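(* Let $k\ge2$ be a constant. If any of #F$k$-OV, #F$k$-SUM, or #F$k$-XOR can be solved in $T(n)$ time then #F$k$-$f$ can be solved in $\tilde{O}(T(n))$ time, for every function $f:(\{0,1\}^b)^k\to\{0,1\}$.
   Context: $g=o(\lg n/\lg\lg n)$, $b=o(\lg n)$. A $(g,b)$-factored vector $v$ is a $g$-tuple of sets $v[i]\subseteq\{0,1\}^b$. For $f:(\{0,1\}^b)^k\to\{0,1\}$, #F$k$-$f$: given $k$ sets $V_1,\dots,V_k$ of $n$ factored vectors each, output $\sum_{v_1\in V_1,\dots,v_k\in V_k}\prod_{i=1}^g\sum_{w_1\in v_1[i],\dots,w_k\in v_k[i]}f(w_1,\dots,w_k)$. #F$k$-OV: $f=1$ iff $\sum_{a=1}^b\prod_j w_j[a]=0$. #F$k$-XOR: $f=1$ iff $w_1\oplus\cdots\oplus w_k=\vec 0$. #F$k$-SUM: $f=1$ iff $w_1+\cdots+w_k=0$ as $b$-bit numbers.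
   Formalization: Since an arbitrary family f may be uncomputable (making the literal claim false), the input of #Fk-f here also contains the truth table of f, with 2^{kb} = n^{o(1)} entries. *)

theory Defs
  imports Complex_Main "HOL-Library.Landau_Symbols"
begin

section \<open>Factored problems\<close>

type_synonym bits = "bool list"
type_synonym fvec = "bits set list"

definition fvecs :: "nat \<Rightarrow> nat \<Rightarrow> fvec set" where
  "fvecs g b = {v. length v = g \<and> (\<forall>A\<in>set v. A \<subseteq> {w. length w = b})}"

definition fk_instance :: "nat \<Rightarrow> nat \<Rightarrow> nat \<Rightarrow> nat \<Rightarrow> fvec set list \<Rightarrow> bool" where
  "fk_instance k n g b Vs \<longleftrightarrow>
     length Vs = k \<and> (\<forall>V\<in>set Vs. V \<subseteq> fvecs g b \<and> card V = n)"

text \<open>\<^const>\<open>listset\<close> \<open>[A\<^sub>1, \<dots>, A\<^sub>k]\<close> is the set of all \<open>[a\<^sub>1, \<dots>, a\<^sub>k]\<close> with \<open>a\<^sub>j \<in> A\<^sub>j\<close>.\<close>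

definition factored_count :: "(bits list \<Rightarrow> bool) \<Rightarrow> nat \<Rightarrow> fvec set list \<Rightarrow> nat" where
  "factored_count f g Vs =
     (\<Sum>vs\<in>listset Vs. \<Prod>i<g. \<Sum>ws\<in>listset (map (\<lambda>v. v ! i) vs). of_bool (f ws))"

text \<open>Bit strings are read as numbers with the least significant bit first.\<close>

definition bits_val :: "bits \<Rightarrow> nat" where
  "bits_val w = horner_sum of_bool 2 w"

definition f_OV :: "nat \<Rightarrow> bits list \<Rightarrow> bool" where
  "f_OV b ws \<longleftrightarrow> (\<Sum>a<b. \<Prod>w\<leftarrow>ws. of_bool (w ! a) :: nat) = 0"

definition f_XOR :: "nat \<Rightarrow> bits list \<Rightarrow> bool" where
  "f_XOR b ws \<longleftrightarrow>
     fold (map2 (\<lambda>x y. x \<noteq> y)) ws (replicate b False) = replicate b False"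

text \<open>Addition of \<open>b\<close>-bit numbers is addition modulo \<open>2 ^ b\<close>.\<close>

definition f_SUM :: "nat \<Rightarrow> bits list \<Rightarrow> bool" where
  "f_SUM b ws \<longleftrightarrow> (\<Sum>w\<leftarrow>ws. bits_val w) mod 2 ^ b = 0"


section \<open>Word RAM\<close>

datatype binop =
  Add | Sub | Mul | Div | Mod | BitAnd | BitOr | BitXor | Shl | Shr | Less | Equal

fun binop_val :: "binop \<Rightarrow> nat \<Rightarrow> nat \<Rightarrow> nat" where
  "binop_val Add x y = x + y"
| "binop_val Sub x y = x - y"
| "binop_val Mul x y = x * y"
| "binop_val Div x y = x div y"
| "binop_val Mod x y = x mod y"
| "binop_val BitAnd x y = and x y"
| "binop_val BitOr x y = or x y"
| "binop_val BitXor x y = xor x y"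
| "binop_val Shl x y = push_bit y x"
| "binop_val Shr x y = drop_bit y x"
| "binop_val Less x y = of_bool (x < y)"
| "binop_val Equal x y = of_bool (x = y)"

text \<open>
  Register arguments are register names. \<open>Load r a\<close> and \<open>Store a r\<close> access the memory cell whose
  address is held in register \<open>a\<close>; conditions test whether a register is nonzero.
\<close>

datatype com =
  Const nat nat
| Op binop nat nat nat
| Load nat nat
| Store nat nat
| Seq com com
| Cond nat com com
| While nat com

type_synonym state = "(nat \<Rightarrow> nat) \<times> (nat \<Rightarrow> nat)"

text \<open>
  \<open>exec w P s t s'\<close>: on a machine with word length \<open>w\<close>, program \<open>P\<close> started in state
  \<open>s = (registers, memory)\<close> halts in state \<open>s'\<close> after exactly \<open>t\<close> unit-cost steps. Every value put
  into a register, hence also every address used and every value stored, has to fit into a word;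
  a computation that overflows has no derivation.
\<close>

inductive exec :: "nat \<Rightarrow> com \<Rightarrow> state \<Rightarrow> nat \<Rightarrow> state \<Rightarrow> bool" for w :: nat where
  Const: "c < 2 ^ w \<Longrightarrow> exec w (Const r c) (R, M) 1 (R(r := c), M)"
| Op: "binop_val bop (R x) (R y) < 2 ^ w \<Longrightarrow>
    exec w (Op bop r x y) (R, M) 1 (R(r := binop_val bop (R x) (R y)), M)"
| Load: "M (R a) < 2 ^ w \<Longrightarrow> exec w (Load r a) (R, M) 1 (R(r := M (R a)), M)"
| Store: "exec w (Store a r) (R, M) 1 (R, M(R a := R r))"
| Seq: "exec w P s t s' \<Longrightarrow> exec w Q s' u s'' \<Longrightarrow> exec w (Seq P Q) s (t + u) s''"
| CondTrue: "R r \<noteq> 0 \<Longrightarrow> exec w P (R, M) t s' \<Longrightarrow> exec w (Cond r P Q) (R, M) (Suc t) s'"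
| CondFalse: "R r = 0 \<Longrightarrow> exec w Q (R, M) t s' \<Longrightarrow> exec w (Cond r P Q) (R, M) (Suc t) s'"
| WhileFalse: "R r = 0 \<Longrightarrow> exec w (While r P) (R, M) 1 (R, M)"
| WhileTrue: "R r \<noteq> 0 \<Longrightarrow> exec w P (R, M) t s' \<Longrightarrow> exec w (While r P) s' u s'' \<Longrightarrow>
    exec w (While r P) (R, M) (Suc (t + u)) s''"

definition initial :: "nat list \<Rightarrow> state" where
  "initial xs = ((\<lambda>_. 0), (\<lambda>i. if i < length xs then xs ! i else 0))"

text \<open>
  The counts need not fit into a constant number of words. A result is left in memory as
  its number of binary digits (without leading zeros), followed by the digits, least significant
  one first.
\<close>

definition result_in :: "(nat \<Rightarrow> nat) \<Rightarrow> nat \<Rightarrow> bool" where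
  "result_in M x \<longleftrightarrow>
     M 0 = (LEAST l. x < 2 ^ l) \<and> (\<forall>i < M 0. M (Suc i) = of_bool (bit x i))"

definition computes_within :: "nat \<Rightarrow> com \<Rightarrow> nat list \<Rightarrow> nat \<Rightarrow> nat \<Rightarrow> bool" where
  "computes_within w P xs t x \<longleftrightarrow>
     (\<exists>t' R M. t' \<le> t \<and> exec w P (initial xs) t' (R, M) \<and> result_in M x)"


section \<open>Solving factored problems on a word RAM\<close>

text \<open>Sets are presented as lists without repetitions, in arbitrary order.\<close>

definition enc_bits_set :: "bits set \<Rightarrow> nat list \<Rightarrow> bool" where
  "enc_bits_set A xs \<longleftrightarrow>
     (\<exists>ws. distinct ws \<and> set ws = A \<and> xs = length ws # map bits_val ws)"

definition enc_fvec :: "fvec \<Rightarrow> nat list \<Rightarrow> bool" where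
  "enc_fvec v xs \<longleftrightarrow> (\<exists>xss. list_all2 enc_bits_set v xss \<and> xs = concat xss)"

definition enc_fvec_set :: "fvec set \<Rightarrow> nat list \<Rightarrow> bool" where
  "enc_fvec_set V xs \<longleftrightarrow>
     (\<exists>vs xss. distinct vs \<and> set vs = V \<and> list_all2 enc_fvec vs xss \<and> xs = concat xss)"

definition enc_instance :: "fvec set list \<Rightarrow> nat list \<Rightarrow> bool" where
  "enc_instance Vs xs \<longleftrightarrow> (\<exists>xss. list_all2 enc_fvec_set Vs xss \<and> xs = concat xss)"

text \<open>Entry \<open>\<Sum>j<k. bits_val w\<^sub>j * 2 ^ (j * b)\<close> of the truth table is \<open>f [w\<^sub>0, \<dots>, w\<^bsub>k-1\<^esub>]\<close>.\<close>

definition truth_table :: "nat \<Rightarrow> nat \<Rightarrow> (bits list \<Rightarrow> bool) \<Rightarrow> nat list" where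
  "truth_table k b f =
     map (\<lambda>x. of_bool (f (map (\<lambda>j. map (\<lambda>a. bit x (j * b + a)) [0..<b]) [0..<k]))) [0..<2 ^ (k * b)]"

definition admissible :: "(nat \<Rightarrow> nat) \<Rightarrow> (nat \<Rightarrow> nat) \<Rightarrow> bool" where
  "admissible g b \<longleftrightarrow>
     (\<lambda>n. real (g n)) \<in> o(\<lambda>n. log 2 (real n) / log 2 (log 2 (real n))) \<and>
     (\<lambda>n. real (b n)) \<in> o(\<lambda>n. log 2 (real n))"

text \<open>
  \<open>f n b\<close> is the function on \<open>({0,1}\<^sup>b)\<^sup>k\<close> used on instances with \<open>n\<close> vectors per set, \<open>aux n b\<close> is
  additional input, and \<open>\<T>\<close> is a class of time bounds such as \<open>O(T)\<close>. A single program has to solve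
  all instances; as \<open>g\<close> and \<open>b\<close> are restricted only asymptotically, the implied constants of
  the running time and of the word length \<open>O(log n)\<close> may depend on the functions \<open>g\<close> and \<open>b\<close>.
\<close>

definition fk_solvable ::
  "nat \<Rightarrow> (nat \<Rightarrow> nat \<Rightarrow> bits list \<Rightarrow> bool) \<Rightarrow> (nat \<Rightarrow> nat \<Rightarrow> nat list) \<Rightarrow> (nat \<Rightarrow> real) set \<Rightarrow> bool" where
  "fk_solvable k f aux \<T> \<longleftrightarrow>
     (\<exists>P. \<forall>g b. admissible g b \<longrightarrow>
       (\<exists>t w. (\<lambda>n. real (t n)) \<in> \<T> \<and> (\<lambda>n. real (w n)) \<in> O(\<lambda>n. log 2 (real n)) \<and>
         (\<forall>n Vs xs. fk_instance k n (g n) (b n) Vs \<longrightarrow> enc_instance Vs xs \<longrightarrow>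
            computes_within (w n) P ([n, g n, b n] @ aux n (b n) @ xs) (t n)
              (factored_count (f n (b n)) (g n) Vs))))"

definition FkOV_solvable :: "nat \<Rightarrow> (nat \<Rightarrow> real) set \<Rightarrow> bool" where
  "FkOV_solvable k = fk_solvable k (\<lambda>n. f_OV) (\<lambda>n b. [])"

definition FkSUM_solvable :: "nat \<Rightarrow> (nat \<Rightarrow> real) set \<Rightarrow> bool" where
  "FkSUM_solvable k = fk_solvable k (\<lambda>n. f_SUM) (\<lambda>n b. [])"

definition FkXOR_solvable :: "nat \<Rightarrow> (nat \<Rightarrow> real) set \<Rightarrow> bool" where
  "FkXOR_solvable k = fk_solvable k (\<lambda>n. f_XOR) (\<lambda>n b. [])"

text \<open>
  An arbitrary \<open>f\<close> need not be computable, so an algorithm for it needs access to \<open>f\<close>: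
  its truth table, of size \<open>2 ^ (k * b)\<close>, is part of the input.
\<close>

definition Fkf_solvable ::
  "nat \<Rightarrow> (nat \<Rightarrow> nat \<Rightarrow> bits list \<Rightarrow> bool) \<Rightarrow> (nat \<Rightarrow> real) set \<Rightarrow> bool" where
  "Fkf_solvable k f = fk_solvable k f (\<lambda>n b. truth_table k b (f n b))"

definition soft_O :: "(nat \<Rightarrow> real) \<Rightarrow> (nat \<Rightarrow> real) set" where
  "soft_O T = (\<Union>p::nat. O(\<lambda>n. T n * log 2 (real n) ^ p))"

end

theory Submission
  imports Defs "HOL-Library.Log_Nat" "HOL-Real_Asymp.Real_Asymp"
begin

text \<open>
  Number the \<open>k\<close>-tuples of words by \<open>u < 2 ^ (k * b)\<close>. In the first set every word \<open>x\<close> is replaced by codes of all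
  tuple numbers whose first digit is \<open>x\<close>, in the other sets by codes of those digits that the set is responsible
  for. A tuple of codes satisfies the target function if and only if the digits fit together to the tuple number
  \<open>u\<close> from the first set and the code of \<open>u\<close> carries no flag; the truth table tells the reduction to flag those \<open>u\<close> at
  which \<open>f\<close> fails. So the satisfying tuples of codes correspond to the satisfying tuples of words. As the codes
  have only \<open>O(k * b)\<close> bits, the new instance is admissible again.

  The reduction takes \<open>O(n * g * 2 ^ (k * b))\<close> steps. This is \<open>O(T)\<close> because a solver of the target problem has to
  read its input: there are instances on which changing any one of many cells changes the count, while the
  result of a run of \<open>t\<close> steps is sensitive to at most \<open>t\<close> cells.
\<close>

section \<open>Executions\<close>

inductive_cases exec_ConstE: "exec w (Const r c) s t s'"
inductive_cases exec_OpE: "exec w (Op bop r x y) s t s'"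
inductive_cases exec_LoadE: "exec w (Load r a) s t s'"
inductive_cases exec_StoreE: "exec w (Store a r) s t s'"
inductive_cases exec_SeqE: "exec w (Seq P Q) s t s'"
inductive_cases exec_CondE: "exec w (Cond r P Q) s t s'"
inductive_cases exec_WhileE: "exec w (While r P) s t s'"

lemmas exec_intros = exec.intros[unfolded One_nat_def]

lemma exec_word_length_mono:
  assumes "exec w P s t s'" "w \<le> w'"
  shows "exec w' P s t s'"
proof -
  have fits: "x < 2 ^ w \<Longrightarrow> x < 2 ^ w'" for x :: nat
    using assms(2) by (meson less_le_trans one_le_numeral power_increasing)
  show ?thesis
    using assms(1) by (induction rule: exec.induct) (auto intro: exec_intros fits)
qed

lemma exec_deterministic:
  assumes "exec w P s t s'" "exec w P s u s''"
  shows "u = t \<and> s'' = s'"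
  using assms
proof (induction arbitrary: u s'' rule: exec.induct)
  case (Seq P s t s' Q u s'')
  from Seq.prems show ?case
    by (rule exec_SeqE) (use Seq.IH in blast)
next
  case (CondTrue R r P M t s' Q)
  from CondTrue.prems CondTrue.hyps(1) obtain v where "u = Suc v" "exec w P (R, M) v s''"
    by (elim exec_CondE) auto
  then show ?case
    using CondTrue.IH by blast
next
  case (CondFalse R r P M t s' Q)
  from CondFalse.prems CondFalse.hyps(1) obtain v where "u = Suc v" "exec w P (R, M) v s''"
    by (elim exec_CondE) auto
  then show ?case
    using CondFalse.IH by blast
next
  case (WhileFalse R r P M)
  from WhileFalse.prems show ?case
    by (rule exec_WhileE) (use WhileFalse.hyps in auto)
next
  case (WhileTrue R r P M t s' u s'' v s3)
  from WhileTrue.prems obtain t2 s2 u2 where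
    "v = Suc (t2 + u2)" "exec w P (R, M) t2 s2" "exec w (While r P) s2 u2 s3"
    by (rule exec_WhileE) (use WhileTrue.hyps(1) in auto)
  then show ?case
    using WhileTrue.IH by blast
qed (erule exec_ConstE exec_OpE exec_LoadE exec_StoreE, simp)+

definition poke :: "nat \<Rightarrow> nat \<Rightarrow> state \<Rightarrow> state" where
  "poke c v s = (fst s, (snd s)(c := v))"

lemma poke_Pair [simp]: "poke c v (R, M) = (R, M(c := v))"
  by (simp add: poke_def)

text \<open>A cell that is never loaded is not sensitive: its final content is either still the initial
  one or has been overwritten independently of the initial one.\<close>

definition sensitive :: "nat \<Rightarrow> com \<Rightarrow> state \<Rightarrow> nat \<Rightarrow> state \<Rightarrow> nat set" where
  "sensitive w P s t s' = {c. \<not> (\<forall>v. exec w P (poke c v s) t s' \<or>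
     snd s' c = snd s c \<and> exec w P (poke c v s) t (poke c v s'))}"

lemma sensitive_Const: "c < 2 ^ w \<Longrightarrow> sensitive w (Const r c) (R, M) 1 (R(r := c), M) = {}"
  unfolding sensitive_def by (auto intro: exec_intros)

lemma sensitive_Op:
  "binop_val bop (R x) (R y) < 2 ^ w \<Longrightarrow>
    sensitive w (Op bop r x y) (R, M) 1 (R(r := binop_val bop (R x) (R y)), M) = {}"
  unfolding sensitive_def by (auto intro: exec_intros)

lemma sensitive_Load:
  assumes "M (R a) < 2 ^ w"
  shows "sensitive w (Load r a) (R, M) 1 (R(r := M (R a)), M) \<subseteq> {R a}"
proof -
  have "exec w (Load r a) (R, M(c := v)) 1 (R(r := M (R a)), M(c := v))" if "c \<noteq> R a" for c v
    using assms exec.Load[of "M(c := v)" R a w r] that by simp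
  then show ?thesis
    unfolding sensitive_def by fastforce
qed

lemma sensitive_Store: "sensitive w (Store a r) (R, M) 1 (R, M(R a := R r)) = {}"
proof -
  have "exec w (Store a r) (R, M(c := v)) 1 (R, M(R a := R r)) \<or> (M(R a := R r)) c = M c \<and>
      exec w (Store a r) (R, M(c := v)) 1 (R, M(R a := R r, c := v))" for c v
    using exec.Store[of w a r R "M(c := v)"]
    by (cases "c = R a") (simp_all add: fun_upd_twist del: One_nat_def)
  then show ?thesis
    unfolding sensitive_def poke_Pair snd_conv by blast
qed

lemma sensitive_Seq:
  assumes "exec w Q s' u s''"
  shows "sensitive w (Seq P Q) s (t + u) s'' \<subseteq> sensitive w P s t s' \<union> sensitive w Q s' u s''"
proof
  fix c
  assume "c \<in> sensitive w (Seq P Q) s (t + u) s''"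
  then show "c \<in> sensitive w P s t s' \<union> sensitive w Q s' u s''"
    unfolding sensitive_def mem_Collect_eq Un_iff using assms exec.Seq[of w P "poke c _ s" t] by metis
qed

lemma sensitive_step:
  assumes "\<And>M s'. exec w P (R, M) t s' \<Longrightarrow> exec w Q (R, M) (Suc t) s'"
  shows "sensitive w Q (R, M) (Suc t) s' \<subseteq> sensitive w P (R, M) t s'"
  unfolding sensitive_def poke_Pair fst_conv snd_conv using assms by blast

lemma sensitive_WhileFalse: "R r = 0 \<Longrightarrow> sensitive w (While r P) (R, M) 1 (R, M) = {}"
  unfolding sensitive_def by (auto intro: exec_intros)

lemma sensitive_WhileTrue:
  assumes "R r \<noteq> 0" "exec w (While r P) s' u s''"
  shows "sensitive w (While r P) (R, M) (Suc (t + u)) s'' \<subseteq>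
    sensitive w P (R, M) t s' \<union> sensitive w (While r P) s' u s''"
proof
  fix c
  assume "c \<in> sensitive w (While r P) (R, M) (Suc (t + u)) s''"
  then show "c \<in> sensitive w P (R, M) t s' \<union> sensitive w (While r P) s' u s''"
    unfolding sensitive_def mem_Collect_eq Un_iff poke_Pair snd_conv
    using assms exec.WhileTrue[of R r w P _ t] by metis
qed

lemma card_sensitive:
  assumes "exec w P s t s'"
  shows "finite (sensitive w P s t s') \<and> card (sensitive w P s t s') \<le> t"
proof -
  have finite_card_subset: "finite A \<and> card A \<le> u" if "A \<subseteq> B" "finite B \<and> card B \<le> t" "t \<le> u"
    for A B :: "nat set" and t u
    using that by (meson card_mono finite_subset le_trans)
  have finite_card_Un: "finite (A \<union> B) \<and> card (A \<union> B) \<le> t + u"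
    if "finite A \<and> card A \<le> t" "finite B \<and> card B \<le> u" for A B :: "nat set" and t u
    using that card_Un_le[of A B] by simp
  show ?thesis
    using assms
  proof (induction rule: exec.induct)
    case Load
    then show ?case
      by (intro finite_card_subset[OF sensitive_Load, where t = 1]) simp_all
  next
    case Seq
    show ?case
      by (rule finite_card_subset[OF sensitive_Seq[OF Seq.hyps(2)] finite_card_Un[OF Seq.IH] order_refl])
  next
    case (CondTrue R r P M t s' Q)
    show ?case
      by (rule finite_card_subset[OF sensitive_step CondTrue.IH])
        (auto intro: exec.CondTrue[of R r, OF CondTrue.hyps(1)])
  next
    case (CondFalse R r P M t s' Q)
    show ?case
      by (rule finite_card_subset[OF sensitive_step CondFalse.IH])
        (auto intro: exec.CondFalse[of R r, OF CondFalse.hyps(1)])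
  next
    case WhileTrue
    show ?case
      by (rule finite_card_subset[OF sensitive_WhileTrue finite_card_Un[OF WhileTrue.IH]])
        (use WhileTrue.hyps in auto)
  qed (simp_all only: sensitive_Const sensitive_Op sensitive_Store sensitive_WhileFalse finite.emptyI
    card.empty le0 simp_thms)
qed

definition wp :: "nat \<Rightarrow> com \<Rightarrow> (nat \<Rightarrow> state \<Rightarrow> bool) \<Rightarrow> state \<Rightarrow> bool" where
  "wp w P Q s \<longleftrightarrow> (\<exists>t s'. exec w P s t s' \<and> Q t s')"

lemma wp_Const: "wp w (Const r c) Q (R, M) \<longleftrightarrow> c < 2 ^ w \<and> Q 1 (R(r := c), M)"
  unfolding wp_def One_nat_def by (blast intro: exec_intros elim: exec_ConstE)

lemma wp_Op: "wp w (Op bop r x y) Q (R, M) \<longleftrightarrow>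
    binop_val bop (R x) (R y) < 2 ^ w \<and> Q 1 (R(r := binop_val bop (R x) (R y)), M)"
  unfolding wp_def One_nat_def by (blast intro: exec_intros elim: exec_OpE)

lemma wp_Load: "wp w (Load r a) Q (R, M) \<longleftrightarrow> M (R a) < 2 ^ w \<and> Q 1 (R(r := M (R a)), M)"
  unfolding wp_def One_nat_def by (blast intro: exec_intros elim: exec_LoadE)

lemma wp_Store: "wp w (Store a r) Q (R, M) \<longleftrightarrow> Q 1 (R, M(R a := R r))"
  unfolding wp_def One_nat_def by (blast intro: exec_intros elim: exec_StoreE)

lemma wp_Seq: "wp w (Seq P P') Q s \<longleftrightarrow> wp w P (\<lambda>t. wp w P' (\<lambda>u. Q (t + u))) s"
  unfolding wp_def by (blast intro: exec.Seq elim: exec_SeqE)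

lemma wp_While: "wp w (While r P) Q (R, M) \<longleftrightarrow>
    (if R r = 0 then Q 1 (R, M) else wp w (Seq P (While r P)) (\<lambda>t. Q (Suc t)) (R, M))"
proof -
  have "wp w (While r P) Q (R, M) \<longleftrightarrow> Q 1 (R, M)" if "R r = 0"
    using that exec.WhileFalse[of R r w P M] unfolding wp_def by (auto elim: exec_WhileE)
  moreover have "wp w (While r P) Q (R, M) \<longleftrightarrow> wp w (Seq P (While r P)) (\<lambda>t. Q (Suc t)) (R, M)"
    if "R r \<noteq> 0"
  proof -
    have "exec w (While r P) (R, M) t s' \<longleftrightarrow> (\<exists>u. t = Suc u \<and> exec w (Seq P (While r P)) (R, M) u s')" for t s'
    proof
      assume "exec w (While r P) (R, M) t s'"
      then show "\<exists>u. t = Suc u \<and> exec w (Seq P (While r P)) (R, M) u s'"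
        by (rule exec_WhileE) (use that in \<open>simp, metis exec.Seq\<close>)
    next
      assume "\<exists>u. t = Suc u \<and> exec w (Seq P (While r P)) (R, M) u s'"
      then show "exec w (While r P) (R, M) t s'"
        by (elim exE conjE exec_SeqE) (simp only: exec.WhileTrue[of R, OF that])
    qed
    then show ?thesis
      unfolding wp_def by auto
  qed
  ultimately show ?thesis
    by simp
qed

lemmas wp_straight_line = wp_Const wp_Op wp_Load wp_Store wp_Seq

lemma wp_mono: "wp w P Q s \<Longrightarrow> (\<And>t s'. Q t s' \<Longrightarrow> Q' t s') \<Longrightarrow> wp w P Q' s"
  unfolding wp_def by blast

section \<open>Bits of natural numbers\<close>

definition bits_of :: "nat \<Rightarrow> nat \<Rightarrow> bits" where
  "bits_of b x = map (bit x) [0..<b]"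

lemma length_bits_of [simp]: "length (bits_of b x) = b"
  by (simp add: bits_of_def)

lemma nth_bits_of [simp]: "a < b \<Longrightarrow> bits_of b x ! a = bit x a"
  by (simp add: bits_of_def)

lemma bits_val_bits_of: "x < 2 ^ b \<Longrightarrow> bits_val (bits_of b x) = x"
  by (simp add: bits_val_def bits_of_def horner_sum_bit_eq_take_bit take_bit_nat_eq_self)

lemma bit_bits_val: "bit (bits_val w) a \<longleftrightarrow> a < length w \<and> w ! a"
  by (simp add: bits_val_def bit_horner_sum_bit_iff)

lemma bits_of_bits_val: "length w = b \<Longrightarrow> bits_of b (bits_val w) = w"
  by (rule nth_equalityI) (simp_all add: bit_bits_val)

lemma inj_on_bits_of: "inj_on (bits_of b) {..<2 ^ b}"
  by (rule inj_on_inverseI[of _ bits_val]) (simp add: bits_val_bits_of)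

lemma less_power_2_iff: "(x::nat) < 2 ^ n \<longleftrightarrow> (\<forall>a. bit x a \<longrightarrow> a < n)"
  by (auto simp: bit_eq_iff bit_take_bit_iff simp flip: take_bit_nat_eq_self_iff)

lemma bits_val_less: "length w = b \<Longrightarrow> bits_val w < 2 ^ b"
  by (simp add: less_power_2_iff bit_bits_val)

definition submask :: "nat \<Rightarrow> nat \<Rightarrow> bool" where
  "submask x m \<longleftrightarrow> and x m = x"

lemma submask_iff: "submask x m \<longleftrightarrow> (\<forall>a. bit x a \<longrightarrow> bit m a)"
  by (auto simp: submask_def bit_eq_iff bit_and_iff)

lemma submask_and: "submask (and x m) m"
  by (simp add: submask_iff bit_and_iff)

lemma submask_mask_iff: "submask x (mask n) \<longleftrightarrow> x < 2 ^ n"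
  by (simp add: submask_iff bit_mask_iff less_power_2_iff)

lemma submask_less: "submask x m \<Longrightarrow> m < 2 ^ n \<Longrightarrow> x < 2 ^ n"
  by (auto simp: submask_iff less_power_2_iff)

lemma submask_add_xor:
  assumes "submask x m"
  shows "x + xor m x = m"
proof -
  have "x + xor m x = or x (xor m x)"
    using assms by (intro disjunctive_add) (auto simp: submask_iff bit_xor_iff)
  also have "\<dots> = m"
    using assms by (auto simp: bit_eq_iff bit_or_iff bit_xor_iff submask_iff)
  finally show ?thesis .
qed

lemma submask_le: "submask x m \<Longrightarrow> x \<le> m"
  using submask_add_xor by (metis le_add1)

lemma bit_diff_submask:
  assumes "submask x m"
  shows "bit (m - x) a \<longleftrightarrow> bit m a \<and> \<not> bit x a"
proof -
  have "m - x = xor m x"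
    using submask_add_xor[OF assms] by linarith
  then show ?thesis
    using assms by (auto simp: bit_xor_iff submask_iff)
qed

lemma bit_add_shifted:
  assumes "x < 2 ^ n"
  shows "bit (x + 2 ^ n * y :: nat) a \<longleftrightarrow> (if a < n then bit x a else bit y (a - n))"
proof -
  have "bit (x + push_bit n y) a \<longleftrightarrow> bit x a \<or> bit (push_bit n y) a"
    using assms by (intro bit_disjunctive_add_iff) (auto simp: bit_push_bit_iff less_power_2_iff)
  then show ?thesis
    using assms by (auto simp: push_bit_eq_mult mult.commute bit_push_bit_iff less_power_2_iff
      simp flip: push_bit_eq_mult)
qed

definition disjoint_bits :: "('i \<Rightarrow> nat) \<Rightarrow> 'i set \<Rightarrow> bool" where
  "disjoint_bits y J \<longleftrightarrow> (\<forall>i\<in>J. \<forall>j\<in>J. \<forall>a. bit (y i) a \<longrightarrow> bit (y j) a \<longrightarrow> i = j)"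

lemma bit_sum_disjoint:
  assumes "finite J" "disjoint_bits y J"
  shows "bit (\<Sum>j\<in>J. y j) a \<longleftrightarrow> (\<exists>j\<in>J. bit (y j) a)"
  using assms
proof (induction J arbitrary: a rule: finite_induct)
  case (insert i J)
  then have IH: "bit (\<Sum>j\<in>J. y j) c \<longleftrightarrow> (\<exists>j\<in>J. bit (y j) c)" for c
    by (simp add: disjoint_bits_def)
  have "bit (y i + (\<Sum>j\<in>J. y j)) a \<longleftrightarrow> bit (y i) a \<or> bit (\<Sum>j\<in>J. y j) a"
    using insert.prems insert.hyps(2) by (intro bit_disjunctive_add_iff) (auto simp: IH disjoint_bits_def)
  then show ?case
    using insert.hyps IH by simp
qed simp

lemma fold_xor_disjoint:
  assumes "distinct js" "disjoint_bits y (set js)"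
  shows "fold xor (map y js) z = xor z (\<Sum>j\<in>set js. y j)"
  using assms
proof (induction js arbitrary: z)
  case (Cons i js)
  then have disjoint: "disjoint_bits y (set js)"
    by (simp add: disjoint_bits_def)
  have "and (y i) (\<Sum>j\<in>set js. y j) = 0"
    using Cons.prems by (auto simp: bit_eq_iff bit_and_iff bit_sum_disjoint[OF _ disjoint] disjoint_bits_def)
  then have "y i + (\<Sum>j\<in>set js. y j) = xor (y i) (\<Sum>j\<in>set js. y j)"
    by (rule disjunctive_add_eq_xor)
  then show ?case
    using Cons.IH[OF _ disjoint] Cons.prems(1) by (simp add: xor.assoc xor.commute[of "y i" z])
qed simp

lemma f_OV_bits_of: "f_OV b (map (bits_of b) xs) \<longleftrightarrow> (\<forall>a<b. \<exists>x\<in>set xs. \<not> bit x a)"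
proof -
  have "(\<Prod>w\<leftarrow>map (bits_of b) xs. of_bool (w ! a) :: nat) = 0 \<longleftrightarrow> (\<exists>x\<in>set xs. \<not> bit x a)" if "a < b" for a
    using that by (induction xs) auto
  then show ?thesis
    by (auto simp: f_OV_def)
qed

lemma f_XOR_bits_of:
  assumes "fold xor xs 0 < 2 ^ b"
  shows "f_XOR b (map (bits_of b) xs) \<longleftrightarrow> fold xor xs 0 = 0"
proof -
  have xor: "map2 (\<lambda>x y. x \<noteq> y) (bits_of b x) (bits_of b z) = bits_of b (xor x z)" for x z
    by (rule nth_equalityI) (simp_all add: bit_xor_iff)
  have "fold (map2 (\<lambda>x y. x \<noteq> y)) (map (bits_of b) xs) (bits_of b z) = bits_of b (fold xor xs z)" for z
    by (induction xs arbitrary: z) (simp_all only: list.map fold_simps xor)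
  moreover have "replicate b False = bits_of b 0"
    by (rule nth_equalityI) simp_all
  ultimately have "f_XOR b (map (bits_of b) xs) \<longleftrightarrow> bits_of b (fold xor xs 0) = bits_of b 0"
    by (simp add: f_XOR_def)
  also have "\<dots> \<longleftrightarrow> fold xor xs 0 = 0"
    using assms inj_on_eq_iff[OF inj_on_bits_of] by simp
  finally show ?thesis .
qed

lemma f_SUM_bits_of:
  assumes "\<And>x. x \<in> set xs \<Longrightarrow> x < 2 ^ b"
  shows "f_SUM b (map (bits_of b) xs) \<longleftrightarrow> sum_list xs mod 2 ^ b = 0"
proof -
  have "map (bits_val \<circ> bits_of b) xs = xs"
    using assms by (intro map_idI) (simp add: bits_val_bits_of)
  then show ?thesis
    by (simp add: f_SUM_def comp_def)
qed

section \<open>Encoding the words of a tuple\<close>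

datatype problem = FOV | FXOR | FSUM

fun target :: "problem \<Rightarrow> nat \<Rightarrow> bits list \<Rightarrow> bool" where
  "target FOV = f_OV"
| "target FXOR = f_XOR"
| "target FSUM = f_SUM"

text \<open>A tuple of \<open>k\<close> words of length \<open>b\<close> is read as one number \<open>u < 2 ^ (k * b)\<close> with digits in base \<open>2 ^ b\<close>.
  The first set is responsible for all digits, the second one for the first two digits, and each
  further set for its own digit.\<close>

locale digit_code =
  fixes k b :: nat
  assumes two_le_k: "2 \<le> k"
begin

definition digit :: "nat \<Rightarrow> nat \<Rightarrow> nat" where
  "digit j u = u div 2 ^ (j * b) mod 2 ^ b"

definition block :: "nat \<Rightarrow> nat" where
  "block j = (if j = 0 then mask (k * b) else if j = 1 then mask (2 * b) else push_bit (j * b) (mask b))"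

lemma bit_digit: "bit (digit j u) a \<longleftrightarrow> a < b \<and> bit u (j * b + a)"
  unfolding digit_def by (auto simp: bit_simps simp flip: take_bit_eq_mod drop_bit_eq_div)

lemma digit_less: "digit j u < 2 ^ b"
  by (simp add: digit_def)

lemma bit_block:
  assumes "j \<in> {1..<k}"
  shows "bit (block j) a \<longleftrightarrow> a < k * b \<and> j = max 1 (a div b)"
proof (cases "b = 0")
  case False
  then have less: "a div b < i \<longleftrightarrow> a < i * b" for i
    by (simp add: div_less_iff_less_mult)
  show ?thesis
  proof (cases "j = 1")
    case True
    have "a < k * b" if "a < 2 * b"
      using that two_le_k by (meson less_le_trans mult_le_mono1)
    then show ?thesis
      using True less[of 2] by (auto simp: block_def bit_mask_iff max_def)
  next
    case False
    have "bit (block j) a \<longleftrightarrow> j * b \<le> a \<and> a < Suc j * b"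
      using False assms by (auto simp: block_def bit_push_bit_iff bit_mask_iff)
    also have "\<dots> \<longleftrightarrow> a div b = j"
      using less[of j] less[of "Suc j"] by linarith
    also have "\<dots> \<longleftrightarrow> a < k * b \<and> j = max 1 (a div b)"
      using False assms less[of k] by auto
    finally show ?thesis .
  qed
next
  case True
  then have "mask (i * b) = (0::nat)" "mask b = (0::nat)" for i
    by simp_all
  then show ?thesis
    unfolding block_def using True by simp
qed

lemma block_less:
  assumes "j < k"
  shows "block j < 2 ^ (k * b)"
  unfolding less_power_2_iff
  using assms bit_block[of j] by (cases "j = 0") (auto simp: block_def bit_mask_iff)

lemma submask_block_less: "submask y (block j) \<Longrightarrow> j < k \<Longrightarrow> y < 2 ^ (k * b)"
  using submask_less block_less by blast

lemma submask_block_0 [simp]: "submask u (block 0) \<longleftrightarrow> u < 2 ^ (k * b)"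
  by (simp add: block_def submask_mask_iff)

lemma digit_and_block:
  assumes "j < k"
  shows "digit j (and u (block j)) = digit j u"
proof -
  have "bit (block j) (j * b + a)" if "a < b" for a
  proof (cases "j \<le> 1")
    case True
    have "a < k * b"
      using that two_le_k mult_le_mono1[of 1 k b] by linarith
    then have "j * b + a < (if j = 0 then k * b else 2 * b)"
      using True that by (cases "j = 0") (auto simp: le_Suc_eq)
    then show ?thesis
      using True by (cases "j = 0") (auto simp: block_def bit_mask_iff)
  qed (use that in \<open>auto simp: block_def bit_push_bit_iff bit_mask_iff\<close>)
  then show ?thesis
    by (auto simp: bit_eq_iff bit_digit bit_and_iff)
qed

lemma disjoint_submasks:
  assumes "\<forall>j\<in>{1..<k}. submask (y j) (block j)"
  shows "disjoint_bits y {1..<k}"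
  unfolding disjoint_bits_def using assms bit_block by (metis submask_iff)

lemma bit_sum_submasks:
  assumes "\<forall>j\<in>{1..<k}. submask (y j) (block j)"
  shows "bit (\<Sum>j\<in>{1..<k}. y j) a \<longleftrightarrow> (\<exists>j\<in>{1..<k}. bit (y j) a)"
  by (rule bit_sum_disjoint[OF finite_atLeastLessThan disjoint_submasks[OF assms]])

lemma sum_submasks_less:
  assumes "\<forall>j\<in>{1..<k}. submask (y j) (block j)"
  shows "(\<Sum>j\<in>{1..<k}. y j) < 2 ^ (k * b)"
proof -
  have "a < k * b" if "bit (\<Sum>j\<in>{1..<k}. y j) a" for a
    using that assms bit_block unfolding bit_sum_submasks[OF assms] by (meson submask_iff)
  then show ?thesis
    by (simp add: less_power_2_iff)
qed

lemma eq_sum_submasks_iff: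
  assumes "u < 2 ^ (k * b)" and submasks: "\<forall>j\<in>{1..<k}. submask (y j) (block j)"
  shows "u = (\<Sum>j\<in>{1..<k}. y j) \<longleftrightarrow> (\<forall>j\<in>{1..<k}. y j = and u (block j))"
proof -
  note bit_sum = bit_sum_submasks[of y, OF submasks]
  have own: "bit (block j) a \<and> j = max 1 (a div b)" if "j \<in> {1..<k}" "bit (y j) a" for j a
    using that submasks bit_block[OF that(1)] by (metis submask_iff)
  show ?thesis
  proof
    assume sum_eq: "u = (\<Sum>j\<in>{1..<k}. y j)"
    have "bit (y j) a \<longleftrightarrow> bit u a \<and> bit (block j) a" if "j \<in> {1..<k}" for j a
      unfolding sum_eq bit_sum using that own bit_block[OF that] by metis
    then show "\<forall>j\<in>{1..<k}. y j = and u (block j)"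
      by (auto simp: bit_eq_iff bit_and_iff)
  next
    assume y_eq: "\<forall>j\<in>{1..<k}. y j = and u (block j)"
    have "bit u a \<longleftrightarrow> (\<exists>j\<in>{1..<k}. bit u a \<and> bit (block j) a)" for a
    proof (cases "bit u a")
      case True
      then have "a < k * b"
        using assms(1) by (auto simp: less_power_2_iff)
      then have "max 1 (a div b) \<in> {1..<k}"
        using two_le_k by (auto simp: less_mult_imp_div_less)
      then show ?thesis
        using True \<open>a < k * b\<close> bit_block by blast
    qed simp
    then show "u = (\<Sum>j\<in>{1..<k}. y j)"
      using y_eq by (simp add: bit_eq_iff bit_sum bit_and_iff del: One_nat_def)
  qed
qed

abbreviation Z :: nat where
  "Z \<equiv> 2 ^ (k * b)"

fun width :: "problem \<Rightarrow> nat" where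
  "width FOV = k * b + (k * b + 1)"
| "width FXOR = k * b + 1"
| "width FSUM = k * b + 2"

fun flag :: "problem \<Rightarrow> nat" where
  "flag FOV = Z * Z"
| "flag FXOR = Z"
| "flag FSUM = Z"

text \<open>In each case the target function compares the number \<open>u\<close> of the first set with the sum of the disjoint
  blocks of the others. \<open>FXOR\<close>: this sum is also their exclusive or. \<open>FSUM\<close>: the codes add up to \<open>0\<close> modulo
  \<open>4 * Z\<close> if the two are equal. \<open>FOV\<close>: the lower halves of the codes are orthogonal if every bit of \<open>u\<close> is set
  in some block, the upper halves if every bit that is not set in \<open>u\<close> is missing in its block, and a flag
  violates orthogonality in the top bit.\<close>

fun unflagged :: "problem \<Rightarrow> nat \<Rightarrow> nat \<Rightarrow> nat" where
  "unflagged FOV j y = (if j = 0 then y + Z * (mask (k * b) - y)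
     else (mask (k * b) - y) + Z * (mask (k * b) - block j + y + Z))"
| "unflagged FXOR j y = y"
| "unflagged FSUM j y = (if j = 0 then Z - y else if j = 1 then 3 * Z + y else y)"

definition code :: "problem \<Rightarrow> (nat \<Rightarrow> bool) \<Rightarrow> nat \<Rightarrow> nat \<Rightarrow> nat" where
  "code prob T j y = unflagged prob j y + (if j = 0 \<and> \<not> T y then flag prob else 0)"

lemma le_mask_iff: "x \<le> mask (k * b) \<longleftrightarrow> x < Z"
  by (simp add: mask_eq_exp_minus_1 Suc_le_eq flip: less_Suc_eq_le)

lemma coblock_plus_less:
  assumes "submask y (block j)" "j < k"
  shows "mask (k * b) - block j + y < Z"
proof -
  have "y \<le> block j"
    using assms(1) by (rule submask_le)
  moreover have "block j \<le> mask (k * b)"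
    using block_less[OF assms(2)] by (simp add: le_mask_iff)
  ultimately show ?thesis
    using le_mask_iff[of "mask (k * b)"] by linarith
qed

lemma code_less:
  assumes "submask y (block j)" "j < k"
  shows "code prob T j y < 2 ^ width prob"
proof -
  have y_less: "y < Z"
    using submask_block_less assms .
  show ?thesis
  proof (cases prob)
    case FOV
    let ?F = "mask (k * b) :: nat"
    have "?F < Z"
      by (simp flip: le_mask_iff)
    have less: "u + Z * v < Z * (2 * Z)" if "u < Z" "v < 2 * Z" for u v
    proof -
      have "u + Z * v < Z * Suc v"
        using that(1) by simp
      also have "\<dots> \<le> Z * (2 * Z)"
        using that(2) by (intro mult_le_mono) simp_all
      finally show ?thesis .
    qed
    have "code prob T j y = (if j = 0 then y + Z * (?F - y + (if T y then 0 else Z))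
        else ?F - y + Z * (?F - block j + y + Z))"
      using FOV by (simp add: code_def distrib_left)
    also have "\<dots> < Z * (2 * Z)"
    proof (cases "j = 0")
      case True
      have "?F - y + (if T y then 0 else Z) < 2 * Z"
        using \<open>?F < Z\<close> by (split if_split) linarith
      then show ?thesis
        using True less[OF y_less] by simp
    next
      case False
      have "?F - y < Z" "?F - block j + y + Z < 2 * Z"
        using \<open>?F < Z\<close> coblock_plus_less[OF assms] by linarith+
      then show ?thesis
        using False less by simp
    qed
    finally show ?thesis
      using FOV by (simp add: power_add)
  qed (use y_less in \<open>auto simp: code_def\<close>)
qed

lemma code_eq_iff:
  assumes "submask u (block j)" "submask u' (block j)" "j < k"
  shows "code prob T j u = code prob T' j u' \<longleftrightarrow> u = u' \<and> (j = 0 \<longrightarrow> T u = T' u')"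
proof -
  have less: "u < Z" "u' < Z"
    using assms submask_block_less by blast+
  show ?thesis
  proof (cases prob)
    case FOV
    let ?F = "mask (k * b) :: nat"
    have mod: "code FOV T j u mod Z = (if j = 0 then u else ?F - u)" if "u < Z" for T u
    proof -
      have "code FOV T j u = (if j = 0 then u else ?F - u) +
          Z * (if j = 0 then ?F - u + (if T u then 0 else Z) else ?F - block j + u + Z)"
        by (simp add: code_def distrib_left)
      moreover have "(if j = 0 then u else ?F - u) < Z"
        using that by (simp add: mask_eq_exp_minus_1)
      ultimately show ?thesis
        by (simp only: mod_mult_self2 mod_less)
    qed
    have "u = u'" if "code FOV T j u = code FOV T' j u'"
    proof -
      have "(if j = 0 then u else ?F - u) = (if j = 0 then u' else ?F - u')"
        using mod[OF less(1), of T] mod[OF less(2), of T'] that by simp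
      moreover have "u \<le> ?F" "u' \<le> ?F"
        using less by (simp_all add: le_mask_iff)
      ultimately show ?thesis
        by (auto split: if_splits)
    qed
    then show ?thesis
      using FOV by (auto simp: code_def)
  qed (use less in \<open>auto simp: code_def split: if_splits\<close>)
qed

lemma map_upt_Cons: "map c [0..<k] = c 0 # map c [1..<k]"
  using two_le_k by (simp add: upt_conv_Cons)

lemma target_codes_iff_FXOR:
  assumes "y 0 < Z" "\<forall>j\<in>{1..<k}. submask (y j) (block j)"
  shows "target FXOR (width FXOR) (map (bits_of (width FXOR)) (map (\<lambda>j. code FXOR T j (y j)) [0..<k])) \<longleftrightarrow>
    T (y 0) \<and> y 0 = (\<Sum>j\<in>{1..<k}. y j)"
proof -
  let ?S = "\<Sum>j\<in>{1..<k}. y j" and ?c = "\<lambda>j. code FXOR T j (y j)"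
  have sum_less: "?S < Z"
    using sum_submasks_less[OF assms(2)] .
  have tail: "map ?c [1..<k] = map y [1..<k]"
    by (simp add: code_def)
  have fold: "fold xor (map ?c [0..<k]) 0 = xor (?c 0) ?S"
    unfolding map_upt_Cons tail using fold_xor_disjoint[of "[1..<k]" y "?c 0"] disjoint_submasks[OF assms(2)]
    by simp
  have "?c 0 < 2 ^ width FXOR" "?S < 2 ^ width FXOR"
    using code_less[of "y 0" 0 FXOR T] assms(1) sum_less two_le_k by simp_all
  then have "xor (?c 0) ?S < 2 ^ width FXOR"
    unfolding less_power_2_iff bit_xor_iff by blast
  then have "target FXOR (width FXOR) (map (bits_of (width FXOR)) (map ?c [0..<k])) \<longleftrightarrow> xor (?c 0) ?S = 0"
    using f_XOR_bits_of[of "map ?c [0..<k]" "width FXOR"] unfolding fold target.simps by simp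
  also have "\<dots> \<longleftrightarrow> ?c 0 = ?S"
    by (auto simp: bit_eq_iff bit_xor_iff)
  also have "\<dots> \<longleftrightarrow> T (y 0) \<and> y 0 = ?S"
    using sum_less by (auto simp: code_def)
  finally show ?thesis .
qed

lemma target_codes_iff_FSUM:
  assumes "y 0 < Z" "\<forall>j\<in>{1..<k}. submask (y j) (block j)"
  shows "target FSUM (width FSUM) (map (bits_of (width FSUM)) (map (\<lambda>j. code FSUM T j (y j)) [0..<k])) \<longleftrightarrow>
    T (y 0) \<and> y 0 = (\<Sum>j\<in>{1..<k}. y j)"
proof -
  let ?S = "\<Sum>j\<in>{1..<k}. y j" and ?c = "\<lambda>j. code FSUM T j (y j)"
  have sum_less: "?S < Z"
    using sum_submasks_less[OF assms(2)] .
  have less: "?c j < 2 ^ width FSUM" if "j < k" for j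
    using that assms by (cases "j = 0") (auto intro: code_less simp del: width.simps)
  have "(\<Sum>j\<in>{1..<k}. ?c j) = (\<Sum>j\<in>{1..<k}. y j + (if j = 1 then 3 * Z else 0))"
    by (intro sum.cong) (auto simp: code_def)
  also have "\<dots> = ?S + 3 * Z"
    using two_le_k by (simp add: sum.distrib)
  finally have sum: "sum_list (map ?c [0..<k]) = ?c 0 + ?S + 3 * Z"
    unfolding map_upt_Cons by (simp add: interv_sum_list_conv_sum_set_nat)
  have "target FSUM (width FSUM) (map (bits_of (width FSUM)) (map ?c [0..<k])) \<longleftrightarrow>
      sum_list (map ?c [0..<k]) mod 2 ^ width FSUM = 0"
    unfolding target.simps by (rule f_SUM_bits_of) (use less in auto)
  also have "\<dots> \<longleftrightarrow> (?c 0 + ?S + 3 * Z) mod (4 * Z) = 0"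
    unfolding sum by simp
  also have "\<dots> \<longleftrightarrow> ?c 0 + ?S + 3 * Z = 4 * Z"
  proof
    assume "(?c 0 + ?S + 3 * Z) mod (4 * Z) = 0"
    then obtain q where quotient: "?c 0 + ?S + 3 * Z = 4 * Z * q"
      by (meson mod_0_imp_dvd dvdE)
    have "0 < ?c 0 + ?S + 3 * Z" "?c 0 + ?S + 3 * Z < 4 * Z * 2"
      using assms(1) sum_less by (auto simp: code_def)
    then have "q = 1"
      unfolding quotient by simp
    then show "?c 0 + ?S + 3 * Z = 4 * Z"
      using quotient by simp
  qed simp
  also have "\<dots> \<longleftrightarrow> T (y 0) \<and> y 0 = ?S"
    using sum_less assms(1) by (auto simp: code_def)
  finally show ?thesis .
qed

lemma bit_code_FOV_0:
  assumes "u < Z"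
  shows "a < k * b \<Longrightarrow> bit (code FOV T 0 u) a \<longleftrightarrow> bit u a"
    "a < k * b \<Longrightarrow> bit (code FOV T 0 u) (k * b + a) \<longleftrightarrow> \<not> bit u a"
    "bit (code FOV T 0 u) (k * b + k * b) \<longleftrightarrow> \<not> T u"
proof -
  let ?F = "mask (k * b) :: nat"
  have "code FOV T 0 u = u + Z * (?F - u + Z * of_bool (\<not> T u))"
    by (simp add: code_def distrib_left)
  moreover have "?F - u < Z"
    by (simp add: mask_eq_exp_minus_1)
  moreover have "bit (?F - u) a \<longleftrightarrow> a < k * b \<and> \<not> bit u a" for a
    using bit_diff_submask[of u ?F a] assms by (simp add: submask_mask_iff bit_mask_iff)
  ultimately show "a < k * b \<Longrightarrow> bit (code FOV T 0 u) a \<longleftrightarrow> bit u a"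
    "a < k * b \<Longrightarrow> bit (code FOV T 0 u) (k * b + a) \<longleftrightarrow> \<not> bit u a"
    "bit (code FOV T 0 u) (k * b + k * b) \<longleftrightarrow> \<not> T u"
    using assms by (simp_all add: bit_add_shifted bit_0)
qed

lemma bit_code_FOV:
  assumes "submask y (block j)" "j \<in> {1..<k}"
  shows "a < k * b \<Longrightarrow> bit (code FOV T j y) a \<longleftrightarrow> \<not> bit y a"
    "a < k * b \<Longrightarrow> bit (code FOV T j y) (k * b + a) \<longleftrightarrow> \<not> bit (block j) a \<or> bit y a"
    "bit (code FOV T j y) (k * b + k * b)"
proof -
  let ?F = "mask (k * b) :: nat"
  have position: "j < k" "j \<noteq> 0"
    using assms(2) by auto
  have bit_diff: "bit (?F - x) a \<longleftrightarrow> a < k * b \<and> \<not> bit x a" if "x < Z" for x a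
    using bit_diff_submask[of x ?F a] that by (simp add: submask_mask_iff bit_mask_iff)
  have less: "?F - y < Z" "?F - block j + y < Z"
    using coblock_plus_less[OF assms(1) position(1)] by (simp_all add: mask_eq_exp_minus_1)
  have sum: "bit (?F - block j + y) a \<longleftrightarrow> bit (?F - block j) a \<or> bit y a" for a
    using assms(1) bit_diff[OF block_less[OF position(1)]]
      by (intro bit_disjunctive_add_iff) (auto simp: submask_iff)
  have "bit (?F - block j + y + Z * 1) a \<longleftrightarrow>
      (if a < k * b then \<not> bit (block j) a \<or> bit y a else a = k * b)" for a
    unfolding bit_add_shifted[OF less(2)] sum bit_diff[OF block_less[OF position(1)]] bit_1_iff by auto
  moreover have "code FOV T j y = ?F - y + Z * (?F - block j + y + Z)"
    using position by (simp add: code_def)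
  ultimately show "a < k * b \<Longrightarrow> bit (code FOV T j y) a \<longleftrightarrow> \<not> bit y a"
    "a < k * b \<Longrightarrow> bit (code FOV T j y) (k * b + a) \<longleftrightarrow> \<not> bit (block j) a \<or> bit y a"
    "bit (code FOV T j y) (k * b + k * b)"
    using less bit_diff[OF submask_block_less[OF assms(1) position(1)]] by (simp_all add: bit_add_shifted)
qed

lemma all_less_double_Suc: "(\<forall>a<m + (m + 1 :: nat). P a) \<longleftrightarrow> (\<forall>a<m. P a \<and> P (m + a)) \<and> P (m + m)"
proof -
  have "a < m + (m + 1) \<longleftrightarrow> a < m \<or> (\<exists>c<m. a = m + c) \<or> a = m + m" for a
    by presburger
  then show ?thesis
    by blast
qed

lemma target_codes_iff_FOV:
  assumes "y 0 < Z" "\<forall>j\<in>{1..<k}. submask (y j) (block j)"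
  shows "target FOV (width FOV) (map (bits_of (width FOV)) (map (\<lambda>j. code FOV T j (y j)) [0..<k])) \<longleftrightarrow>
    T (y 0) \<and> y 0 = (\<Sum>j\<in>{1..<k}. y j)"
proof -
  let ?S = "\<Sum>j\<in>{1..<k}. y j" and ?c = "\<lambda>j. code FOV T j (y j)" and ?N = "k * b"
  define zero_at where "zero_at a \<longleftrightarrow> \<not> bit (?c 0) a \<or> (\<exists>j\<in>{1..<k}. \<not> bit (?c j) a)" for a
  have "target FOV (width FOV) (map (bits_of (width FOV)) (map ?c [0..<k])) \<longleftrightarrow> (\<forall>a<?N + (?N + 1). zero_at a)"
    unfolding target.simps f_OV_bits_of map_upt_Cons zero_at_def by auto
  also have "\<dots> \<longleftrightarrow> (\<forall>a<?N. zero_at a \<and> zero_at (?N + a)) \<and> zero_at (?N + ?N)"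
    by (rule all_less_double_Suc)
  also have "\<dots> \<longleftrightarrow> (\<forall>a<?N. bit (y 0) a \<longleftrightarrow> bit ?S a) \<and> T (y 0)"
  proof -
    have "zero_at a \<and> zero_at (?N + a) \<longleftrightarrow> (bit (y 0) a \<longleftrightarrow> bit ?S a)" if a_less: "a < ?N" for a
    proof -
      let ?i = "max 1 (a div b)"
      have "zero_at a \<longleftrightarrow> \<not> bit (y 0) a \<or> bit ?S a"
        unfolding zero_at_def bit_sum_submasks[OF assms(2)]
        using bit_code_FOV_0(1)[OF assms(1) a_less] bit_code_FOV(1) assms(2) a_less by blast
      moreover have "?i \<in> {1..<k}"
        using a_less two_le_k by (auto simp: less_mult_imp_div_less)
      then have "bit ?S a \<longleftrightarrow> bit (y ?i) a" "bit (block j) a \<longleftrightarrow> j = ?i" if "j \<in> {1..<k}" for j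
        unfolding bit_sum_submasks[OF assms(2)] using assms(2) bit_block a_less that by (metis submask_iff)+
      then have "zero_at (?N + a) \<longleftrightarrow> bit (y 0) a \<or> \<not> bit ?S a"
        unfolding zero_at_def
        using bit_code_FOV_0(2)[OF assms(1) a_less] bit_code_FOV(2) assms(2) a_less \<open>?i \<in> {1..<k}\<close> by blast
      ultimately show ?thesis
        by blast
    qed
    moreover have "zero_at (?N + ?N) \<longleftrightarrow> T (y 0)"
      unfolding zero_at_def using bit_code_FOV_0(3)[OF assms(1)] bit_code_FOV(3) assms(2) by blast
    ultimately show ?thesis
      by blast
  qed
  also have "\<dots> \<longleftrightarrow> T (y 0) \<and> y 0 = ?S"
    using assms(1) sum_submasks_less[OF assms(2)] by (auto simp: less_power_2_iff bit_eq_iff)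
  finally show ?thesis .
qed

lemma target_codes_iff:
  assumes "\<forall>j<k. submask (y j) (block j)"
  shows "target prob (width prob) (map (\<lambda>j. bits_of (width prob) (code prob T j (y j))) [0..<k]) \<longleftrightarrow>
    T (y 0) \<and> (\<forall>j<k. y j = and (y 0) (block j))"
proof -
  have submasks: "y 0 < Z" "\<forall>j\<in>{1..<k}. submask (y j) (block j)"
    using assms[rule_format, of 0] two_le_k by (simp, simp add: assms)
  have "target prob (width prob) (map (bits_of (width prob)) (map (\<lambda>j. code prob T j (y j)) [0..<k])) \<longleftrightarrow>
      T (y 0) \<and> y 0 = (\<Sum>j\<in>{1..<k}. y j)"
    using target_codes_iff_FOV[OF submasks] target_codes_iff_FXOR[OF submasks]
      target_codes_iff_FSUM[OF submasks]
    by (cases prob) blast+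
  also have "\<dots> \<longleftrightarrow> T (y 0) \<and> (\<forall>j\<in>{1..<k}. y j = and (y 0) (block j))"
    using eq_sum_submasks_iff[OF submasks] by simp
  also have "\<dots> \<longleftrightarrow> T (y 0) \<and> (\<forall>j<k. y j = and (y 0) (block j))"
  proof -
    have "{..<k} = insert 0 {1..<k}"
      using two_le_k by auto
    moreover have "y 0 = and (y 0) (block 0)"
      using submasks(1) unfolding submask_block_0[symmetric] submask_def by simp
    ultimately show ?thesis
      unfolding Ball_def[of "{..<k}", unfolded lessThan_iff, symmetric] by simp
  qed
  finally show ?thesis
    by (simp add: comp_def)
qed

end

section \<open>Images of instances\<close>

lemma div_eq_image:
  assumes "0 < m"
  shows "{y. y div m = x} = (\<lambda>i. x * m + i) ` {..<m :: nat}"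
proof (intro set_eqI iffI)
  fix y
  assume "y \<in> {y. y div m = x}"
  then have "y = x * m + y mod m"
    using div_mult_mod_eq[of y m] by simp
  then show "y \<in> (\<lambda>i. x * m + i) ` {..<m}"
    using assms by (intro image_eqI[of _ _ "y mod m"]) simp_all
qed (use assms in auto)

lemma fvecs_iff: "v \<in> fvecs g b \<longleftrightarrow> length v = g \<and> (\<forall>i<g. v ! i \<subseteq> {w. length w = b})"
  by (auto simp: fvecs_def all_set_conv_all_nth)

context digit_code
begin

definition fiber_size :: "nat \<Rightarrow> nat" where
  "fiber_size j = (if j = 0 then 2 ^ ((k - 1) * b) else if j = 1 then 2 ^ b else 1)"

definition fiber_step :: "nat \<Rightarrow> nat" where
  "fiber_step j = (if j = 0 then 2 ^ b else 1)"

definition fiber :: "nat \<Rightarrow> nat \<Rightarrow> nat list" where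
  "fiber j x = map (\<lambda>i. x * 2 ^ (j * b) + i * fiber_step j) [0..<fiber_size j]"

lemma length_fiber: "length (fiber j x) = fiber_size j"
  by (simp add: fiber_def)

lemma distinct_fiber: "distinct (fiber j x)"
  by (simp add: fiber_def distinct_map inj_on_def fiber_step_def)

lemma Z_eq: "Z = 2 ^ b * 2 ^ ((k - 1) * b)"
proof -
  have "k * b = b + (k - 1) * b"
    using two_le_k by (cases k) simp_all
  then show ?thesis
    by (simp add: power_add)
qed

lemma set_fiber_0:
  assumes "x < 2 ^ b"
  shows "set (fiber 0 x) = {y. y < Z \<and> digit 0 y = x}"
proof -
  have fiber: "set (fiber 0 x) = (\<lambda>i. x + i * 2 ^ b) ` {..<2 ^ ((k - 1) * b)}"
    by (simp add: fiber_def fiber_step_def fiber_size_def atLeast0LessThan)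
  have "y \<in> set (fiber 0 x) \<longleftrightarrow> y div 2 ^ b < 2 ^ ((k - 1) * b) \<and> y mod 2 ^ b = x" for y
  proof
    assume "y div 2 ^ b < 2 ^ ((k - 1) * b) \<and> y mod 2 ^ b = x"
    then show "y \<in> set (fiber 0 x)"
      unfolding fiber using div_mult_mod_eq[of y "2 ^ b"] by (intro image_eqI[of _ _ "y div 2 ^ b"]) simp_all
  qed (use assms in \<open>auto simp: fiber\<close>)
  moreover have "y div 2 ^ b < 2 ^ ((k - 1) * b) \<longleftrightarrow> y < Z" for y
    unfolding Z_eq by (simp add: div_less_iff_less_mult mult.commute)
  ultimately show ?thesis
    by (auto simp: digit_def)
qed

lemma set_fiber_1:
  assumes "x < 2 ^ b"
  shows "set (fiber 1 x) = {y. submask y (block 1) \<and> digit 1 y = x}"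
proof -
  have "set (fiber 1 x) = {y. y div 2 ^ b = x}"
    by (simp add: fiber_def fiber_step_def fiber_size_def atLeast0LessThan div_eq_image)
  moreover have "y < 2 ^ (2 * b) \<longleftrightarrow> y div 2 ^ b < 2 ^ b" for y :: nat
    by (simp add: div_less_iff_less_mult mult_2 power_add)
  ultimately show ?thesis
    using assms by (auto simp: digit_def block_def submask_mask_iff)
qed

lemma set_fiber_ge_2:
  assumes "x < 2 ^ b" "2 \<le> j"
  shows "set (fiber j x) = {y. submask y (block j) \<and> digit j y = x}"
proof -
  have "bit (push_bit (j * b) (digit j y)) a \<longleftrightarrow> bit y a \<and> bit (block j) a" for y a
    using assms(2) by (auto simp: block_def bit_push_bit_iff bit_mask_iff bit_digit)
  then have "and y (block j) = digit j y * 2 ^ (j * b)" for y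
    by (simp add: bit_eq_iff bit_and_iff flip: push_bit_eq_mult)
  then have "submask y (block j) \<and> digit j y = x \<longleftrightarrow> y = x * 2 ^ (j * b)" for y
    using assms(1) by (auto simp: submask_def digit_def)
  moreover have "set (fiber j x) = {x * 2 ^ (j * b)}"
    using assms(2) by (simp add: fiber_def fiber_step_def fiber_size_def)
  ultimately show ?thesis
    by auto
qed

lemma set_fiber:
  assumes "x < 2 ^ b"
  shows "set (fiber j x) = {y. submask y (block j) \<and> digit j y = x}"
proof -
  consider "j = 0" | "j = 1" | "2 \<le> j"
    by linarith
  then show ?thesis
    using set_fiber_0[OF assms] set_fiber_1[OF assms] set_fiber_ge_2[OF assms] by cases simp_all
qed

definition words_image :: "problem \<Rightarrow> (nat \<Rightarrow> bool) \<Rightarrow> nat \<Rightarrow> bits set \<Rightarrow> bits set" where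
  "words_image prob T j A = (\<lambda>y. bits_of (width prob) (code prob T j y)) `
     {y. submask y (block j) \<and> bits_of b (digit j y) \<in> A}"

definition vec_image :: "problem \<Rightarrow> (nat \<Rightarrow> bool) \<Rightarrow> nat \<Rightarrow> fvec \<Rightarrow> fvec" where
  "vec_image prob T j = map (words_image prob T j)"

definition instance_image :: "problem \<Rightarrow> (nat \<Rightarrow> bool) \<Rightarrow> fvec set list \<Rightarrow> fvec set list" where
  "instance_image prob T Vs = map (\<lambda>j. vec_image prob T j ` (Vs ! j)) [0..<k]"

lemma inj_on_code:
  assumes "j < k"
  shows "inj_on (code prob T j) {y. submask y (block j)}"
  by (rule inj_onI) (use assms code_eq_iff in blast)

lemma inj_on_bits_of_code:
  assumes "j < k"
  shows "inj_on (\<lambda>y. bits_of (width prob) (code prob T j y)) {y. submask y (block j)}"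
  by (rule comp_inj_on[OF inj_on_code[OF assms] inj_on_subset[OF inj_on_bits_of], unfolded comp_def])
    (use code_less assms in auto)

lemma inj_on_words_image:
  assumes "j < k"
  shows "inj_on (words_image prob T j) (Pow {w. length w = b})"
proof (rule inj_onI)
  fix A A'
  assume word_sets: "A \<in> Pow {w. length w = b}" "A' \<in> Pow {w. length w = b}"
    and eq: "words_image prob T j A = words_image prob T j A'"
  have "{y. submask y (block j) \<and> bits_of b (digit j y) \<in> A} =
      {y. submask y (block j) \<and> bits_of b (digit j y) \<in> A'}"
    using eq unfolding words_image_def
    by (subst (asm) inj_on_image_eq_iff[OF inj_on_bits_of_code[OF assms]]) auto
  then have iff: "bits_of b (digit j y) \<in> A \<longleftrightarrow> bits_of b (digit j y) \<in> A'" if "submask y (block j)" for y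
    using that by blast
  have "w \<in> A \<longleftrightarrow> w \<in> A'" if "length w = b" for w
  proof -
    let ?y = "bits_val w * 2 ^ (j * b) + 0 * fiber_step j"
    have "?y \<in> set (fiber j (bits_val w))"
      unfolding fiber_def set_map by (rule imageI) (simp add: fiber_size_def)
    then have "submask ?y (block j)" "bits_of b (digit j ?y) = w"
      using set_fiber[OF bits_val_less[OF that]] bits_of_bits_val[OF that] by auto
    then show ?thesis
      using iff by metis
  qed
  then show "A = A'"
    using word_sets by blast
qed

lemma inj_on_vec_image:
  assumes "j < k"
  shows "inj_on (vec_image prob T j) (fvecs g b)"
  unfolding vec_image_def
  by (rule inj_on_mapI, rule inj_on_subset[OF inj_on_words_image[OF assms]]) (auto simp: fvecs_def)

lemma vec_image_in_fvecs: "v \<in> fvecs g b \<Longrightarrow> vec_image prob T j v \<in> fvecs g (width prob)"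
  by (auto simp: vec_image_def fvecs_def words_image_def)

lemma vec_image_set:
  assumes "V \<subseteq> fvecs g b" "j < k"
  shows "vec_image prob T j ` V \<subseteq> fvecs g (width prob)" "card (vec_image prob T j ` V) = card V"
  using assms vec_image_in_fvecs inj_on_subset[OF inj_on_vec_image[OF assms(2)] assms(1)]
  by (auto intro: card_image)

lemma fk_instance_image:
  assumes "fk_instance k n g b Vs"
  shows "fk_instance k n g (width prob) (instance_image prob T Vs)"
proof -
  have "vec_image prob T j ` (Vs ! j) \<subseteq> fvecs g (width prob)" "card (vec_image prob T j ` (Vs ! j)) = n"
    if "j < k" for j
  proof -
    have "Vs ! j \<subseteq> fvecs g b" "card (Vs ! j) = n"
      using assms that by (auto simp: fk_instance_def)
    then show "vec_image prob T j ` (Vs ! j) \<subseteq> fvecs g (width prob)" "card (vec_image prob T j ` (Vs ! j)) = n"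
      using vec_image_set that by simp_all
  qed
  then show ?thesis
    by (auto simp: fk_instance_def instance_image_def)
qed

end

section \<open>Counting\<close>

lemma in_listset_iff: "xs \<in> listset As \<longleftrightarrow> length xs = length As \<and> (\<forall>i<length As. xs ! i \<in> As ! i)"
proof (induction As arbitrary: xs)
  case (Cons A As)
  show ?case
    by (cases xs) (auto simp: set_Cons_def Cons.IH less_Suc_eq_0_disj)
qed auto

lemma finite_listset: "(\<And>A. A \<in> set As \<Longrightarrow> finite A) \<Longrightarrow> finite (listset As)"
proof (induction As)
  case (Cons A As)
  have "listset (A # As) = (\<lambda>(x, xs). x # xs) ` (A \<times> listset As)"
    by (auto simp: set_Cons_def)
  then show ?case
    using Cons by simp
qed simp

lemma listset_image:
  "listset (map (\<lambda>j. h j ` (As ! j)) [0..<length As]) =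
      (\<lambda>xs. map (\<lambda>j. h j (xs ! j)) [0..<length As]) ` listset As"
proof (intro set_eqI iffI)
  fix ys
  assume "ys \<in> listset (map (\<lambda>j. h j ` (As ! j)) [0..<length As])"
  then have ys: "length ys = length As" "\<forall>j<length As. \<exists>x. x \<in> As ! j \<and> ys ! j = h j x"
    by (auto simp: in_listset_iff)
  then obtain x where "\<forall>j<length As. x j \<in> As ! j \<and> ys ! j = h j (x j)"
    by metis
  then show "ys \<in> (\<lambda>xs. map (\<lambda>j. h j (xs ! j)) [0..<length As]) ` listset As"
    using ys(1) by (intro image_eqI[of _ _ "map x [0..<length As]"])
      (auto simp: in_listset_iff intro: nth_equalityI)
qed (auto simp: in_listset_iff)

lemma sum_listset_image:
  assumes "\<And>j. j < length As \<Longrightarrow> inj_on (h j) (As ! j)"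
  shows "(\<Sum>ys\<in>listset (map (\<lambda>j. h j ` (As ! j)) [0..<length As]). G ys) =
    (\<Sum>xs\<in>listset As. G (map (\<lambda>j. h j (xs ! j)) [0..<length As]))"
proof -
  have "inj_on (\<lambda>xs. map (\<lambda>j. h j (xs ! j)) [0..<length As]) (listset As)"
  proof (rule inj_onI)
    fix xs ys
    assume xs: "xs \<in> listset As" "ys \<in> listset As"
      and eq: "map (\<lambda>j. h j (xs ! j)) [0..<length As] = map (\<lambda>j. h j (ys ! j)) [0..<length As]"
    have "xs ! j = ys ! j" if "j < length As" for j
      using that xs eq inj_onD[OF assms[OF that]] by (simp add: in_listset_iff)
    then show "xs = ys"
      using xs by (simp add: in_listset_iff list_eq_iff_nth_eq)
  qed
  then show ?thesis
    unfolding listset_image by (simp add: sum.reindex)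
qed

lemma finite_words: "finite {w :: bits. length w = b}"
  using finite_lists_length_eq[of "UNIV :: bool set" b] by simp

context digit_code
begin

definition tuple :: "nat \<Rightarrow> bits list" where
  "tuple u = map (\<lambda>j. bits_of b (digit j u)) [0..<k]"

definition codeword :: "problem \<Rightarrow> (nat \<Rightarrow> bool) \<Rightarrow> nat \<Rightarrow> bits list" where
  "codeword prob T u = map (\<lambda>j. bits_of (width prob) (code prob T j (and u (block j)))) [0..<k]"

lemma eq_if_digits_eq:
  assumes "u < Z" "v < Z" "\<And>j. j < k \<Longrightarrow> digit j u = digit j v"
  shows "u = v"
proof (rule bit_eqI)
  fix a
  show "bit u a = bit v a"
  proof (cases "a < k * b")
    case True
    then have "0 < b" "a div b < k"
      by (cases b, auto simp: less_mult_imp_div_less)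
    then have "bit (digit (a div b) w) (a mod b) \<longleftrightarrow> bit w a" for w
      by (simp add: bit_digit)
    then show ?thesis
      using assms(3)[OF \<open>a div b < k\<close>] by metis
  qed (use assms(1,2) in \<open>auto simp: less_power_2_iff\<close>)
qed

lemma bij_betw_tuple: "bij_betw tuple {..<Z} {ws. length ws = k \<and> (\<forall>w\<in>set ws. length w = b)}"
proof -
  let ?W = "{w :: bits. length w = b}"
  have inj: "inj_on tuple {..<Z}"
  proof (rule inj_onI)
    fix u v
    assume less: "u \<in> {..<Z}" "v \<in> {..<Z}" and eq: "tuple u = tuple v"
    have "digit j u = digit j v" if "j < k" for j
      using eq that inj_onD[OF inj_on_bits_of, of b "digit j u" "digit j v"]
      by (simp add: tuple_def digit_less)
    then show "u = v"
      using less eq_if_digits_eq by simp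
  qed
  have tuples: "{ws. length ws = k \<and> (\<forall>w\<in>set ws. length w = b)} = {ws. set ws \<subseteq> ?W \<and> length ws = k}"
    by auto
  have "card ?W = 2 ^ b"
    using card_lists_length_eq[of "UNIV :: bool set" b] by simp
  then have "card (tuple ` {..<Z}) = card {ws. set ws \<subseteq> ?W \<and> length ws = k}"
    using inj card_lists_length_eq[OF finite_words, of b k] by (simp add: card_image power_mult mult.commute)
  then have "tuple ` {..<Z} = {ws. set ws \<subseteq> ?W \<and> length ws = k}"
    by (intro card_subset_eq finite_lists_length_eq finite_words) (auto simp: tuple_def)
  then show ?thesis
    using inj unfolding bij_betw_def tuples by blast
qed

lemma inj_on_codeword: "inj_on (codeword prob T) {..<Z}"
proof (rule inj_onI)
  fix u v
  assume less: "u \<in> {..<Z}" "v \<in> {..<Z}" and eq: "codeword prob T u = codeword prob T v"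
  have "codeword prob T u ! 0 = codeword prob T v ! 0"
    using eq by simp
  moreover have "codeword prob T w ! 0 = bits_of (width prob) (code prob T 0 w)" if "w < Z" for w
    using that two_le_k submask_block_0[of w] by (simp add: codeword_def submask_def del: submask_block_0)
  ultimately show "u = v"
    using less two_le_k inj_onD[OF inj_on_bits_of_code[of 0]] by simp
qed

lemma codeword_satisfies:
  assumes "length As = k" "u < Z" "tuple u \<in> listset As" "T u"
  shows "codeword prob T u \<in> listset (map (\<lambda>j. words_image prob T j (As ! j)) [0..<k])"
    "target prob (width prob) (codeword prob T u)"
proof -
  have "codeword prob T u ! j \<in> words_image prob T j (As ! j)" if "j < k" for j
    using that assms(1,3) submask_and digit_and_block
    by (auto simp: codeword_def words_image_def tuple_def in_listset_iff)
  then show "codeword prob T u \<in> listset (map (\<lambda>j. words_image prob T j (As ! j)) [0..<k])"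
    using assms(1) by (simp add: in_listset_iff codeword_def)
  have "and u (block 0) = u"
    using assms(2) submask_block_0[of u] by (simp add: submask_def del: submask_block_0)
  then show "target prob (width prob) (codeword prob T u)"
    unfolding codeword_def using target_codes_iff[of "\<lambda>j. and u (block j)" prob T] assms(4)
    by (simp add: submask_and)
qed

lemma eq_codeword_if_satisfies:
  assumes "length As = k" "ws \<in> listset (map (\<lambda>j. words_image prob T j (As ! j)) [0..<k])"
    "target prob (width prob) ws"
  obtains u where "u < Z" "tuple u \<in> listset As" "T u" "ws = codeword prob T u"
proof -
  have "length ws = k" and "\<forall>j<k. \<exists>y. submask y (block j) \<and> bits_of b (digit j y) \<in> As ! j \<and>
      ws ! j = bits_of (width prob) (code prob T j y)"
    using assms(2) by (auto simp: in_listset_iff words_image_def)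
  then obtain y where preimages: "\<forall>j<k. submask (y j) (block j)" "\<forall>j<k. bits_of b (digit j (y j)) \<in> As ! j"
    and "\<forall>j<k. ws ! j = bits_of (width prob) (code prob T j (y j))"
    by metis
  then have ws: "ws = map (\<lambda>j. bits_of (width prob) (code prob T j (y j))) [0..<k]"
    using \<open>length ws = k\<close> by (simp add: list_eq_iff_nth_eq)
  have hit: "T (y 0)" "\<forall>j<k. y j = and (y 0) (block j)"
    using assms(3) target_codes_iff[OF preimages(1), of prob T] unfolding ws by blast+
  have "ws = codeword prob T (y 0)"
    unfolding ws codeword_def by (rule map_cong[OF refl]) (metis hit(2) atLeastLessThan_iff set_upt)
  moreover have "digit j (y 0) = digit j (y j)" if "j < k" for j
    using hit(2) digit_and_block that by metis
  then have "tuple (y 0) \<in> listset As"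
    using preimages(2) assms(1) by (simp add: in_listset_iff tuple_def)
  moreover have "y 0 < Z"
    using preimages(1)[rule_format, of 0] two_le_k by simp
  ultimately show thesis
    using hit(1) that by blast
qed

lemma satisfying_codewords:
  assumes "length As = k"
  shows "{ws \<in> listset (map (\<lambda>j. words_image prob T j (As ! j)) [0..<k]). target prob (width prob) ws} =
    codeword prob T ` {u. u < Z \<and> tuple u \<in> listset As \<and> T u}"
  using codeword_satisfies[OF assms] by (auto elim!: eq_codeword_if_satisfies[OF assms])

lemma count_words_image:
  assumes As: "length As = k" "\<And>A. A \<in> set As \<Longrightarrow> A \<subseteq> {w. length w = b}"
    and table: "\<And>u. u < Z \<Longrightarrow> T u \<longleftrightarrow> f (tuple u)"
  shows "(\<Sum>ws\<in>listset (map (\<lambda>j. words_image prob T j (As ! j)) [0..<k]).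
      of_bool (target prob (width prob) ws)) =
    (\<Sum>ws\<in>listset As. of_bool (f ws) :: nat)"
proof -
  let ?As' = "map (\<lambda>j. words_image prob T j (As ! j)) [0..<k]"
  let ?U = "{u. u < Z \<and> tuple u \<in> listset As \<and> T u}"
  have finite: "finite (listset As)"
    by (intro finite_listset finite_subset[OF As(2) finite_words])
  have finite': "finite (listset ?As')"
  proof (rule finite_listset)
    fix A
    assume "A \<in> set ?As'"
    then have "A \<subseteq> {w. length w = width prob}"
      by (auto simp: words_image_def)
    then show "finite A"
      using finite_words by (rule finite_subset)
  qed
  have sub: "?U \<subseteq> {..<Z}"
    by auto
  have "length w = b" if "ws \<in> listset As" "w \<in> set ws" for ws w
  proof -
    from that obtain i where "i < k" "w \<in> As ! i"
      using As(1) by (auto simp: in_listset_iff in_set_conv_nth)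
    then show ?thesis
      using As(1) As(2)[of "As ! i"] by auto
  qed
  then have "listset As \<subseteq> tuple ` {..<Z}"
    unfolding bij_betw_imp_surj_on[OF bij_betw_tuple] using As(1) by (auto simp: in_listset_iff)
  then have "{ws \<in> listset As. f ws} = tuple ` ?U"
    using table by auto
  then have "card {ws \<in> listset As. f ws} = card ?U"
    using inj_on_subset[OF bij_betw_imp_inj_on[OF bij_betw_tuple] sub] by (simp add: card_image)
  moreover have "card {ws \<in> listset ?As'. target prob (width prob) ws} = card ?U"
    unfolding satisfying_codewords[OF As(1)] by (rule card_image[OF inj_on_subset[OF inj_on_codeword sub]])
  ultimately show ?thesis
    using finite finite' by (simp add: Collect_conj_eq)
qed

theorem factored_count_image:
  assumes inst: "fk_instance k n g b Vs"
    and table: "\<And>u. u < Z \<Longrightarrow> T u \<longleftrightarrow> f (tuple u)"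
  shows "factored_count (target prob (width prob)) g (instance_image prob T Vs) = factored_count f g Vs"
proof -
  have Vs: "length Vs = k" "\<And>j. j < k \<Longrightarrow> Vs ! j \<subseteq> fvecs g b"
    using inst by (auto simp: fk_instance_def)
  let ?im = "\<lambda>vs. map (\<lambda>j. vec_image prob T j (vs ! j)) [0..<k]"
  have "factored_count (target prob (width prob)) g (instance_image prob T Vs) =
    (\<Sum>vs\<in>listset Vs. \<Prod>i<g. \<Sum>ws\<in>listset (map (\<lambda>v. v ! i) (?im vs)). of_bool (target prob (width prob) ws))"
    unfolding factored_count_def instance_image_def
    by (rule sum_listset_image[of Vs, unfolded Vs(1)]) (use Vs inj_on_subset[OF inj_on_vec_image] in blast)
  also have "\<dots> = (\<Sum>vs\<in>listset Vs. \<Prod>i<g. \<Sum>ws\<in>listset (map (\<lambda>v. v ! i) vs). of_bool (f ws))"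
  proof (rule sum.cong[OF refl], rule prod.cong[OF refl])
    fix vs i
    assume "vs \<in> listset Vs" "i \<in> {..<g}"
    then have vs: "length vs = k" "\<And>j. j < k \<Longrightarrow> vs ! j \<in> fvecs g b" and i_less: "i < g"
      using Vs by (auto simp: in_listset_iff)
    let ?As = "map (\<lambda>v. v ! i) vs"
    have components: "map (\<lambda>v. v ! i) (?im vs) = map (\<lambda>j. words_image prob T j (?As ! j)) [0..<k]"
      using vs i_less by (auto simp: vec_image_def fvecs_iff)
    have "A \<subseteq> {w. length w = b}" if "A \<in> set ?As" for A
      using that vs i_less by (fastforce simp: fvecs_iff set_conv_nth)
    then show "(\<Sum>ws\<in>listset (map (\<lambda>v. v ! i) (?im vs)). of_bool (target prob (width prob) ws)) =
        (\<Sum>ws\<in>listset ?As. of_bool (f ws) :: nat)"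
      unfolding components using table vs(1) by (intro count_words_image) simp_all
  qed
  also have "\<dots> = factored_count f g Vs"
    by (simp add: factored_count_def)
  finally show ?thesis .
qed

end

section \<open>Encodings\<close>

definition enc_list :: "nat list \<Rightarrow> nat list" where
  "enc_list ns = length ns # ns"

definition enc_lists :: "nat list list \<Rightarrow> nat list" where
  "enc_lists nss = concat (map enc_list nss)"

definition represents :: "nat \<Rightarrow> bits set \<Rightarrow> nat list \<Rightarrow> bool" where
  "represents b A ns \<longleftrightarrow> distinct ns \<and> (\<forall>n\<in>set ns. n < 2 ^ b) \<and> A = bits_of b ` set ns"

lemma represents_length_le:
  assumes "represents b A ns"
  shows "length ns \<le> 2 ^ b"
proof -
  have "set ns \<subseteq> {..<2 ^ b}"
    using assms by (auto simp: represents_def)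
  then have "card (set ns) \<le> card {..<(2::nat) ^ b}"
    by (rule card_mono[rotated]) simp
  then show ?thesis
    using assms by (simp add: represents_def distinct_card)
qed

lemma enc_bits_set_iff:
  assumes "A \<subseteq> {w. length w = b}"
  shows "enc_bits_set A xs \<longleftrightarrow> (\<exists>ns. represents b A ns \<and> xs = enc_list ns)"
proof
  assume "enc_bits_set A xs"
  then obtain ws where ws: "distinct ws" "set ws = A" "xs = length ws # map bits_val ws"
    by (auto simp: enc_bits_set_def)
  have inverse: "bits_of b (bits_val w) = w" if "w \<in> set ws" for w
    using that ws(2) assms bits_of_bits_val by blast
  then have "inj_on bits_val (set ws)"
    by (rule inj_on_inverseI)
  moreover have "bits_of b ` set (map bits_val ws) = A"
    using inverse ws(2) by (simp add: image_image)
  ultimately have "represents b A (map bits_val ws)"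
    using ws assms bits_val_less by (auto simp: represents_def distinct_map)
  then show "\<exists>ns. represents b A ns \<and> xs = enc_list ns"
    using ws(3) by (intro exI[of _ "map bits_val ws"]) (simp add: enc_list_def)
next
  assume "\<exists>ns. represents b A ns \<and> xs = enc_list ns"
  then obtain ns where ns: "distinct ns" "\<forall>n\<in>set ns. n < 2 ^ b" "A = bits_of b ` set ns" "xs = enc_list ns"
    by (auto simp: represents_def)
  have "distinct (map (bits_of b) ns)"
    using ns(1,2) inj_on_subset[OF inj_on_bits_of, of "set ns" b] by (auto simp: distinct_map)
  moreover have "map (bits_val \<circ> bits_of b) ns = ns"
    using ns(2) by (intro map_idI) (simp add: bits_val_bits_of)
  ultimately show "enc_bits_set A xs"
    unfolding enc_bits_set_def using ns(3,4)
    by (intro exI[of _ "map (bits_of b) ns"]) (simp add: enc_list_def)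
qed

lemma list_all2_ex_iff:
  "list_all2 (\<lambda>x y. \<exists>z. P x z \<and> y = h z) xs ys \<longleftrightarrow> (\<exists>zs. list_all2 P xs zs \<and> ys = map h zs)"
proof (induction xs arbitrary: ys)
  case (Cons x xs)
  show ?case
    by (cases ys) (auto simp: Cons.IH list_all2_Cons1 intro: exI[of _ "_ # _"])
qed simp

lemma enc_fvec_iff:
  assumes "v \<in> fvecs g b"
  shows "enc_fvec v xs \<longleftrightarrow> (\<exists>nss. list_all2 (represents b) v nss \<and> xs = enc_lists nss)"
proof -
  have "list_all2 enc_bits_set v xss \<longleftrightarrow> list_all2 (\<lambda>A xs. \<exists>ns. represents b A ns \<and> xs = enc_list ns) v xss"
    for xss
    using assms by (intro list.rel_cong refl) (auto simp: fvecs_def enc_bits_set_iff)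
  then show ?thesis
    by (auto simp: enc_fvec_def list_all2_ex_iff enc_lists_def)
qed

lemma enc_fvec_set_iff:
  assumes "V \<subseteq> fvecs g b"
  shows "enc_fvec_set V xs \<longleftrightarrow> (\<exists>vs nsss. distinct vs \<and> set vs = V \<and>
    list_all2 (list_all2 (represents b)) vs nsss \<and> xs = enc_lists (concat nsss))"
proof -
  have "list_all2 enc_fvec vs xss \<longleftrightarrow>
      list_all2 (\<lambda>v xs. \<exists>nss. list_all2 (represents b) v nss \<and> xs = enc_lists nss) vs xss"
    if "set vs = V" for vs xss
    using that assms by (intro list.rel_cong refl enc_fvec_iff) blast
  moreover have "concat (map enc_lists nsss) = enc_lists (concat nsss)" for nsss
    by (induction nsss) (simp_all add: enc_lists_def)
  ultimately show ?thesis
    by (auto simp: enc_fvec_set_def list_all2_ex_iff) metis+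
qed

definition word_lists :: "nat \<Rightarrow> nat \<Rightarrow> nat list list set" where
  "word_lists m b = {nss. length nss = m \<and> (\<forall>ns\<in>set nss. length ns \<le> 2 ^ b \<and> (\<forall>n\<in>set ns. n < 2 ^ b))}"

lemma concat_in_word_lists:
  assumes "set vs \<subseteq> fvecs g b" "list_all2 (list_all2 (represents b)) vs nsss"
  shows "concat nsss \<in> word_lists (length vs * g) b"
  using assms(2,1)
proof (induction rule: list_all2_induct)
  case (Cons v vs nss nsss)
  have "length ns \<le> 2 ^ b \<and> (\<forall>n\<in>set ns. n < 2 ^ b)" if "ns \<in> set nss" for ns
    using Cons.hyps(1) that represents_length_le
    by (metis list_all2_conv_all_nth in_set_conv_nth represents_def)
  moreover have "length nss = g"
    using Cons.hyps(1) Cons.prems by (auto simp: fvecs_def list_all2_lengthD)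
  ultimately show ?case
    using Cons.IH Cons.prems by (auto simp: word_lists_def)
qed (simp add: word_lists_def)

context digit_code
begin

definition fibers :: "nat \<Rightarrow> nat list \<Rightarrow> nat list" where
  "fibers j ns = concat (map (fiber j) ns)"

definition list_image :: "problem \<Rightarrow> (nat \<Rightarrow> bool) \<Rightarrow> nat \<Rightarrow> nat list \<Rightarrow> nat list" where
  "list_image prob T j ns = map (code prob T j) (fibers j ns)"

lemma length_list_image: "length (list_image prob T j ns) = length ns * fiber_size j"
  by (induction ns) (simp_all add: list_image_def fibers_def length_fiber)

lemma set_fibers:
  assumes "\<forall>n\<in>set ns. n < 2 ^ b"
  shows "set (fibers j ns) = {y. submask y (block j) \<and> digit j y \<in> set ns}"
  using assms by (auto simp: fibers_def set_fiber)

lemma distinct_fibers: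
  assumes "distinct ns" "\<forall>n\<in>set ns. n < 2 ^ b"
  shows "distinct (fibers j ns)"
  using assms
proof (induction ns)
  case (Cons n ns)
  then have "set (fiber j n) \<inter> set (fibers j ns) = {}"
    by (auto simp: set_fiber set_fibers)
  then show ?case
    using Cons by (simp add: fibers_def distinct_fiber)
qed (simp add: fibers_def)

lemma list_image_less:
  assumes "j < k" "\<forall>n\<in>set ns. n < 2 ^ b" "c \<in> set (list_image prob T j ns)"
  shows "c < 2 ^ width prob"
  using assms code_less by (auto simp: list_image_def set_fibers)

lemma represents_image:
  assumes "j < k" "represents b A ns"
  shows "represents (width prob) (words_image prob T j A) (list_image prob T j ns)"
proof -
  have ns: "distinct ns" "\<forall>n\<in>set ns. n < 2 ^ b" and set_eq: "A = bits_of b ` set ns"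
    using assms(2) by (simp_all add: represents_def)
  have "bits_of b (digit j y) \<in> A \<longleftrightarrow> digit j y \<in> set ns" for y
    using ns(2) unfolding set_eq by (subst inj_on_image_mem_iff[OF inj_on_bits_of]) (auto simp: digit_less)
  then have "words_image prob T j A = bits_of (width prob) ` set (list_image prob T j ns)"
    by (simp add: words_image_def list_image_def set_fibers[OF ns(2)] image_image)
  moreover have "distinct (list_image prob T j ns)"
    unfolding list_image_def distinct_map set_fibers[OF ns(2)]
    by (intro conjI distinct_fibers[OF ns] inj_on_subset[OF inj_on_code[OF assms(1)]]) blast
  ultimately show ?thesis
    using list_image_less[OF assms(1) ns(2)] by (simp add: represents_def)
qed

lemma enc_fvec_set_image:
  assumes "j < k" "set vs \<subseteq> fvecs g b" "distinct vs" "list_all2 (list_all2 (represents b)) vs nsss"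
  shows "enc_fvec_set (vec_image prob T j ` set vs) (enc_lists (map (list_image prob T j) (concat nsss)))"
proof -
  let ?im = "map (list_image prob T j)"
  have "list_all2 (represents (width prob)) (vec_image prob T j v) (?im nss)"
    if "list_all2 (represents b) v nss" for v nss
    using that by (induction rule: list_all2_induct) (simp_all add: vec_image_def represents_image[OF assms(1)])
  with assms(4) have "list_all2 (list_all2 (represents (width prob))) (map (vec_image prob T j) vs)
      (map ?im nsss)"
    by (induction rule: list_all2_induct) simp_all
  moreover have "distinct (map (vec_image prob T j) vs)"
    using assms(1-3) inj_on_subset[OF inj_on_vec_image] by (auto simp: distinct_map)
  moreover have "?im (concat nsss) = concat (map ?im nsss)"
    by (rule map_concat)
  ultimately show ?thesis
    unfolding enc_fvec_set_iff[OF vec_image_set(1)[OF assms(2,1)]]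
    by (intro exI[of _ "map (vec_image prob T j) vs"] exI[of _ "map ?im nsss"]) simp
qed

lemma enc_instance_image:
  assumes inst: "fk_instance k n g b Vs" and enc: "enc_instance Vs xs"
  obtains nsss where "length nsss = k" "set nsss \<subseteq> word_lists (n * g) b" "xs = concat (map enc_lists nsss)"
    "enc_instance (instance_image prob T Vs)
      (concat (map (\<lambda>j. enc_lists (map (list_image prob T j) (nsss ! j))) [0..<k]))"
proof -
  have Vs: "length Vs = k" "\<And>j. j < k \<Longrightarrow> Vs ! j \<subseteq> fvecs g b \<and> card (Vs ! j) = n"
    using inst by (auto simp: fk_instance_def)
  obtain xss where xss: "list_all2 enc_fvec_set Vs xss" "xs = concat xss"
    using enc by (auto simp: enc_instance_def)
  have "\<exists>nss. nss \<in> word_lists (n * g) b \<and> xss ! j = enc_lists nss \<and>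
      enc_fvec_set (vec_image prob T j ` (Vs ! j))
        (enc_lists (map (list_image prob T j) nss))" if position: "j < k" for j
  proof -
    have "enc_fvec_set (Vs ! j) (xss ! j)"
      using xss(1) position Vs(1) by (simp add: list_all2_conv_all_nth)
    then obtain vs nsss where "distinct vs" "set vs = Vs ! j" "list_all2 (list_all2 (represents b)) vs nsss"
      "xss ! j = enc_lists (concat nsss)"
      using enc_fvec_set_iff[OF conjunct1[OF Vs(2)[OF position]]] by blast
    then show ?thesis
      using concat_in_word_lists[of vs g b nsss] enc_fvec_set_image[OF position, of vs g nsss prob T]
        Vs(2)[OF position]
        distinct_card[of vs]
      by (intro exI[of _ "concat nsss"]) simp
  qed
  then obtain nss where nss: "\<And>j. j < k \<Longrightarrow> nss j \<in> word_lists (n * g) b \<and> xss ! j = enc_lists (nss j) \<and>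
      enc_fvec_set (vec_image prob T j ` (Vs ! j)) (enc_lists (map (list_image prob T j) (nss j)))"
    by metis
  have "length xss = k"
    using xss(1) Vs(1) by (simp add: list_all2_lengthD)
  then have "xss = map enc_lists (map nss [0..<k])"
    using nss by (simp add: list_eq_iff_nth_eq)
  moreover have "list_all2 enc_fvec_set (instance_image prob T Vs)
      (map (\<lambda>j. enc_lists (map (list_image prob T j) (map nss [0..<k] ! j))) [0..<k])"
    using nss by (simp add: list_all2_conv_all_nth instance_image_def)
  then have "enc_instance (instance_image prob T Vs)
      (concat (map (\<lambda>j. enc_lists (map (list_image prob T j) (map nss [0..<k] ! j))) [0..<k]))"
    unfolding enc_instance_def by blast
  ultimately show thesis
    using nss xss(2) by (intro that[of "map nss [0..<k]"]) auto
qed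

end

section \<open>Every solver reads its input\<close>

lemma result_in_less: "result_in M x \<Longrightarrow> x < 2 ^ M 0"
  unfolding result_in_def using LeastI[of "\<lambda>l. x < 2 ^ l" x] by simp

lemma result_in_bit: "result_in M x \<Longrightarrow> i < M 0 \<Longrightarrow> M (Suc i) = of_bool (bit x i)"
  by (simp add: result_in_def)

lemma result_in_unique:
  assumes "result_in M x" "result_in M' y" "M 0 = M' 0" "\<And>i. i < M 0 \<Longrightarrow> M (Suc i) = M' (Suc i)"
  shows "x = y"
proof (rule bit_eqI)
  fix i
  show "bit x i = bit y i"
  proof (cases "i < M 0")
    case True
    then have "of_bool (bit x i) = (of_bool (bit y i) :: nat)"
      using assms result_in_bit[OF assms(1), of i] result_in_bit[OF assms(2), of i] by simp
    then show ?thesis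
      by (simp only: of_bool_eq_iff)
  next
    case False
    then show ?thesis
      using result_in_less[OF assms(1)] result_in_less[OF assms(2)] assms(3) by (auto simp: less_power_2_iff)
  qed
qed

text \<open>A cell whose value is not a bit cannot be part of the output either, unless it is overwritten.\<close>

lemma result_insensitive:
  assumes run: "exec w P (initial X) t (R, M)" "result_in M x"
    and cell: "c \<notin> sensitive w P (initial X) t (R, M)" "0 < c" "c < length X" "2 \<le> X ! c"
    and run': "exec w P (initial (X[c := v])) t' (R', M')" "result_in M' y"
  shows "x = y"
proof -
  have "initial (X[c := v]) = poke c v (initial X)" "snd (initial X) c = X ! c"
    using cell(3) by (auto simp: initial_def fun_eq_iff nth_list_update)
  then consider "exec w P (initial (X[c := v])) t (R, M)" |
    "M c = X ! c" "exec w P (initial (X[c := v])) t (R, M(c := v))"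
    using cell(1) by (auto simp: sensitive_def)
  then show ?thesis
  proof cases
    case 1
    then have "M' = M"
      using exec_deterministic[OF run'(1)] by blast
    then show ?thesis
      using result_in_unique[OF run(2) run'(2)] by simp
  next
    case 2
    then have memory_eq: "M' = M(c := v)"
      using exec_deterministic[OF run'(1)] by blast
    have "Suc i \<noteq> c" if "i < M 0" for i
      using result_in_bit[OF run(2) that] 2(1) cell(4) by (cases "bit x i") auto
    then show ?thesis
      using result_in_unique[OF run(2) run'(2)] cell(2) memory_eq by simp
  qed
qed

lemma enc_lists_update:
  assumes "\<forall>ns\<in>set nss. length ns = l" "i < length nss" "x < l"
  shows "i * Suc l + Suc x < length (enc_lists nss)"
    "enc_lists nss ! (i * Suc l + Suc x) = nss ! i ! x"
    "(enc_lists nss)[i * Suc l + Suc x := v] = enc_lists (nss[i := (nss ! i)[x := v]])"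
proof -
  have "i * Suc l + Suc x < length (enc_lists nss) \<and> enc_lists nss ! (i * Suc l + Suc x) = nss ! i ! x \<and>
      (enc_lists nss)[i * Suc l + Suc x := v] = enc_lists (nss[i := (nss ! i)[x := v]])"
    using assms(1,2)
  proof (induction nss arbitrary: i)
    case (Cons ns nss)
    have split: "enc_lists (ns # nss) = enc_list ns @ enc_lists nss" for ns nss
      by (simp add: enc_lists_def)
    show ?case
    proof (cases i)
      case 0
      then show ?thesis
        using Cons.prems assms(3) by (simp add: split enc_list_def nth_append list_update_append)
    next
      case (Suc i')
      have "i * Suc l + Suc x = length (enc_list ns) + (i' * Suc l + Suc x)"
        using Suc Cons.prems by (simp add: enc_list_def)
      then show ?thesis
        using Suc Cons.IH[of i'] Cons.prems by (simp add: split nth_append list_update_append)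
    qed
  qed simp
  then show "i * Suc l + Suc x < length (enc_lists nss)"
    "enc_lists nss ! (i * Suc l + Suc x) = nss ! i ! x"
    "(enc_lists nss)[i * Suc l + Suc x := v] = enc_lists (nss[i := (nss ! i)[x := v]])"
    by blast+
qed

lemma enc_fvec_set_singletons:
  assumes "\<And>i. i < n \<Longrightarrow> represents b (W i) (A i)" "inj_on W {..<n}"
  defines "V \<equiv> (\<lambda>i. [W i]) ` {..<n}"
  shows "V \<subseteq> fvecs 1 b" "card V = n" "enc_fvec_set V (enc_lists (map A [0..<n]))"
proof -
  have inj: "inj_on (\<lambda>i. [W i]) {..<n}"
    using assms(2) by (auto simp: inj_on_def)
  show in_fvecs: "V \<subseteq> fvecs 1 b"
    using assms(1) by (auto simp: V_def fvecs_def represents_def)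
  show "card V = n"
    using inj by (simp add: V_def card_image)
  have "list_all2 (list_all2 (represents b)) (map (\<lambda>i. [W i]) [0..<n]) (map (\<lambda>i. [A i]) [0..<n])"
    using assms(1) by (simp add: list_all2_conv_all_nth)
  moreover have "distinct (map (\<lambda>i. [W i]) [0..<n])" "set (map (\<lambda>i. [W i]) [0..<n]) = V"
    using inj by (simp_all add: distinct_map V_def atLeast0LessThan)
  moreover have "map A [0..<n] = concat (map (\<lambda>i. [A i]) [0..<n])"
    by (induction n) simp_all
  ultimately show "enc_fvec_set V (enc_lists (map A [0..<n]))"
    unfolding enc_fvec_set_iff[OF in_fvecs] by metis
qed

lemma sum_set_Cons:
  assumes "finite A" "finite B"
  shows "(\<Sum>xs\<in>set_Cons A B. F xs) = (\<Sum>a\<in>A. \<Sum>xs\<in>B. F (a # xs))"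
proof -
  have "set_Cons A B = (\<lambda>(a, xs). a # xs) ` (A \<times> B)"
    by (auto simp: set_Cons_def)
  moreover have "inj_on (\<lambda>(a, xs). a # xs) (A \<times> B)"
    by (auto simp: inj_on_def)
  ultimately show ?thesis
    by (simp add: sum.reindex case_prod_unfold sum.cartesian_product)
qed

definition weight :: "(bits list \<Rightarrow> bool) \<Rightarrow> fvec set list \<Rightarrow> bits \<Rightarrow> nat" where
  "weight f Vs w = (\<Sum>vs\<in>listset Vs. \<Sum>ws\<in>listset (map (\<lambda>v. v ! 0) vs). of_bool (f (w # ws)))"

lemma finite_component: "v \<in> fvecs g b \<Longrightarrow> i < g \<Longrightarrow> finite (v ! i)"
  using finite_subset[OF _ finite_words] by (auto simp: fvecs_iff)

lemma finite_listset_components: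
  assumes "\<forall>V\<in>set Vs. V \<subseteq> fvecs 1 b" "vs \<in> listset Vs"
  shows "finite (listset (map (\<lambda>v. v ! 0) vs))"
proof (rule finite_listset)
  fix A
  assume "A \<in> set (map (\<lambda>v. v ! 0) vs)"
  then obtain i where "i < length Vs" "vs ! i \<in> Vs ! i" "A = vs ! i ! 0"
    using assms(2) by (auto simp: in_listset_iff in_set_conv_nth)
  then show "finite A"
    using assms(1) nth_mem finite_component[of "vs ! i" 1 b 0] by auto
qed

lemma weight_pos_iff:
  assumes "\<forall>V\<in>set Vs. V \<subseteq> fvecs 1 b \<and> finite V"
  shows "0 < weight f Vs w \<longleftrightarrow> (\<exists>vs\<in>listset Vs. \<exists>ws\<in>listset (map (\<lambda>v. v ! 0) vs). f (w # ws))"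
proof -
  have "finite (listset Vs)"
    using assms by (intro finite_listset) blast
  moreover have "finite (listset (map (\<lambda>v. v ! 0) vs))" if "vs \<in> listset Vs" for vs
    using assms that by (intro finite_listset_components) blast
  ultimately show ?thesis
    by (simp add: weight_def flip: neq0_conv) blast
qed

lemma factored_count_Cons:
  assumes "V \<subseteq> fvecs 1 b" "finite V" "\<forall>V\<in>set Vs. V \<subseteq> fvecs 1 b \<and> finite V"
  shows "factored_count f 1 (V # Vs) = (\<Sum>v\<in>V. \<Sum>w\<in>v ! 0. weight f Vs w)"
proof -
  have "finite (listset Vs)"
    using assms(3) by (intro finite_listset) blast
  then have "factored_count f 1 (V # Vs) =
    (\<Sum>v\<in>V. \<Sum>vs\<in>listset Vs. \<Sum>ws\<in>set_Cons (v ! 0) (listset (map (\<lambda>v. v ! 0) vs)). of_bool (f ws))"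
    by (simp add: factored_count_def sum_set_Cons[OF assms(2)])
  also have "\<dots> = (\<Sum>v\<in>V. \<Sum>vs\<in>listset Vs. \<Sum>w\<in>v ! 0. \<Sum>ws\<in>listset (map (\<lambda>v. v ! 0) vs). of_bool (f (w # ws)))"
  proof (rule sum.cong[OF refl], rule sum.cong[OF refl], rule sum_set_Cons)
    fix v vs
    assume "v \<in> V" "vs \<in> listset Vs"
    then show "finite (v ! 0)" "finite (listset (map (\<lambda>v. v ! 0) vs))"
      using assms finite_component[of v 1 b 0] finite_listset_components[of Vs b vs] by auto
  qed
  also have "\<dots> = (\<Sum>v\<in>V. \<Sum>w\<in>v ! 0. weight f Vs w)"
    unfolding weight_def by (rule sum.cong[OF refl], rule sum.swap)
  finally show ?thesis .
qed

lemma mult_add_eq_iff: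
  assumes "x < m" "x' < (m :: nat)"
  shows "i * m + x = i' * m + x' \<longleftrightarrow> i = i' \<and> x = x'"
proof
  assume "i * m + x = i' * m + x'"
  then have "(i * m + x) div m = (i' * m + x') div m" "(i * m + x) mod m = (i' * m + x') mod m"
    by simp_all
  then show "i = i' \<and> x = x'"
    using assms by simp
qed simp

context digit_code
begin

text \<open>The instances of the lower bound: each vector of the first set contains all tuple numbers, under a
  truth table of its own. The vectors of the other sets have to be distinct, too, so vector \<open>i\<close> lacks the
  words \<open>x\<close> for which bit \<open>x\<close> of \<open>i\<close> is set; vector \<open>0\<close> contains all words.\<close>

definition first_lists :: "problem \<Rightarrow> nat \<Rightarrow> (nat \<Rightarrow> nat \<Rightarrow> bool) \<Rightarrow> nat list list" where
  "first_lists prob n T = map (\<lambda>i. map (code prob (T i) 0) [0..<Z]) [0..<n]"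

definition first_set :: "problem \<Rightarrow> nat \<Rightarrow> (nat \<Rightarrow> nat \<Rightarrow> bool) \<Rightarrow> fvec set" where
  "first_set prob n T = (\<lambda>i. [bits_of (width prob) ` code prob (T i) 0 ` {..<Z}]) ` {..<n}"

definition available :: "nat \<Rightarrow> nat list" where
  "available i = filter (\<lambda>x. \<not> bit i x) [0..<2 ^ b]"

definition further_lists :: "problem \<Rightarrow> nat \<Rightarrow> nat \<Rightarrow> nat list list" where
  "further_lists prob n j = map (\<lambda>i. list_image prob (\<lambda>_. True) j (available i)) [0..<n]"

definition further_set :: "problem \<Rightarrow> nat \<Rightarrow> nat \<Rightarrow> fvec set" where
  "further_set prob n j = (\<lambda>i. [words_image prob (\<lambda>_. True) j (bits_of b ` set (available i))]) ` {..<n}"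

definition distinguishing :: "nat \<Rightarrow> (nat \<Rightarrow> nat \<Rightarrow> bool) \<Rightarrow> bool" where
  "distinguishing n T \<longleftrightarrow> (\<forall>i<n. \<forall>i'<n. (\<forall>u<Z. T i u = T i' u) \<longrightarrow> i = i')"

lemma represents_available: "represents b (bits_of b ` set (available i)) (available i)"
  by (auto simp: represents_def available_def)

lemma further_set:
  assumes "n \<le> 2 ^ 2 ^ b" "j < k"
  shows "further_set prob n j \<subseteq> fvecs 1 (width prob)" "card (further_set prob n j) = n"
    "enc_fvec_set (further_set prob n j) (enc_lists (further_lists prob n j))"
proof -
  have "inj_on (\<lambda>i. words_image prob (\<lambda>_. True) j (bits_of b ` set (available i))) {..<n}"
  proof (rule inj_onI)
    fix i i'
    assume indices: "i \<in> {..<n}" "i' \<in> {..<n}"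
      and eq: "words_image prob (\<lambda>_. True) j (bits_of b ` set (available i)) =
        words_image prob (\<lambda>_. True) j (bits_of b ` set (available i'))"
    have "bits_of b ` set (available i) = bits_of b ` set (available i')"
      by (rule inj_onD[OF inj_on_words_image[OF assms(2)] eq]) auto
    moreover have sub: "set (available i) \<subseteq> {..<2 ^ b}" for i
      by (auto simp: available_def)
    ultimately have "set (available i) = set (available i')"
      using inj_on_image_eq_iff[OF inj_on_bits_of sub sub] by simp
    then have "bit i x \<longleftrightarrow> bit i' x" if "x < 2 ^ b" for x
      using that by (auto simp: available_def set_eq_iff)
    moreover have "i < 2 ^ 2 ^ b" "i' < 2 ^ 2 ^ b"
      using indices assms(1) by auto
    ultimately show "i = i'"
      unfolding less_power_2_iff by (intro bit_eqI) blast
  qed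
  from enc_fvec_set_singletons[OF represents_image[OF assms(2) represents_available] this]
  show "further_set prob n j \<subseteq> fvecs 1 (width prob)" "card (further_set prob n j) = n"
    "enc_fvec_set (further_set prob n j) (enc_lists (further_lists prob n j))"
    unfolding further_set_def further_lists_def by blast+
qed

lemma bits_of_code_0_eq_iff:
  assumes "u < Z" "u' < Z"
  shows "bits_of (width prob) (code prob T 0 u) = bits_of (width prob) (code prob T' 0 u') \<longleftrightarrow>
      u = u' \<and> T u = T' u'"
proof -
  have "bits_of (width prob) (code prob T 0 u) = bits_of (width prob) (code prob T' 0 u') \<longleftrightarrow>
      code prob T 0 u = code prob T' 0 u'"
    using assms code_less[of _ 0] two_le_k by (intro inj_on_eq_iff[OF inj_on_bits_of]) auto
  then show ?thesis
    using assms code_eq_iff[of u 0 u'] two_le_k by simp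
qed

lemma first_set:
  assumes "distinguishing n T"
  shows "first_set prob n T \<subseteq> fvecs 1 (width prob)" "card (first_set prob n T) = n"
    "enc_fvec_set (first_set prob n T) (enc_lists (first_lists prob n T))"
proof -
  have represents: "represents (width prob) (bits_of (width prob) ` code prob (T i) 0 ` {..<Z})
      (map (code prob (T i) 0) [0..<Z])" for i
    using inj_on_code[of 0 prob "T i"] code_less[of _ 0] two_le_k
    by (auto simp: represents_def distinct_map atLeast0LessThan lessThan_def)
  have "inj_on (\<lambda>i. bits_of (width prob) ` code prob (T i) 0 ` {..<Z}) {..<n}"
  proof (rule inj_onI)
    fix i i'
    assume indices: "i \<in> {..<n}" "i' \<in> {..<n}"
      and eq: "bits_of (width prob) ` code prob (T i) 0 ` {..<Z} =
          bits_of (width prob) ` code prob (T i') 0 ` {..<Z}"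
    have "T i u = T i' u" if "u < Z" for u
    proof -
      have "bits_of (width prob) (code prob (T i) 0 u) \<in> bits_of (width prob) ` code prob (T i') 0 ` {..<Z}"
        using that unfolding eq[symmetric] by simp
      then show ?thesis
        using bits_of_code_0_eq_iff[OF that] by auto
    qed
    then show "i = i'"
      using assms indices by (simp add: distinguishing_def)
  qed
  from enc_fvec_set_singletons[OF represents this]
  show "first_set prob n T \<subseteq> fvecs 1 (width prob)" "card (first_set prob n T) = n"
    "enc_fvec_set (first_set prob n T) (enc_lists (first_lists prob n T))"
    unfolding first_set_def first_lists_def by blast+
qed

definition further_sets :: "problem \<Rightarrow> nat \<Rightarrow> fvec set list" where
  "further_sets prob n = map (further_set prob n) [1..<k]"

lemma further_sets:
  assumes "0 < n" "n \<le> 2 ^ 2 ^ b"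
  shows "\<forall>V\<in>set (further_sets prob n). V \<subseteq> fvecs 1 (width prob) \<and> card V = n \<and> finite V"
  using further_set[OF assms(2)] assms(1) by (auto simp: further_sets_def card_ge_0_finite)

lemma table_true_if_satisfying:
  assumes u_less: "u < Z" and ws: "vs \<in> listset (further_sets prob n)" "ws \<in> listset (map (\<lambda>v. v ! 0) vs)"
    and target: "target prob (width prob) (bits_of (width prob) (code prob T 0 u) # ws)"
  shows "T u"
proof -
  have "length vs = k - 1" "\<And>l. l < k - 1 \<Longrightarrow> vs ! l \<in> further_set prob n (Suc l)"
    using ws(1) by (auto simp: in_listset_iff further_sets_def)
  then have nth: "length ws = k - 1" "\<And>l. l < k - 1 \<Longrightarrow> vs ! l \<in> further_set prob n (Suc l) \<and> ws ! l \<in> vs ! l ! 0"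
    using ws(2) by (auto simp: in_listset_iff)
  have "\<exists>y. submask y (block j) \<and> ws ! (j - 1) = bits_of (width prob) (code prob T j y)"
    if position: "j \<in> {1..<k}"
    for j
  proof -
    have "j - 1 < k - 1" "Suc (j - 1) = j"
      using position by auto
    then show ?thesis
      using nth(2)[of "j - 1"] position by (auto simp: further_set_def words_image_def code_def)
  qed
  then obtain y where preimages: "\<And>j. j \<in> {1..<k} \<Longrightarrow>
      submask (y j) (block j) \<and> ws ! (j - 1) = bits_of (width prob) (code prob T j (y j))"
    by metis
  let ?y = "y(0 := u)"
  have "ws = map (\<lambda>j. bits_of (width prob) (code prob T j (?y j))) [1..<k]"
    using nth(1) preimages[of "Suc _"] by (intro nth_equalityI) simp_all
  then have "target prob (width prob) (map (\<lambda>j. bits_of (width prob) (code prob T j (?y j))) [0..<k])"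
    using target unfolding map_upt_Cons by simp
  moreover have "\<forall>j<k. submask (?y j) (block j)"
    using preimages u_less by auto
  ultimately show ?thesis
    using target_codes_iff[of ?y] by auto
qed

lemma satisfying_if_table_true:
  assumes table_true: "u < Z" "T u" and "0 < n"
  obtains vs ws where "vs \<in> listset (further_sets prob n)" "ws \<in> listset (map (\<lambda>v. v ! 0) vs)"
    "target prob (width prob) (bits_of (width prob) (code prob T 0 u) # ws)"
proof
  let ?vs = "map (\<lambda>j. [words_image prob (\<lambda>_. True) j (bits_of b ` set (available 0))]) [1..<k]"
  let ?ws = "map (\<lambda>j. bits_of (width prob) (code prob T j (and u (block j)))) [1..<k]"
  show "?vs \<in> listset (further_sets prob n)"
    using assms(3) by (auto simp: in_listset_iff further_sets_def further_set_def)
  have "?ws ! l \<in> words_image prob (\<lambda>_. True) (Suc l) (bits_of b ` set (available 0))" if "l < k - 1" for l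
    using that submask_and by (auto simp: words_image_def available_def digit_less code_def)
  then show "?ws \<in> listset (map (\<lambda>v. v ! 0) ?vs)"
    by (simp add: in_listset_iff)
  have block_0: "and u (block 0) = u"
    using table_true(1) submask_block_0[of u] by (simp add: submask_def del: submask_block_0)
  then have "bits_of (width prob) (code prob T 0 u) # ?ws =
      map (\<lambda>j. bits_of (width prob) (code prob T j (and u (block j)))) [0..<k]"
    unfolding map_upt_Cons by simp
  then show "target prob (width prob) (bits_of (width prob) (code prob T 0 u) # ?ws)"
    using target_codes_iff[of "\<lambda>j. and u (block j)" prob T] table_true(2) submask_and block_0 by simp
qed

lemma weight_code_pos_iff:
  assumes "u < Z" "0 < n" "n \<le> 2 ^ 2 ^ b"
  shows "0 < weight (target prob (width prob)) (further_sets prob n)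
      (bits_of (width prob) (code prob T 0 u)) \<longleftrightarrow> T u"
proof -
  have "\<forall>V\<in>set (further_sets prob n). V \<subseteq> fvecs 1 (width prob) \<and> finite V"
    using further_sets[OF assms(2,3)] by blast
  then show ?thesis
    unfolding weight_pos_iff[OF \<open>\<forall>V\<in>set _. _\<close>]
    using table_true_if_satisfying[OF assms(1)] satisfying_if_table_true[OF assms(1) _ assms(2)] by metis
qed

lemma factored_count_first_set:
  assumes "distinguishing n T" "0 < n" "n \<le> 2 ^ 2 ^ b"
  shows "factored_count f 1 (first_set prob n T # further_sets prob n) =
    (\<Sum>i<n. \<Sum>u<Z. weight f (further_sets prob n) (bits_of (width prob) (code prob (T i) 0 u)))"
proof -
  let ?W = "\<lambda>i. (\<lambda>u. bits_of (width prob) (code prob (T i) 0 u)) ` {..<Z}"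
  have first: "first_set prob n T = (\<lambda>i. [?W i]) ` {..<n}"
    by (simp add: first_set_def image_image)
  have "factored_count f 1 (first_set prob n T # further_sets prob n) =
      (\<Sum>v\<in>first_set prob n T. \<Sum>w\<in>v ! 0. weight f (further_sets prob n) w)"
  proof (rule factored_count_Cons[OF first_set(1)[OF assms(1)]])
    show "finite (first_set prob n T)"
      by (simp add: first)
  qed (use further_sets[OF assms(2,3)] in blast)
  also have "\<dots> = (\<Sum>i<n. \<Sum>w\<in>?W i. weight f (further_sets prob n) w)"
  proof -
    have "inj_on (\<lambda>i. [?W i]) {..<n}"
      using first_set(2)[OF assms(1), of prob] unfolding first by (intro eq_card_imp_inj_on) simp_all
    then show ?thesis
      by (simp add: first sum.reindex)
  qed
  also have "\<dots> = (\<Sum>i<n. \<Sum>u<Z. weight f (further_sets prob n) (bits_of (width prob) (code prob (T i) 0 u)))"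
  proof (rule sum.cong[OF refl])
    fix i
    have "inj_on (\<lambda>u. bits_of (width prob) (code prob (T i) 0 u)) {..<Z}"
      using inj_on_bits_of_code[of 0] two_le_k by (auto simp: lessThan_def)
    then show "(\<Sum>w\<in>?W i. weight f (further_sets prob n) w) =
        (\<Sum>u<Z. weight f (further_sets prob n) (bits_of (width prob) (code prob (T i) 0 u)))"
      by (simp add: sum.reindex)
  qed
  finally show ?thesis .
qed

lemma factored_count_flip_less:
  assumes "0 < n" "n \<le> 2 ^ 2 ^ b" "i < n" "u < Z" "T i u"
    and "distinguishing n T" "distinguishing n (T(i := (T i)(u := False)))"
  shows "factored_count (target prob (width prob)) 1
      (first_set prob n (T(i := (T i)(u := False))) # further_sets prob n)
    < factored_count (target prob (width prob)) 1 (first_set prob n T # further_sets prob n)"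
proof -
  let ?T' = "T(i := (T i)(u := False))"
  let ?weight = "\<lambda>T i u. weight (target prob (width prob)) (further_sets prob n)
      (bits_of (width prob) (code prob (T i) 0 u))"
  have flipped: "?weight ?T' i u = 0" "0 < ?weight T i u"
    using weight_code_pos_iff[OF assms(4,1,2), of prob "?T' i"]
      weight_code_pos_iff[OF assms(4,1,2), of prob "T i"]
      assms(5) by simp_all
  have same: "?weight ?T' j x = ?weight T j x" if "(j, x) \<noteq> (i, u)" for j x
    using that by (auto simp: code_def)
  have weight_le: "?weight ?T' j x \<le> ?weight T j x" for j x
    using flipped(1) same[of j x] by (cases "(j, x) = (i, u)") simp_all
  have "(\<Sum>x<Z. ?weight ?T' i x) < (\<Sum>x<Z. ?weight T i x)"
    using assms(4) flipped weight_le by (intro sum_strict_mono_ex1) (blast, blast, metis lessThan_iff)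
  then have "(\<Sum>j<n. \<Sum>x<Z. ?weight ?T' j x) < (\<Sum>j<n. \<Sum>x<Z. ?weight T j x)"
    using assms(3) weight_le by (intro sum_strict_mono_ex1) (blast, blast intro: sum_mono, blast)
  then show ?thesis
    using factored_count_first_set assms by simp
qed

lemma distinguishing_if_high_bits:
  assumes "0 < b" "n \<le> 2 ^ 2 ^ (k * b - 1)" "\<And>i a. i < n \<Longrightarrow> a < 2 ^ (k * b - 1) \<Longrightarrow>
      T i (2 ^ (k * b - 1) + a) = bit i a"
  shows "distinguishing n T"
  unfolding distinguishing_def
proof (intro allI impI)
  fix i i'
  assume indices: "i < n" "i' < n" and eq: "\<forall>u<Z. T i u = T i' u"
  have "2 * 2 ^ (k * b - 1) = Z"
    using assms(1) two_le_k by (simp flip: power_Suc)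
  then have "bit i a \<longleftrightarrow> bit i' a" if "a < 2 ^ (k * b - 1)" for a
    using assms(3) indices eq that by (metis add_strict_left_mono mult_2)
  moreover have "i < 2 ^ 2 ^ (k * b - 1)" "i' < 2 ^ 2 ^ (k * b - 1)"
    using indices assms(2) by simp_all
  ultimately show "i = i'"
    unfolding less_power_2_iff by (intro bit_eqI) blast
qed

lemma lower_bound_instance:
  assumes "distinguishing n T" "0 < n" "n \<le> 2 ^ 2 ^ b"
  shows "fk_instance k n 1 (width prob) (first_set prob n T # further_sets prob n)"
    "enc_instance (first_set prob n T # further_sets prob n)
       (enc_lists (first_lists prob n T) @ concat (map (\<lambda>j. enc_lists (further_lists prob n j)) [1..<k]))"
proof -
  show "fk_instance k n 1 (width prob) (first_set prob n T # further_sets prob n)"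
    using first_set[OF assms(1)] further_sets[OF assms(2,3)] two_le_k
    by (auto simp: fk_instance_def further_sets_def)
  have "list_all2 enc_fvec_set (first_set prob n T # further_sets prob n)
      (enc_lists (first_lists prob n T) # map (\<lambda>j. enc_lists (further_lists prob n j)) [1..<k])"
    using first_set(3)[OF assms(1)] further_set(3)[OF assms(3)]
    by (simp add: further_sets_def list.rel_map list_all2_same)
  then show "enc_instance (first_set prob n T # further_sets prob n)
      (enc_lists (first_lists prob n T) @ concat (map (\<lambda>j. enc_lists (further_lists prob n j)) [1..<k]))"
    unfolding enc_instance_def by (intro exI conjI) (assumption, simp)
qed

lemma two_le_code_0:
  assumes "2 \<le> u" "u < 2 ^ (k * b - 1)"
  shows "2 \<le> code prob T 0 u"
proof -
  have "0 < b"
    using assms by (cases b) auto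
  then have "2 * 2 ^ (k * b - 1) = Z"
    using two_le_k by (simp flip: power_Suc)
  then have "2 \<le> unflagged prob 0 u"
    using assms by (cases prob) auto
  then show ?thesis
    by (simp add: code_def)
qed

definition lower_bound_input :: "problem \<Rightarrow> nat \<Rightarrow> (nat \<Rightarrow> nat \<Rightarrow> bool) \<Rightarrow> nat list" where
  "lower_bound_input prob n T = [n, 1, width prob] @ enc_lists (first_lists prob n T) @
     concat (map (\<lambda>j. enc_lists (further_lists prob n j)) [1..<k])"

definition lower_bound_count :: "problem \<Rightarrow> nat \<Rightarrow> (nat \<Rightarrow> nat \<Rightarrow> bool) \<Rightarrow> nat" where
  "lower_bound_count prob n T =
     factored_count (target prob (width prob)) 1 (first_set prob n T # further_sets prob n)"

definition table_cell :: "nat \<Rightarrow> nat \<Rightarrow> nat" where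
  "table_cell i u = 3 + (i * Suc Z + Suc u)"

lemma inj_on_table_cell: "inj_on (\<lambda>(i, u). table_cell i u) (A \<times> {..<Z})"
proof (rule inj_onI, clarify)
  fix i u i' u'
  assume "u < Z" "u' < Z" "table_cell i u = table_cell i' u'"
  then show "i = i' \<and> u = u'"
    using mult_add_eq_iff[of "Suc u" "Suc Z" "Suc u'" i i'] unfolding table_cell_def by simp
qed

lemma lower_bound_input_flip:
  fixes T :: "nat \<Rightarrow> nat \<Rightarrow> bool" and v :: bool
  assumes "i < n" "u < Z"
  defines "T' \<equiv> T(i := (T i)(u := v))"
  shows "table_cell i u < length (lower_bound_input prob n T)"
    "lower_bound_input prob n T ! table_cell i u = code prob (T i) 0 u"
    "(lower_bound_input prob n T)[table_cell i u := code prob (T' i) 0 u] = lower_bound_input prob n T'"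
proof -
  have lists: "\<forall>ns\<in>set (first_lists prob n T). length ns = Z" "i < length (first_lists prob n T)"
    using assms(1) by (auto simp: first_lists_def)
  note update = enc_lists_update[OF lists assms(2)]
  show "table_cell i u < length (lower_bound_input prob n T)"
    using update(1) by (simp add: lower_bound_input_def table_cell_def)
  show "lower_bound_input prob n T ! table_cell i u = code prob (T i) 0 u"
    using update(1,2) assms(1,2)
    by (simp add: lower_bound_input_def table_cell_def nth_append numeral_3_eq_3 first_lists_def)
  have "(first_lists prob n T)[i := (first_lists prob n T ! i)[u := code prob (T' i) 0 u]] =
      first_lists prob n T'"
    using assms(1) by (auto simp: T'_def first_lists_def list_eq_iff_nth_eq nth_list_update code_def)
  then show "(lower_bound_input prob n T)[table_cell i u := code prob (T' i) 0 u] = lower_bound_input prob n T'"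
    using update(1) update(3)[of "code prob (T' i) 0 u"]
    by (simp add: lower_bound_input_def table_cell_def list_update_append numeral_3_eq_3)
qed

lemma table_cell_sensitive:
  assumes n_bounds: "0 < n" "n \<le> 2 ^ 2 ^ b" and i_less: "i < n" and entry: "2 \<le> u" "u < 2 ^ (k * b - 1)" "T i u"
  defines "T' \<equiv> T(i := (T i)(u := False))"
  assumes distinguishing: "distinguishing n T" "distinguishing n T'"
    and run: "exec w P (initial (lower_bound_input prob n T)) t (R, M)"
      "result_in M (lower_bound_count prob n T)"
    and run': "computes_within w P (lower_bound_input prob n T') t' (lower_bound_count prob n T')"
  shows "table_cell i u \<in> sensitive w P (initial (lower_bound_input prob n T)) t (R, M)"
proof (rule ccontr)
  assume insensitive: "table_cell i u \<notin> sensitive w P (initial (lower_bound_input prob n T)) t (R, M)"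
  have "(2::nat) ^ (k * b - 1) \<le> Z"
    by simp
  then have "u < Z"
    using entry(2) by linarith
  note flip = lower_bound_input_flip[OF i_less this]
  obtain t2 R' M' where "exec w P (initial (lower_bound_input prob n T')) t2 (R', M')"
    "result_in M' (lower_bound_count prob n T')"
    using run' by (auto simp: computes_within_def)
  moreover have "2 \<le> lower_bound_input prob n T ! table_cell i u"
    unfolding flip(2) using entry(1,2) by (rule two_le_code_0)
  moreover have "0 < table_cell i u"
    by (simp add: table_cell_def)
  ultimately have "lower_bound_count prob n T = lower_bound_count prob n T'"
    using result_insensitive[OF run insensitive _ flip(1)] flip(3) unfolding T'_def by metis
  moreover have "lower_bound_count prob n T' < lower_bound_count prob n T"
    unfolding lower_bound_count_def T'_def
    using n_bounds i_less \<open>u < Z\<close> entry(3) distinguishing[unfolded T'_def] by (rule factored_count_flip_less)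
  ultimately show False
    by simp
qed

text \<open>All entries of the lower half of these tables can be flipped, while the upper half spells out \<open>i\<close> in
  binary and so keeps the vectors of the first set distinct.\<close>

definition binary_tables :: "nat \<Rightarrow> nat \<Rightarrow> bool" where
  "binary_tables i u \<longleftrightarrow> u < 2 ^ (k * b - 1) \<or> bit i (u - 2 ^ (k * b - 1))"

lemma distinguishing_binary_tables:
  assumes "0 < b" "n \<le> 2 ^ 2 ^ b"
  shows "distinguishing n binary_tables"
    "u < 2 ^ (k * b - 1) \<Longrightarrow> distinguishing n (binary_tables(i := (binary_tables i)(u := False)))"
proof -
  have "2 * b \<le> k * b"
    using two_le_k by simp
  then have "b \<le> k * b - 1"
    using assms(1) by linarith
  then have "(2::nat) ^ 2 ^ b \<le> 2 ^ 2 ^ (k * b - 1)"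
    by simp
  then have n_le: "n \<le> 2 ^ 2 ^ (k * b - 1)"
    using assms(2) by (rule le_trans[rotated])
  show "distinguishing n binary_tables"
    using assms(1) n_le by (rule distinguishing_if_high_bits) (simp add: binary_tables_def)
  show "distinguishing n (binary_tables(i := (binary_tables i)(u := False)))" if "u < 2 ^ (k * b - 1)"
    using assms(1) n_le by (rule distinguishing_if_high_bits) (use that in \<open>simp add: binary_tables_def\<close>)
qed

theorem reading_lower_bound:
  assumes "0 < b" "n \<le> 2 ^ 2 ^ b"
    and solver: "\<And>Vs xs. fk_instance k n 1 (width prob) Vs \<Longrightarrow> enc_instance Vs xs \<Longrightarrow>
      computes_within w P ([n, 1, width prob] @ xs) t (factored_count (target prob (width prob)) 1 Vs)"
  shows "n * (2 ^ (k * b - 1) - 2) \<le> t"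
proof (cases "n = 0")
  case False
  define H :: nat where "H = 2 ^ (k * b - 1)"
  let ?T = binary_tables and ?cells = "{..<n} \<times> {2..<H}"
  have n_pos: "0 < n"
    using False by simp
  note distinguishing = distinguishing_binary_tables[OF assms(1,2)]
  have solve: "computes_within w P (lower_bound_input prob n T) t (lower_bound_count prob n T)"
    if "distinguishing n T" for T
    unfolding lower_bound_input_def lower_bound_count_def using lower_bound_instance[OF that n_pos assms(2)]
      by (rule solver)
  obtain t' R M where run: "t' \<le> t" "exec w P (initial (lower_bound_input prob n ?T)) t' (R, M)"
    "result_in M (lower_bound_count prob n ?T)"
    using solve[OF distinguishing(1)] by (auto simp: computes_within_def)
  have "table_cell i u \<in> sensitive w P (initial (lower_bound_input prob n ?T)) t' (R, M)" if "(i, u) \<in> ?cells"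
    for i u
  proof (rule table_cell_sensitive[OF n_pos assms(2) _ _ _ _ distinguishing(1) _ run(2,3)])
    show "distinguishing n (?T(i := (?T i)(u := False)))"
      using that by (intro distinguishing(2)) (simp add: H_def)
    then show "computes_within w P (lower_bound_input prob n (?T(i := (?T i)(u := False)))) t
        (lower_bound_count prob n (?T(i := (?T i)(u := False))))"
      by (rule solve)
  qed (use that in \<open>simp_all add: binary_tables_def H_def\<close>)
  then have "(\<lambda>(i, u). table_cell i u) ` ?cells \<subseteq>
      sensitive w P (initial (lower_bound_input prob n ?T)) t' (R, M)"
    by auto
  then have "card ((\<lambda>(i, u). table_cell i u) ` ?cells) \<le> t'"
    using card_sensitive[OF run(2)] card_mono le_trans by blast
  moreover have "H \<le> Z"
    unfolding H_def by (intro power_increasing) simp_all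
  then have "inj_on (\<lambda>(i, u). table_cell i u) ?cells"
    by (intro inj_on_subset[OF inj_on_table_cell[of "{..<n}"]]) auto
  then have "card ((\<lambda>(i, u). table_cell i u) ` ?cells) = n * (H - 2)"
    by (simp add: card_image)
  ultimately show ?thesis
    using run(1) by (simp add: H_def)
qed simp

end

section \<open>Programs that translate a stream\<close>

abbreviation (input) seq :: "com \<Rightarrow> com \<Rightarrow> com" (infixr ";;" 60) where
  "P ;; Q \<equiv> Seq P Q"

text \<open>Register \<open>rIn\<close> holds the address of the next cell to be read, \<open>rOut\<close> that of the next cell to be
  written. Register \<open>0\<close> is not written before the registers are cleared and serves as the constant zero.\<close>

abbreviation (input) "rIn \<equiv> 2 :: nat"
abbreviation (input) "rOut \<equiv> 3 :: nat"
abbreviation (input) "rLists \<equiv> 4 :: nat"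
abbreviation (input) "rWords \<equiv> 5 :: nat"
abbreviation (input) "rFiber \<equiv> 6 :: nat"
abbreviation (input) "rIndex \<equiv> 7 :: nat"
abbreviation (input) "rTmp \<equiv> 8 :: nat"
abbreviation (input) "rAux \<equiv> 9 :: nat"
abbreviation (input) "rSize \<equiv> 10 :: nat"
abbreviation (input) "rShift \<equiv> 11 :: nat"
abbreviation (input) "rStep \<equiv> 12 :: nat"
abbreviation (input) "rCoblock \<equiv> 13 :: nat"
abbreviation (input) "rOne \<equiv> 14 :: nat"
abbreviation (input) "rThree \<equiv> 15 :: nat"
abbreviation (input) "rN \<equiv> 16 :: nat"
abbreviation (input) "rG \<equiv> 17 :: nat"
abbreviation (input) "rB \<equiv> 18 :: nat"
abbreviation (input) "rNG \<equiv> 19 :: nat"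
abbreviation (input) "rZ \<equiv> 20 :: nat"
abbreviation (input) "rE \<equiv> 21 :: nat"
abbreviation (input) "rMask \<equiv> 22 :: nat"
abbreviation (input) "rBase \<equiv> 23 :: nat"
abbreviation (input) "rFlag \<equiv> 24 :: nat"

definition for_loop :: "nat \<Rightarrow> com \<Rightarrow> com" where
  "for_loop c P = While c (P ;; Op Sub c c rOne)"

lemma wp_for_loop_step:
  "R c \<noteq> 0 \<Longrightarrow> wp w (for_loop c P) Q (R, M) \<longleftrightarrow>
    wp w P (\<lambda>t. wp w (Op Sub c c rOne) (\<lambda>u. wp w (for_loop c P) (\<lambda>v. Q (Suc (t + (u + v)))))) (R, M)"
  by (simp add: for_loop_def wp_While wp_Seq add.assoc)

lemma wp_for_loop:
  assumes body: "\<And>i R M. i < N \<Longrightarrow> I i R M \<Longrightarrow> R c = N - i \<Longrightarrow>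
      wp w P (\<lambda>t (R', M'). t \<le> \<tau> \<and> R' c = N - i \<and> I (Suc i) R' M') (R, M)"
    and one: "\<And>i R M. I i R M \<Longrightarrow> R rOne = 1"
    and counter: "\<And>i R M v. I i (R(c := v)) M \<longleftrightarrow> I i R M"
    and start: "N < 2 ^ w" "I 0 R M" "R c = N"
  shows "wp w (for_loop c P) (\<lambda>t (R', M'). t \<le> N * (\<tau> + 2) + 1 \<and> I N R' M') (R, M)"
proof -
  have "wp w (for_loop c P) (\<lambda>t (R', M'). t \<le> m * (\<tau> + 2) + 1 \<and> I N R' M') (R, M)"
    if "I i R M" "R c = m" "i + m = N" for i m R M
    using that
  proof (induction m arbitrary: i R M)
    case 0
    then show ?case
      by (simp add: for_loop_def wp_While)
  next
    case (Suc m)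
    let ?Q = "\<lambda>t (R', M'). t \<le> Suc m * (\<tau> + 2) + 1 \<and> I N R' M'"
    have "wp w P (\<lambda>t. wp w (Op Sub c c rOne) (\<lambda>u. wp w (for_loop c P) (\<lambda>v. ?Q (Suc (t + (u + v)))))) (R, M)"
    proof (rule wp_mono[OF body[of i R M]])
      fix t s'
      assume "case s' of (R', M') \<Rightarrow> t \<le> \<tau> \<and> R' c = N - i \<and> I (Suc i) R' M'"
      then obtain R' M' where state: "s' = (R', M')" "t \<le> \<tau>" "R' c = Suc m" "I (Suc i) R' M'"
        using Suc.prems(3) by (cases s') auto
      have "I (Suc i) (R'(c := m)) M'"
        unfolding counter by (rule state(4))
      then have "wp w (for_loop c P) (\<lambda>t (R', M'). t \<le> m * (\<tau> + 2) + 1 \<and> I N R' M') (R'(c := m), M')"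
        by (rule Suc.IH) (use Suc.prems(3) in simp_all)
      then have "wp w (for_loop c P) (\<lambda>v. ?Q (Suc (t + (1 + v)))) (R'(c := m), M')"
        by (rule wp_mono) (use state(2) in auto)
      moreover have "m < 2 ^ w"
        using Suc.prems(3) start(1) by linarith
      ultimately show "wp w (Op Sub c c rOne) (\<lambda>u. wp w (for_loop c P) (\<lambda>v. ?Q (Suc (t + (u + v))))) s'"
        unfolding state(1) wp_Op using state(3) one[OF state(4)] by simp
    qed (use Suc.prems in auto)
    then show ?case
      using Suc.prems(2) by (subst wp_for_loop_step) simp_all
  qed
  from this[OF start(2,3)] show ?thesis
    by simp
qed

definition mem :: "nat list \<Rightarrow> nat \<Rightarrow> nat list \<Rightarrow> nat \<Rightarrow> nat" where
  "mem X B out = (\<lambda>i. if i < length X then X ! i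
     else if B \<le> i \<and> i < B + length out then out ! (i - B) else 0)"

definition segment :: "nat list \<Rightarrow> nat \<Rightarrow> nat list \<Rightarrow> bool" where
  "segment X p xs \<longleftrightarrow> (\<exists>us vs. X = us @ xs @ vs \<and> length us = p)"

lemma segment_append:
  assumes "segment X p (xs @ ys)"
  shows "segment X p xs" "segment X (p + length xs) ys"
proof -
  obtain us vs where "X = us @ (xs @ ys) @ vs" "length us = p"
    using assms by (auto simp: segment_def)
  then show "segment X p xs" "segment X (p + length xs) ys"
    unfolding segment_def by (force, intro exI[of _ "us @ xs"] exI[of _ vs], simp)
qed

lemma segment_singleton: "segment X p [x] \<Longrightarrow> p < length X \<and> X ! p = x"
  by (auto simp: segment_def)

lemma concat_map_upt_split:
  assumes "i < n"
  shows "concat (map f [0..<n]) = concat (map f [0..<i]) @ f i @ concat (map f [Suc i..<n])"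
proof -
  have "[0..<n] = [0..<i] @ i # [Suc i..<n]"
    using assms upt_add_eq_append[of 0 i "n - i"] by (simp add: upt_conv_Cons)
  then show ?thesis
    by simp
qed

definition read :: "nat \<Rightarrow> com" where
  "read r = Load r rIn ;; Op Add rIn rIn rOne"

definition emit :: "nat \<Rightarrow> com" where
  "emit r = Store rOut r ;; Op Add rOut rOut rOne"

locale stream =
  fixes w :: nat and X :: "nat list" and B :: nat
  assumes input_below: "length X \<le> B" and input_fits: "\<forall>x\<in>set X. x < 2 ^ w"
begin

definition transduces ::
  "nat \<Rightarrow> com \<Rightarrow> ((nat \<Rightarrow> nat) \<Rightarrow> bool) \<Rightarrow> nat list \<Rightarrow> nat list \<Rightarrow> ((nat \<Rightarrow> nat) \<Rightarrow> bool) \<Rightarrow> bool" where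
  "transduces \<tau> P \<Phi> xs ys \<Psi> \<longleftrightarrow> (\<forall>R out. \<Phi> R \<longrightarrow> segment X (R rIn) xs \<longrightarrow> R rOut = B + length out \<longrightarrow>
     B + length out + length ys < 2 ^ w \<longrightarrow>
     wp w P (\<lambda>t (R', M'). t \<le> \<tau> \<and> \<Psi> R' \<and> R' rIn = R rIn + length xs \<and>
       R' rOut = B + length out + length ys \<and> M' = mem X B (out @ ys)) (R, mem X B out))"

lemma transducesD:
  assumes "transduces \<tau> P \<Phi> xs ys \<Psi>" "\<Phi> R" "segment X (R rIn) xs" "R rOut = B + length out"
    "B + length out + length ys < 2 ^ w"
  shows "wp w P (\<lambda>t (R', M'). t \<le> \<tau> \<and> \<Psi> R' \<and> R' rIn = R rIn + length xs \<and>
    R' rOut = B + length out + length ys \<and> M' = mem X B (out @ ys)) (R, mem X B out)"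
  using assms unfolding transduces_def by blast

lemma transduces_mono:
  assumes "transduces \<tau> P \<Phi> xs ys \<Psi>" "\<tau> \<le> \<tau>'" "\<And>R. \<Phi>' R \<Longrightarrow> \<Phi> R" "\<And>R. \<Psi> R \<Longrightarrow> \<Psi>' R"
    "xs = xs'" "ys = ys'"
  shows "transduces \<tau>' P \<Phi>' xs' ys' \<Psi>'"
  unfolding transduces_def assms(5,6)[symmetric]
proof (intro allI impI)
  fix R :: "nat \<Rightarrow> nat" and out :: "nat list"
  assume "\<Phi>' R" "segment X (R rIn) xs" "R rOut = B + length out" "B + length out + length ys < 2 ^ w"
  from transducesD[OF assms(1) assms(3)[OF this(1)] this(2-)]
  show "wp w P (\<lambda>t (R', M'). t \<le> \<tau>' \<and> \<Psi>' R' \<and> R' rIn = R rIn + length xs \<and>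
      R' rOut = B + length out + length ys \<and> M' = mem X B (out @ ys)) (R, mem X B out)"
    by (rule wp_mono) (use assms(2,4) in auto)
qed

lemma transduces_Seq:
  assumes "transduces \<tau> P \<Phi> xs ys \<Psi>" "transduces \<tau>' P' \<Psi> xs' ys' \<Psi>'"
  shows "transduces (\<tau> + \<tau>') (P ;; P') \<Phi> (xs @ xs') (ys @ ys') \<Psi>'"
  unfolding transduces_def wp_Seq
proof (intro allI impI)
  fix R :: "nat \<Rightarrow> nat" and out :: "nat list"
  assume pre: "\<Phi> R" "segment X (R rIn) (xs @ xs')" "R rOut = B + length out"
    "B + length out + length (ys @ ys') < 2 ^ w"
  note segments = segment_append[OF pre(2)]
  have "B + length out + length ys < 2 ^ w"
    using pre(4) by simp
  from transducesD[OF assms(1) pre(1) segments(1) pre(3) this]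
  show "wp w P (\<lambda>t. wp w P' (\<lambda>u (R', M'). t + u \<le> \<tau> + \<tau>' \<and> \<Psi>' R' \<and> R' rIn = R rIn + length (xs @ xs') \<and>
      R' rOut = B + length out + length (ys @ ys') \<and> M' = mem X B (out @ ys @ ys'))) (R, mem X B out)"
  proof (rule wp_mono)
    fix t s
    assume "case s of (R', M') \<Rightarrow> t \<le> \<tau> \<and> \<Psi> R' \<and> R' rIn = R rIn + length xs \<and>
      R' rOut = B + length out + length ys \<and> M' = mem X B (out @ ys)"
    then obtain R' where state: "s = (R', mem X B (out @ ys))" "t \<le> \<tau>" "\<Psi> R'" "R' rIn = R rIn + length xs"
      "R' rOut = B + length (out @ ys)"
      by (cases s) auto
    have "wp w P' (\<lambda>u (R'', M''). u \<le> \<tau>' \<and> \<Psi>' R'' \<and> R'' rIn = R' rIn + length xs' \<and>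
        R'' rOut = B + length (out @ ys) + length ys' \<and> M'' = mem X B ((out @ ys) @ ys'))
          (R', mem X B (out @ ys))"
      using state pre(4) segments(2) by (intro transducesD[OF assms(2)]) simp_all
    then show "wp w P' (\<lambda>u (R', M'). t + u \<le> \<tau> + \<tau>' \<and> \<Psi>' R' \<and> R' rIn = R rIn + length (xs @ xs') \<and>
        R' rOut = B + length out + length (ys @ ys') \<and> M' = mem X B (out @ ys @ ys')) s"
      unfolding state(1) by (rule wp_mono) (use state in auto)
  qed
qed

lemma transduces_silent:
  assumes "\<And>R out. \<Phi> R \<Longrightarrow>
    wp w P (\<lambda>t (R', M'). t \<le> \<tau> \<and> \<Psi> R' \<and> R' rIn = R rIn \<and> R' rOut = R rOut \<and> M' = mem X B out) (R, mem X B out)"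
  shows "transduces \<tau> P \<Phi> [] [] \<Psi>"
  unfolding transduces_def
proof (intro allI impI)
  fix R :: "nat \<Rightarrow> nat" and out :: "nat list"
  assume pre: "\<Phi> R" "R rOut = B + length out"
  show "wp w P (\<lambda>t (R', M'). t \<le> \<tau> \<and> \<Psi> R' \<and> R' rIn = R rIn + length ([] :: nat list) \<and>
      R' rOut = B + length out + length ([] :: nat list) \<and> M' = mem X B (out @ [])) (R, mem X B out)"
    by (rule wp_mono[OF assms[OF pre(1)]]) (use pre(2) in auto)
qed

lemma transduces_read:
  assumes "\<And>R. \<Phi> R \<Longrightarrow> R rOne = 1" "\<And>R p. \<Phi> R \<Longrightarrow> \<Psi> (R(r := x, rIn := p))" "r \<notin> {rIn, rOut, rOne}" "B < 2 ^ w"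
  shows "transduces 2 (read r) \<Phi> [x] [] \<Psi>"
  unfolding transduces_def
proof (intro allI impI)
  fix R :: "nat \<Rightarrow> nat" and out :: "nat list"
  assume pre: "\<Phi> R" "segment X (R rIn) [x]" "R rOut = B + length out"
  moreover from pre have "R rIn < length X" "X ! R rIn = x"
    using segment_singleton by blast+
  moreover from this have "x < 2 ^ w" "Suc (R rIn) < 2 ^ w"
    using input_below input_fits assms(4) by auto
  ultimately show "wp w (read r) (\<lambda>t (R', M'). t \<le> 2 \<and> \<Psi> R' \<and> R' rIn = R rIn + length [x] \<and>
      R' rOut = B + length out + length ([] :: nat list) \<and> M' = mem X B (out @ [])) (R, mem X B out)"
    using assms(1)[OF pre(1)] assms(2-) by (simp add: read_def wp_straight_line mem_def)
qed

lemma transduces_emit: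
  assumes "\<And>R. \<Phi> R \<Longrightarrow> R rOne = 1 \<and> R r = y" "\<And>R p. \<Phi> R \<Longrightarrow> \<Psi> (R(rOut := p))"
  shows "transduces 2 (emit r) \<Phi> [] [y] \<Psi>"
  unfolding transduces_def
proof (intro allI impI)
  fix R :: "nat \<Rightarrow> nat" and out :: "nat list"
  assume pre: "\<Phi> R" "R rOut = B + length out" "B + length out + length [y] < 2 ^ w"
  moreover have "(mem X B out)(B + length out := y) = mem X B (out @ [y])"
    using input_below by (auto simp: mem_def fun_eq_iff nth_append)
  ultimately show "wp w (emit r) (\<lambda>t (R', M'). t \<le> 2 \<and> \<Psi> R' \<and> R' rIn = R rIn + length ([] :: nat list) \<and>
      R' rOut = B + length out + length [y] \<and> M' = mem X B (out @ [y])) (R, mem X B out)"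
    using assms(1)[OF pre(1)] assms(2) by (simp add: emit_def wp_straight_line)
qed

lemma transduces_for_loop:
  assumes body: "\<And>i. i < N \<Longrightarrow> transduces \<tau> P (\<lambda>R. \<Phi> i R \<and> R c = N - i) (xs i) (ys i)
      (\<lambda>R. \<Phi> (Suc i) R \<and> R c = N - i)"
    and "\<And>i R. \<Phi> i R \<Longrightarrow> R rOne = 1" "\<And>i R v. \<Phi> i (R(c := v)) \<longleftrightarrow> \<Phi> i R" "c \<notin> {rIn, rOut}" "N < 2 ^ w"
  shows "transduces (N * (\<tau> + 2) + 1) (for_loop c P) (\<lambda>R. \<Phi> 0 R \<and> R c = N)
    (concat (map xs [0..<N])) (concat (map ys [0..<N])) (\<Phi> N)"
  unfolding transduces_def
proof (intro allI impI)
  fix R :: "nat \<Rightarrow> nat" and out :: "nat list"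
  let ?xs = "\<lambda>i. concat (map xs [0..<i])" and ?ys = "\<lambda>i. concat (map ys [0..<i])"
  assume pre: "\<Phi> 0 R \<and> R c = N" "segment X (R rIn) (?xs N)" "R rOut = B + length out"
    "B + length out + length (?ys N) < 2 ^ w"
  define I where "I i R' M' \<longleftrightarrow> \<Phi> i R' \<and> R' rIn = R rIn + length (?xs i) \<and>
    R' rOut = B + length (out @ ?ys i) \<and> M' = mem X B (out @ ?ys i)" for i R' M'
  have "wp w (for_loop c P) (\<lambda>t (R', M'). t \<le> N * (\<tau> + 2) + 1 \<and> I N R' M') (R, mem X B out)"
  proof (rule wp_for_loop)
    fix i R' M'
    assume i_less: "i < N" and invariant: "I i R' M'" and counter: "R' c = N - i"
    have "segment X (R' rIn) (xs i)"
      using invariant pre(2) segment_append unfolding I_def concat_map_upt_split[OF i_less, of xs] by metis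
    moreover have "length (?ys i @ ys i) \<le> length (?ys N)"
      unfolding concat_map_upt_split[OF i_less, of ys] by simp
    then have "B + length (out @ ?ys i) + length (ys i) < 2 ^ w"
      using pre(4) by simp
    moreover have memory_eq: "M' = mem X B (out @ ?ys i)"
      using invariant by (simp add: I_def)
    ultimately have "wp w P (\<lambda>t (R'', M''). t \<le> \<tau> \<and> (\<Phi> (Suc i) R'' \<and> R'' c = N - i) \<and>
        R'' rIn = R' rIn + length (xs i) \<and>
        R'' rOut = B + length (out @ ?ys i) + length (ys i) \<and> M'' = mem X B ((out @ ?ys i) @ ys i)) (R', M')"
      unfolding memory_eq using invariant counter
        by (intro transducesD[OF body[OF i_less]]) (simp_all add: I_def)
    then show "wp w P (\<lambda>t (R'', M''). t \<le> \<tau> \<and> R'' c = N - i \<and> I (Suc i) R'' M'') (R', M')"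
      by (rule wp_mono) (use invariant in \<open>auto simp: I_def\<close>)
  next
    show "I i (R'(c := v)) M' \<longleftrightarrow> I i R' M'" for i R' M' v
      unfolding I_def assms(3) using assms(4) by auto
  next
    show "R' rOne = 1" if "I i R' M'" for i R' M'
      using that assms(2) unfolding I_def by blast
  qed (use assms(5) pre in \<open>simp_all add: I_def\<close>)
  then show "wp w (for_loop c P) (\<lambda>t (R', M'). t \<le> N * (\<tau> + 2) + 1 \<and> \<Phi> N R' \<and> R' rIn = R rIn + length (?xs N) \<and>
      R' rOut = B + length out + length (?ys N) \<and> M' = mem X B (out @ ?ys N)) (R, mem X B out)"
    by (rule wp_mono) (auto simp: I_def)
qed

end

section \<open>The reduction on the word RAM\<close>

fun unflagged_program :: "problem \<Rightarrow> nat \<Rightarrow> com" where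
  "unflagged_program FOV j = (if j = 0
     then Op Sub rTmp rMask rIndex ;; Op Mul rTmp rZ rTmp ;; Op Add rTmp rIndex rTmp
     else Op Add rTmp rCoblock rIndex ;; Op Add rTmp rTmp rZ ;; Op Mul rTmp rZ rTmp ;;
       Op Sub rAux rMask rIndex ;; Op Add rTmp rAux rTmp)"
| "unflagged_program FXOR j = Op Add rTmp rIndex 0"
| "unflagged_program FSUM j = (if j = 0 then Op Sub rTmp rZ rIndex
     else if j = 1 then Op Add rTmp rZ rZ ;; Op Add rTmp rTmp rZ ;; Op Add rTmp rTmp rIndex
     else Op Add rTmp rIndex 0)"

definition code_program :: "problem \<Rightarrow> nat \<Rightarrow> com" where
  "code_program prob j = (if j = 0
     then unflagged_program prob j ;; Op Add rAux rThree rIndex ;; Load rAux rAux ;; Op Sub rAux rOne rAux ;;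
       Op Mul rAux rAux rFlag ;; Op Add rTmp rTmp rAux
     else unflagged_program prob j)"

definition write_fiber :: "problem \<Rightarrow> nat \<Rightarrow> com" where
  "write_fiber prob j = for_loop rFiber ((code_program prob j ;; emit rTmp) ;; Op Add rIndex rIndex rStep)"

definition expand_word :: "problem \<Rightarrow> nat \<Rightarrow> com" where
  "expand_word prob j =
     read rIndex ;; (Op Mul rIndex rIndex rShift ;; Op Add rFiber rSize 0) ;; write_fiber prob j"

definition expand_list :: "problem \<Rightarrow> nat \<Rightarrow> com" where
  "expand_list prob j = read rWords ;; Op Mul rTmp rWords rSize ;; emit rTmp ;;
      for_loop rWords (expand_word prob j)"

definition expand_lists :: "problem \<Rightarrow> nat \<Rightarrow> com" where
  "expand_lists prob j = Op Add rLists rNG 0 ;; for_loop rLists (expand_list prob j)"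

definition set_parameters :: "nat \<Rightarrow> com" where
  "set_parameters j = Const rTmp j ;; Op Mul rTmp rTmp rB ;; Op Shl rShift rOne rTmp ;;
     (if j = 0 then Op Div rSize rZ rE ;; Op Add rStep rE 0
      else if j = 1 then Op Add rSize rE 0 ;; Op Add rStep rOne 0 ;;
        Op Mul rCoblock rE rE ;; Op Sub rCoblock rZ rCoblock
      else Op Add rSize rOne 0 ;; Op Add rStep rOne 0 ;;
        Op Mul rCoblock rE rShift ;; Op Sub rCoblock rCoblock rShift ;; Op Sub rCoblock rMask rCoblock)"

primrec expand_sets :: "problem \<Rightarrow> nat list \<Rightarrow> com" where
  "expand_sets prob [] = Const rTmp 0"
| "expand_sets prob (j # js) = (set_parameters j ;; expand_lists prob j) ;; expand_sets prob js"

definition load_constants :: "problem \<Rightarrow> nat \<Rightarrow> com" where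
  "load_constants prob k =
     Const rOne 1 ;; Const rThree 3 ;; Const rIn 2 ;; Load rN 0 ;; Load rG rOne ;; Load rB rIn ;;
     Op Mul rNG rN rG ;; Op Shl rE rOne rB ;; Const rZ k ;; Op Mul rZ rZ rB ;; Op Shl rZ rOne rZ ;;
     Op Sub rMask rZ rOne ;; (if prob = FOV then Op Mul rFlag rZ rZ else Op Add rFlag rZ 0) ;;
     Op Add rIn rThree rZ ;; Const rBase k ;; Op Mul rBase rBase rNG ;; Op Add rTmp rE rOne ;;
     Op Mul rBase rBase rTmp ;; Op Add rBase rIn rBase ;; Op Add rOut rBase 0"

fun width_program :: "problem \<Rightarrow> com" where
  "width_program FOV = Op Add rTmp rTmp rTmp ;; Op Add rTmp rTmp rOne"
| "width_program FXOR = Op Add rTmp rTmp rOne"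
| "width_program FSUM = Op Add rTmp rTmp rOne ;; Op Add rTmp rTmp rOne"

definition write_header :: "problem \<Rightarrow> nat \<Rightarrow> com" where
  "write_header prob k =
     emit rN ;; emit rG ;; (Const rTmp k ;; Op Mul rTmp rTmp rB ;; width_program prob) ;; emit rTmp"

primrec clear_registers :: "nat \<Rightarrow> com" where
  "clear_registers 0 = Const 0 0"
| "clear_registers (Suc r) = Const (Suc r) 0 ;; clear_registers r"

definition copy_output :: com where
  "copy_output = Op Sub rLists rOut rBase ;; Op Add rIn rBase 0 ;; Op Add rOut 0 0 ;;
     for_loop rLists (read rTmp ;; emit rTmp)"

definition erase_source :: com where
  "erase_source = Op Add rLists rBase 0 ;; for_loop rLists (emit 0)"

definition reduction :: "problem \<Rightarrow> nat \<Rightarrow> com" where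
  "reduction prob k = load_constants prob k ;; (write_header prob k ;; expand_sets prob [0..<k]) ;;
      copy_output ;; erase_source ;; clear_registers rFlag"

lemma length_enc_lists_le:
  assumes "\<forall>ns\<in>set nss. length ns \<le> l"
  shows "length (enc_lists nss) \<le> length nss * (l + 1)"
  using assms by (induction nss) (auto simp: enc_lists_def enc_list_def)

lemma length_concat_upt_le:
  assumes "\<And>j. j < m \<Longrightarrow> length (f j) \<le> l"
  shows "length (concat (map f [0..<m])) \<le> m * l"
  using assms by (induction m) (simp_all add: add.commute[of l] add_mono)

context digit_code
begin

lemma fiber_bounds: "0 < fiber_size j" "2 ^ b * fiber_size j \<le> Z" "fiber_size j \<le> Z" "fiber_step j \<le> Z"
proof -
  have "2 * b \<le> k * b" "b \<le> k * b"
    using two_le_k by simp_all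
  then have "(2::nat) ^ (b + b) \<le> Z" "(2::nat) ^ b \<le> Z"
    by (simp_all flip: mult_2)
  then show size: "2 ^ b * fiber_size j \<le> Z" and "fiber_step j \<le> Z"
    by (auto simp: fiber_size_def fiber_step_def power_add Z_eq)
  show "fiber_size j \<le> Z"
    using size by (rule le_trans[rotated]) simp
qed (simp add: fiber_size_def)

lemma block_1: "2 ^ b * 2 ^ b = Suc (block 1)"
  by (simp add: block_def mask_eq_exp_minus_1 mult_2 power_add)

lemma block_ge_2: "2 \<le> j \<Longrightarrow> 2 ^ b * 2 ^ (j * b) - 2 ^ (j * b) = block j"
  by (simp add: block_def push_bit_eq_mult mask_eq_exp_minus_1 diff_mult_distrib)

lemma fiber_count_le:
  assumes "l \<le> 2 ^ b"
  shows "l * fiber_size j \<le> Z" "l \<le> Z"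
proof -
  have "l * fiber_size j \<le> 2 ^ b * fiber_size j" "l * 1 \<le> l * fiber_size j"
    using assms fiber_bounds(1)[of j] by (simp_all add: Suc_leI)
  then show "l * fiber_size j \<le> Z" "l \<le> Z"
    using fiber_bounds(2)[of j] by linarith+
qed

lemma length_list_image_le: "length ns \<le> 2 ^ b \<Longrightarrow> length (list_image prob T j ns) \<le> Z"
  unfolding length_list_image by (rule fiber_count_le)

definition volume :: "nat \<Rightarrow> nat \<Rightarrow> nat" where
  "volume n g = (n + 1) * (g + 1) * (k * (Z * Z))"

lemma volume_ge:
  "Z * Z \<le> volume n g" "(n * g + 1) * (k * Z) \<le> volume n g" "n \<le> volume n g" "g \<le> volume n g"
  "k \<le> volume n g" "n * g \<le> volume n g"
proof -
  have "Z * Z \<le> k * (Z * Z)" "k \<le> k * (Z * Z)"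
    using two_le_k by simp_all
  moreover have "k * (Z * Z) \<le> volume n g"
    by (simp add: volume_def)
  ultimately show "Z * Z \<le> volume n g" "k \<le> volume n g"
    by (blast intro: le_trans)+
  show "(n * g + 1) * (k * Z) \<le> volume n g"
    unfolding volume_def by (intro mult_le_mono) simp_all
  have "(n + 1) * (g + 1) * 1 \<le> volume n g"
    unfolding volume_def using two_le_k by (intro mult_le_mono order_refl) simp
  then show "n \<le> volume n g" "g \<le> volume n g" "n * g \<le> volume n g"
    by simp_all
qed

end

text \<open>The output is first written behind the input, which ends before the base address.\<close>

locale reduction_input = digit_code k b for k b :: nat +
  fixes w :: nat and prob :: problem and T :: "nat \<Rightarrow> bool" and n g :: nat and nsss :: "nat list list list"
  assumes lists: "length nsss = k" "set nsss \<subseteq> word_lists (n * g) b"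
    and word_length: "16 * volume n g < 2 ^ w"
begin

definition input :: "nat list" where
  "input = [n, g, b] @ map (\<lambda>u. of_bool (T u)) [0..<Z] @ concat (map enc_lists nsss)"

definition translation :: "nat list" where
  "translation = [n, g, width prob] @
      concat (map (\<lambda>j. enc_lists (map (list_image prob T j) (nsss ! j))) [0..<k])"

definition base :: nat where
  "base = 3 + Z + k * (n * g * (2 ^ b + 1))"

lemma fits: "x \<le> 4 * (Z * Z) \<Longrightarrow> x < 2 ^ w" and Z_fits: "4 * Z < 2 ^ w"
proof -
  have "4 * Z \<le> 4 * (Z * Z)"
    by simp
  then show "x \<le> 4 * (Z * Z) \<Longrightarrow> x < 2 ^ w" "4 * Z < 2 ^ w"
    using volume_ge(1)[of n g] word_length by linarith+
qed

lemma lists_nth: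
  assumes "j < k"
  shows "nsss ! j \<in> word_lists (n * g) b"
  using assms lists by (metis nth_mem subsetD)

lemma length_input_le: "length input \<le> base"
proof -
  have "length (enc_lists (nsss ! j)) \<le> n * g * (2 ^ b + 1)" if "j < k" for j
    using lists_nth[OF that] length_enc_lists_le[of "nsss ! j" "2 ^ b"] by (auto simp: word_lists_def)
  then have "length (concat (map (\<lambda>j. enc_lists (nsss ! j)) [0..<k])) \<le> k * (n * g * (2 ^ b + 1))"
    by (rule length_concat_upt_le)
  moreover have "map (\<lambda>j. enc_lists (nsss ! j)) [0..<k] = map enc_lists nsss"
    using lists(1) by (auto simp: list_eq_iff_nth_eq)
  ultimately show ?thesis
    by (simp add: input_def base_def)
qed

lemma length_translation_le: "length translation \<le> 3 + k * (n * g * (Z + 1))"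
proof -
  have "length (enc_lists (map (list_image prob T j) (nsss ! j))) \<le> n * g * (Z + 1)" if "j < k" for j
    using lists_nth[OF that] length_enc_lists_le[of "map (list_image prob T j) (nsss ! j)" Z]
      length_list_image_le
    by (auto simp: word_lists_def)
  then have "length (concat (map (\<lambda>j. enc_lists (map (list_image prob T j) (nsss ! j))) [0..<k])) \<le>
      k * (n * g * (Z + 1))"
    by (rule length_concat_upt_le)
  then show ?thesis
    by (simp add: translation_def)
qed

lemma base_fits: "base + length translation < 2 ^ w" "base < 2 ^ w"
proof -
  have Z_bounds: "(2::nat) ^ b \<le> Z" "1 \<le> Z" "Z \<le> k * Z"
    using two_le_k by simp_all
  then have "k * (n * g * (2 ^ b + 1)) \<le> k * (n * g * (2 * Z))" "k * (n * g * (Z + 1)) \<le> k * (n * g * (2 * Z))"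
    by (intro mult_le_mono order_refl; linarith)+
  moreover have "k * (n * g * (2 * Z)) = 2 * (n * g * (k * Z))"
    by simp
  moreover have "n * g * (k * Z) + Z \<le> volume n g"
    using Z_bounds(3) volume_ge(2)[of n g] unfolding distrib_right by linarith
  ultimately have "base + length translation \<le> 16 * volume n g"
    using length_translation_le Z_bounds(2) unfolding base_def by linarith
  then show "base + length translation < 2 ^ w" "base < 2 ^ w"
    using word_length by linarith+
qed

lemma sizes_fit: "n < 2 ^ w" "g < 2 ^ w" "b < 2 ^ w" "k < 2 ^ w" "k * b < 2 ^ w" "n * g < 2 ^ w"
  "width prob < 2 ^ w"
proof -
  show "n < 2 ^ w" "g < 2 ^ w" "k < 2 ^ w" "n * g < 2 ^ w"
    using volume_ge[where n = n and g = g] word_length by linarith+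
  have "k * b < Z"
    by simp
  moreover have "1 * b \<le> k * b"
    using two_le_k by (intro mult_le_mono1) simp
  moreover have "width prob \<le> 2 * (k * b) + 2"
    by (cases prob) simp_all
  ultimately show "b < 2 ^ w" "k * b < 2 ^ w" "width prob < 2 ^ w"
    using Z_fits by linarith+
qed

lemma small_fit: "b < w" "k * b < w" "Z < 2 ^ w" "Suc 0 < 2 ^ w"
proof -
  show "Z < 2 ^ w"
    using Z_fits by linarith
  then show "k * b < w"
    by simp
  moreover have "1 * b \<le> k * b"
    using two_le_k by (intro mult_le_mono1) simp
  ultimately show "b < w"
    by linarith
  show "Suc 0 < 2 ^ w"
    using sizes_fit(4) two_le_k by linarith
qed

lemma code_fits:
  assumes "j < k" "submask y (block j)"
  shows "code prob S j y < 2 ^ w"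
proof -
  have "code prob S j y < 2 ^ width prob"
    using assms by (intro code_less)
  also have "(2::nat) ^ width prob \<le> 4 * (Z * Z)"
    by (cases prob) (simp_all add: power_add)
  finally show ?thesis
    by (intro fits less_imp_le)
qed

lemma enc_lists_fit:
  assumes "\<forall>ns\<in>set nss. length ns \<le> Z \<and> (\<forall>x\<in>set ns. x < 2 ^ w)" "x \<in> set (enc_lists nss)"
  shows "x < 2 ^ w"
proof -
  obtain ns where ns: "ns \<in> set nss" "x = length ns \<or> x \<in> set ns"
    using assms(2) by (auto simp: enc_lists_def enc_list_def)
  then show ?thesis
    using assms(1) Z_fits by fastforce
qed

lemma input_fits_word:
  assumes "x \<in> set input"
  shows "x < 2 ^ w"
proof -
  consider "x \<in> {n, g, b}" | "x \<le> 1" | nss where "nss \<in> set nsss" "x \<in> set (enc_lists nss)"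
    using assms by (auto simp: input_def)
  then show ?thesis
  proof cases
    case 2
    then show ?thesis
      using sizes_fit(4) two_le_k by linarith
  next
    case 3
    have "2 ^ b \<le> Z"
      using two_le_k by simp
    have "length ns \<le> 2 ^ b" "\<forall>y\<in>set ns. y < 2 ^ b" if "ns \<in> set nss" for ns
      using lists(2) 3(1) that unfolding word_lists_def by blast+
    moreover have "y < 2 ^ w" if "y < 2 ^ b" for y :: nat
      using that \<open>2 ^ b \<le> Z\<close> Z_fits by linarith
    ultimately have "length ns \<le> Z \<and> (\<forall>y\<in>set ns. y < 2 ^ w)" if "ns \<in> set nss" for ns
      using that \<open>2 ^ b \<le> Z\<close> le_trans by blast
    then show ?thesis
      using enc_lists_fit 3(2) by blast
  qed (use sizes_fit in auto)
qed

lemma translation_fits_word: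
  assumes "x \<in> set translation"
  shows "x < 2 ^ w"
proof -
  consider "x \<in> {n, g, width prob}" | j where "j < k"
    "x \<in> set (enc_lists (map (list_image prob T j) (nsss ! j)))"
    using assms by (auto simp: translation_def)
  then show ?thesis
  proof cases
    case 2
    have "length ns \<le> Z \<and> (\<forall>y\<in>set ns. y < 2 ^ w)" if ns: "ns \<in> set (map (list_image prob T j) (nsss ! j))"
      for ns
    proof -
      obtain xs where xs: "ns = list_image prob T j xs" "length xs \<le> 2 ^ b" "\<forall>x\<in>set xs. x < 2 ^ b"
        using ns lists_nth[OF 2(1)] by (auto simp: word_lists_def)
      moreover have "y < 2 ^ w" if "y \<in> set ns" for y
        using that xs(1,3) code_fits[OF 2(1)] set_fibers[of xs j] by (auto simp: list_image_def)
      ultimately show ?thesis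
        using length_list_image_le by blast
    qed
    then show ?thesis
      using enc_lists_fit 2(2) by blast
  qed (use sizes_fit in auto)
qed

sublocale stream w input base
  by unfold_locales (use length_input_le input_fits_word in blast)+

lemma
  shows table: "u < Z \<Longrightarrow> input ! (3 + u) = of_bool (T u)" and table_below: "3 + Z \<le> length input"
  by (simp_all add: input_def nth_append)

definition constants :: "(nat \<Rightarrow> nat) \<Rightarrow> bool" where
  "constants R \<longleftrightarrow> R 0 = 0 \<and> R rOne = 1 \<and> R rThree = 3 \<and> R rN = n \<and> R rG = g \<and> R rB = b \<and> R rNG = n * g \<and>
     R rZ = Z \<and> R rE = 2 ^ b \<and> R rMask = mask (k * b) \<and> R rBase = base \<and> R rFlag = flag prob \<and>
       (\<forall>r. r = 1 \<or> rFlag < r \<longrightarrow> R r = 0)"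

definition parameters :: "nat \<Rightarrow> (nat \<Rightarrow> nat) \<Rightarrow> bool" where
  "parameters j R \<longleftrightarrow> constants R \<and> R rSize = fiber_size j \<and> R rShift = 2 ^ (j * b) \<and> R rStep = fiber_step j \<and>
     (j \<noteq> 0 \<longrightarrow> R rCoblock = mask (k * b) - block j)"

lemma constants_upd [simp]: "1 < r \<Longrightarrow> r < rOne \<Longrightarrow> constants (R(r := v)) \<longleftrightarrow> constants R"
  by (auto simp: constants_def)

lemma parameters_upd [simp]: "1 < r \<Longrightarrow> r < rSize \<Longrightarrow> parameters j (R(r := v)) \<longleftrightarrow> parameters j R"
  by (auto simp: parameters_def)

lemma parameters_cong:
  assumes "\<forall>r. r \<noteq> rTmp \<longrightarrow> r \<noteq> rAux \<longrightarrow> R' r = R r"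
  shows "parameters j R' \<longleftrightarrow> parameters j R"
  using assms by (auto simp: parameters_def constants_def)

lemma parameters_one: "parameters j R \<Longrightarrow> R rOne = 1"
  by (simp add: parameters_def constants_def)

lemma wp_unflagged_program:
  fixes R :: "nat \<Rightarrow> nat"
  assumes position: "j < k" and state: "parameters j R" "submask (R rIndex) (block j)"
    and post: "\<And>t R'. t \<le> 5 \<Longrightarrow> (\<forall>r. r \<noteq> rTmp \<longrightarrow> r \<noteq> rAux \<longrightarrow> R' r = R r) \<Longrightarrow>
      R' rTmp = unflagged prob j (R rIndex) \<Longrightarrow> Q t (R', M)"
  shows "wp w (unflagged_program prob j) Q (R, M)"
proof -
  let ?u = "R rIndex" and ?F = "mask (k * b) :: nat"
  have index_bounds: "?u < Z" "?F - ?u < Z" "?F - block j + ?u < Z"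
    using submask_block_less[OF state(2) position] coblock_plus_less[OF state(2) position]
      by (simp_all add: mask_eq_exp_minus_1)
  have regs: "R 0 = 0" "R rZ = Z" "R rMask = ?F" "j \<noteq> 0 \<Longrightarrow> R rCoblock = ?F - block j"
    using state(1) by (simp_all add: parameters_def constants_def)
  have result: "unflagged prob j ?u < 2 ^ w"
    using code_fits[OF position state(2), of "\<lambda>_. True"] by (simp add: code_def)
  have Z_bounds: "1 \<le> Z" "Z \<le> Z * Z"
    by simp_all
  have product: "Z * x < 2 ^ w" if "x \<le> 4 * Z" for x
    using mult_le_mono2[OF that, of Z] by (intro fits) simp
  have sum: "x < 2 ^ w" if "x \<le> 4 * Z" for x
    using that Z_bounds(2) by (intro fits) linarith
  show ?thesis
  proof (cases "prob = FOV \<and> j \<noteq> 0")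
    case True
    then show ?thesis
      using result index_bounds sum product regs by (auto simp: wp_straight_line intro!: post)
  next
    case False
    then show ?thesis
      using result index_bounds sum product regs by (cases prob) (auto simp: wp_straight_line intro!: post)
  qed
qed

lemma wp_code_program:
  fixes R :: "nat \<Rightarrow> nat"
  assumes position: "j < k" and state: "parameters j R" "submask (R rIndex) (block j)"
    and post: "\<And>t R'. t \<le> 10 \<Longrightarrow> (\<forall>r. r \<noteq> rTmp \<longrightarrow> r \<noteq> rAux \<longrightarrow> R' r = R r) \<Longrightarrow>
      R' rTmp = code prob T j (R rIndex) \<Longrightarrow> Q t (R', mem input base out)"
  shows "wp w (code_program prob j) Q (R, mem input base out)"
proof (cases "j = 0")
  case True
  define u where "u = R rIndex"
  have index_less: "u < Z"
    using submask_block_less[OF state(2) position] by (simp add: u_def)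
  have "mem input base out (3 + u) = of_bool (T u)" "3 + u < 2 ^ w"
    using table[OF index_less] table_below length_input_le base_fits index_less by (simp_all add: mem_def)
  moreover have "flag prob < 2 ^ w"
    by (rule fits) (cases prob, simp_all)
  moreover have "unflagged prob 0 u + (1 - of_bool (T u)) * flag prob = code prob T 0 u"
    "code prob T 0 u < 2 ^ w"
    using code_fits[OF position state(2)] True by (simp_all add: code_def u_def)
  moreover have "R' rIndex = u" "R' rOne = 1" "R' rThree = 3" "R' rFlag = flag prob"
    if "\<forall>r. r \<noteq> rTmp \<longrightarrow> r \<noteq> rAux \<longrightarrow> R' r = R r" for R'
    using that state(1) by (simp_all add: parameters_def constants_def u_def)
  ultimately have "wp w (Op Add rAux rThree rIndex ;; Load rAux rAux ;; Op Sub rAux rOne rAux ;;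
      Op Mul rAux rAux rFlag ;; Op Add rTmp rTmp rAux) (\<lambda>t'. Q (t + t')) (R', mem input base out)"
    if "t \<le> 5" "\<forall>r. r \<noteq> rTmp \<longrightarrow> r \<noteq> rAux \<longrightarrow> R' r = R r" "R' rTmp = unflagged prob 0 u" for t R'
    using that True by (auto simp: wp_straight_line u_def intro!: post)
  then show ?thesis
    unfolding code_program_def wp_Seq if_P[OF True] u_def
    using position state by (intro wp_unflagged_program) (auto simp: True)
next
  case False
  then show ?thesis
    unfolding code_program_def if_not_P[OF False]
    using position state by (intro wp_unflagged_program post) (auto simp: code_def)
qed

lemma position_fits:
  assumes "j < k"
  shows "j < 2 ^ w" "j * b < w" "j * b < 2 ^ w" "block j < 2 ^ w" "mask (k * b) - block j < 2 ^ w"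
proof -
  have "j * b \<le> k * b"
    using assms by (intro mult_le_mono1) simp
  then show "j < 2 ^ w" "j * b < w" "j * b < 2 ^ w"
    using assms sizes_fit(4,5) small_fit(2) by linarith+
  have "mask (k * b) < Z"
    by (simp add: mask_eq_exp_minus_1)
  then show "block j < 2 ^ w" "mask (k * b) - block j < 2 ^ w"
    using block_less[OF assms] small_fit(3) by linarith+
qed

lemma transduces_set_parameters:
  assumes "j < k"
  shows "transduces 8 (set_parameters j) constants [] [] (parameters j)"
proof (rule transduces_silent)
  fix R :: "nat \<Rightarrow> nat" and out :: "nat list"
  let ?post = "\<lambda>t (R', M'). t \<le> 8 \<and> parameters j R' \<and> R' rIn = R rIn \<and> R' rOut = R rOut \<and>
      M' = mem input base out"
  assume state: "constants R"
  then have regs: "R 0 = 0" "R rOne = 1" "R rB = b" "R rZ = Z" "R rE = 2 ^ b" "R rMask = mask (k * b)"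
    by (simp_all add: constants_def)
  note simps = set_parameters_def wp_straight_line parameters_def fiber_step_def
  consider "j = 0" | "j = 1" | "2 \<le> j"
    by linarith
  then show "wp w (set_parameters j) ?post (R, mem input base out)"
  proof cases
    case 1
    have "Z div 2 ^ b = fiber_size 0" "fiber_size 0 < 2 ^ w"
      using fiber_bounds(3)[of 0] small_fit(3) by (simp add: fiber_size_def Z_eq, linarith)
    then show ?thesis
      using 1 state by (simp add: simps regs position_fits[OF assms] small_fit)
  next
    case 2
    have "Suc (block 1) \<le> Z"
      using block_less[of 1] two_le_k by simp
    then have "Suc (block 1) < 2 ^ w"
      using small_fit(3) by linarith
    moreover have "Z - Suc (block 1) = mask (k * b) - block 1"
      by (simp add: mask_eq_exp_minus_1)
    ultimately show ?thesis
      using 2 state sizes_fit(3) block_1 position_fits(5)[OF assms]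
        by (simp add: simps regs small_fit fiber_size_def)
  next
    case 3
    note block_ge_2[OF 3]
    moreover have "Suc j * b \<le> k * b"
      using assms by (intro mult_le_mono1) simp
    then have "2 ^ b * 2 ^ (j * b) \<le> Z"
      by (simp flip: power_add)
    then have "2 ^ b * 2 ^ (j * b) < (2::nat) ^ w"
      using small_fit(3) by linarith
    ultimately show ?thesis
      using 3 state by (simp add: simps regs position_fits[OF assms] small_fit fiber_size_def)
  qed
qed

definition loop_state :: "nat \<Rightarrow> nat \<Rightarrow> nat \<Rightarrow> (nat \<Rightarrow> nat) \<Rightarrow> bool" where
  "loop_state j l m R \<longleftrightarrow> parameters j R \<and> R rLists = l \<and> R rWords = m"

lemma loop_state_upd [simp]:
  "r \<in> {rIn, rOut, rFiber, rIndex, rTmp, rAux} \<Longrightarrow> loop_state j l m (R(r := v)) \<longleftrightarrow> loop_state j l m R"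
  by (auto simp: loop_state_def)

lemma loop_state_one: "loop_state j l m R \<Longrightarrow> R rOne = 1"
  unfolding loop_state_def by (blast dest: parameters_one)

lemma transduces_code:
  assumes "j < k" "submask y (block j)"
  shows "transduces 12 (code_program prob j ;; emit rTmp) (\<lambda>R. loop_state j l m R \<and> R rFiber = i \<and> R rIndex = y)
    [] [code prob T j y] (\<lambda>R. loop_state j l m R \<and> R rFiber = i \<and> R rIndex = y)"
proof -
  let ?\<Phi> = "\<lambda>R. loop_state j l m R \<and> R rFiber = i \<and> R rIndex = y"
  have "transduces 10 (code_program prob j) ?\<Phi> [] [] (\<lambda>R. ?\<Phi> R \<and> R rTmp = code prob T j y)"
  proof (rule transduces_silent)
    fix R :: "nat \<Rightarrow> nat" and out
    assume state: "?\<Phi> R"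
    show "wp w (code_program prob j) (\<lambda>t (R', M'). t \<le> 10 \<and> (?\<Phi> R' \<and> R' rTmp = code prob T j y) \<and>
        R' rIn = R rIn \<and> R' rOut = R rOut \<and> M' = mem input base out) (R, mem input base out)"
      using state assms by (intro wp_code_program)
        (auto simp: loop_state_def intro: parameters_cong[THEN iffD2])
  qed
  moreover have "transduces 2 (emit rTmp) (\<lambda>R. ?\<Phi> R \<and> R rTmp = code prob T j y) [] [code prob T j y] ?\<Phi>"
    by (rule transduces_emit) (auto simp: loop_state_def parameters_one)
  ultimately show ?thesis
    using transduces_Seq by fastforce
qed

lemma fiber_index:
  assumes "j < k" "x < 2 ^ b" "i < fiber_size j"
  shows "submask (x * 2 ^ (j * b) + i * fiber_step j) (block j)"
    "x * 2 ^ (j * b) + i * fiber_step j < 2 ^ w" "x * 2 ^ (j * b) + Suc i * fiber_step j < 2 ^ w"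
proof -
  let ?y = "x * 2 ^ (j * b) + i * fiber_step j"
  have "?y \<in> set (fiber j x)"
    using assms(3) by (auto simp: fiber_def)
  then show submask: "submask ?y (block j)"
    using set_fiber[OF assms(2)] by blast
  show "?y < 2 ^ w" "x * 2 ^ (j * b) + Suc i * fiber_step j < 2 ^ w"
    using submask_block_less[OF submask assms(1)] fiber_bounds(4)[of j] Z_fits unfolding mult_Suc by linarith+
qed

lemma transduces_write_fiber:
  assumes "j < k" "x < 2 ^ b"
  shows "transduces (15 * fiber_size j + 1) (write_fiber prob j)
    (\<lambda>R. loop_state j l m R \<and> R rIndex = x * 2 ^ (j * b) \<and> R rFiber = fiber_size j) []
    (map (code prob T j) (fiber j x)) (loop_state j l m)"
proof -
  let ?y = "\<lambda>i. x * 2 ^ (j * b) + i * fiber_step j" and ?P = "code_program prob j ;; emit rTmp"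
  let ?\<Phi> = "\<lambda>i R. loop_state j l m R \<and> R rIndex = ?y i"
  note index = fiber_index[OF assms]
  have "transduces (fiber_size j * (13 + 2) + 1) (for_loop rFiber (?P ;; Op Add rIndex rIndex rStep))
      (\<lambda>R. ?\<Phi> 0 R \<and> R rFiber = fiber_size j) (concat (map (\<lambda>i. []) [0..<fiber_size j]))
      (concat (map (\<lambda>i. [code prob T j (?y i)]) [0..<fiber_size j])) (?\<Phi> (fiber_size j))"
  proof (rule transduces_for_loop[where \<Phi> = ?\<Phi>])
    fix i
    assume i_less: "i < fiber_size j"
    have "transduces 1 (Op Add rIndex rIndex rStep)
        (\<lambda>R. loop_state j l m R \<and> R rFiber = fiber_size j - i \<and> R rIndex = ?y i) [] []
        (\<lambda>R. ?\<Phi> (Suc i) R \<and> R rFiber = fiber_size j - i)"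
      using index(3)[OF i_less] by (intro transduces_silent)
        (auto simp: wp_straight_line loop_state_def parameters_def constants_def add_ac)
    from transduces_Seq[OF transduces_code[OF assms(1) index(1)[OF i_less]] this]
    show "transduces 13 (?P ;; Op Add rIndex rIndex rStep) (\<lambda>R. ?\<Phi> i R \<and> R rFiber = fiber_size j - i) []
        [code prob T j (?y i)] (\<lambda>R. ?\<Phi> (Suc i) R \<and> R rFiber = fiber_size j - i)"
      by (rule transduces_mono) auto
  qed (use fiber_bounds(3)[of j] Z_fits loop_state_one in auto)
  then show ?thesis
    unfolding write_fiber_def by (rule transduces_mono) (auto simp: fiber_def)
qed

lemma transduces_expand_word:
  assumes "j < k" "x < 2 ^ b"
  shows "transduces (15 * fiber_size j + 5) (expand_word prob j) (loop_state j l m) [x]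
      (map (code prob T j) (fiber j x))
    (loop_state j l m)"
proof -
  have read: "transduces 2 (read rIndex) (loop_state j l m) [x] [] (\<lambda>R. loop_state j l m R \<and> R rIndex = x)"
    by (rule transduces_read) (auto simp: loop_state_one base_fits)
  have "x * 2 ^ (j * b) < 2 ^ w" "fiber_size j < 2 ^ w"
    using fiber_index(2)[OF assms fiber_bounds(1)] fiber_bounds(3)[of j] Z_fits by auto
  then have start: "transduces 2 (Op Mul rIndex rIndex rShift ;; Op Add rFiber rSize 0)
      (\<lambda>R. loop_state j l m R \<and> R rIndex = x) [] []
      (\<lambda>R. loop_state j l m R \<and> R rIndex = x * 2 ^ (j * b) \<and> R rFiber = fiber_size j)"
    by (intro transduces_silent) (auto simp: wp_straight_line loop_state_def parameters_def constants_def)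
  from transduces_Seq[OF read transduces_Seq[OF start transduces_write_fiber[OF assms]]] show ?thesis
    unfolding expand_word_def by (rule transduces_mono) auto
qed

lemma map_nth_eq: "map (\<lambda>i. h (xs ! i)) [0..<length xs] = map h xs"
  by (rule nth_equalityI) simp_all

lemma transduces_expand_list:
  assumes position: "j < k" and ns: "length ns \<le> 2 ^ b" "\<forall>n\<in>set ns. n < 2 ^ b"
  shows "transduces (30 * Z) (expand_list prob j) (\<lambda>R. parameters j R \<and> R rLists = l) (enc_list ns)
    (enc_list (list_image prob T j ns)) (\<lambda>R. parameters j R \<and> R rLists = l)"
proof -
  let ?s = "fiber_size j" and ?N = "length ns"
  have size: "?N * ?s \<le> Z" "?N \<le> Z" "1 \<le> Z"
    using fiber_count_le[OF ns(1)] by simp_all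
  have read: "transduces 2 (read rWords) (\<lambda>R. parameters j R \<and> R rLists = l) [?N] [] (loop_state j l ?N)"
    by (rule transduces_read) (auto simp: loop_state_def parameters_one base_fits)
  have count: "transduces 1 (Op Mul rTmp rWords rSize) (loop_state j l ?N) [] []
      (\<lambda>R. loop_state j l ?N R \<and> R rTmp = ?N * ?s)"
    using size Z_fits by (intro transduces_silent)
      (auto simp: wp_straight_line loop_state_def parameters_def constants_def)
  have emit: "transduces 2 (emit rTmp) (\<lambda>R. loop_state j l ?N R \<and> R rTmp = ?N * ?s) [] [?N * ?s]
      (\<lambda>R. (parameters j R \<and> R rLists = l) \<and> R rWords = ?N)"
    by (rule transduces_emit) (auto simp: loop_state_def parameters_one)
  have loop: "transduces (?N * (15 * ?s + 5 + 2) + 1) (for_loop rWords (expand_word prob j))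
      (\<lambda>R. (parameters j R \<and> R rLists = l) \<and> R rWords = ?N) (concat (map (\<lambda>i. [ns ! i]) [0..<?N]))
      (concat (map (\<lambda>i. map (code prob T j) (fiber j (ns ! i))) [0..<?N])) (\<lambda>R. parameters j R \<and> R rLists = l)"
  proof (rule transduces_for_loop[where \<Phi> = "\<lambda>_ R. parameters j R \<and> R rLists = l"])
    show "transduces (15 * ?s + 5) (expand_word prob j) (\<lambda>R. (parameters j R \<and> R rLists = l) \<and>
        R rWords = ?N - i)
        [ns ! i] (map (code prob T j) (fiber j (ns ! i)))
          (\<lambda>R. (parameters j R \<and> R rLists = l) \<and> R rWords = ?N - i)"
      if "i < ?N" for i
      using ns(2) that by (intro transduces_mono[OF transduces_expand_word[OF position]])
        (auto simp: loop_state_def)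
  qed (use size(2) Z_fits parameters_one in auto)
  have "enc_list ns = [?N] @ [] @ [] @ concat (map (\<lambda>i. [ns ! i]) [0..<?N])"
    by (simp add: enc_list_def map_nth)
  moreover have "enc_list (list_image prob T j ns) =
      [] @ [] @ [?N * ?s] @ concat (map (\<lambda>i. map (code prob T j) (fiber j (ns ! i))) [0..<?N])"
    by (simp add: enc_list_def length_list_image) (simp add: list_image_def fibers_def map_concat comp_def
        map_nth_eq[of "\<lambda>n. map (code prob T j) (fiber j n)"])
  moreover have "2 + (1 + (2 + (?N * (15 * ?s + 5 + 2) + 1))) \<le> 30 * Z"
    using size unfolding distrib_left mult.left_commute[of "?N" 15] by linarith
  ultimately show ?thesis
    unfolding expand_list_def
      using transduces_Seq[OF read transduces_Seq[OF count transduces_Seq[OF emit loop]]]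
    by (elim transduces_mono) auto
qed

lemma transduces_expand_lists:
  assumes position: "j < k" and nss: "nss \<in> word_lists (n * g) b"
  shows "transduces (n * g * (30 * Z + 2) + 2) (expand_lists prob j) (parameters j) (enc_lists nss)
    (enc_lists (map (list_image prob T j) nss)) (parameters j)"
proof -
  have length: "length nss = n * g" and lists: "\<And>ns. ns \<in> set nss \<Longrightarrow> length ns \<le> 2 ^ b \<and> (\<forall>n\<in>set ns. n < 2 ^ b)"
    using nss by (auto simp: word_lists_def)
  have start: "transduces 1 (Op Add rLists rNG 0) (parameters j) [] [] (\<lambda>R. parameters j R \<and> R rLists = n * g)"
    using sizes_fit by (intro transduces_silent) (auto simp: wp_straight_line parameters_def constants_def)
  have loop: "transduces (n * g * (30 * Z + 2) + 1) (for_loop rLists (expand_list prob j))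
      (\<lambda>R. parameters j R \<and> R rLists = n * g) (concat (map (\<lambda>i. enc_list (nss ! i)) [0..<n * g]))
      (concat (map (\<lambda>i. enc_list (list_image prob T j (nss ! i))) [0..<n * g])) (parameters j)"
  proof (rule transduces_for_loop[where \<Phi> = "\<lambda>_. parameters j"])
    show "transduces (30 * Z) (expand_list prob j) (\<lambda>R. parameters j R \<and>
        R rLists = n * g - i) (enc_list (nss ! i))
        (enc_list (list_image prob T j (nss ! i))) (\<lambda>R. parameters j R \<and> R rLists = n * g - i)"
      if "i < n * g" for i
      using that lists[of "nss ! i"] length by (intro transduces_expand_list[OF position]) simp_all
  qed (use sizes_fit parameters_one in auto)
  show ?thesis
    unfolding expand_lists_def
    by (rule transduces_mono[OF transduces_Seq[OF start loop]])
      (simp_all add: enc_lists_def comp_def map_nth_eq[of enc_list] map_nth_eq[of "\<lambda>ns. enc_list (h ns)" for h]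
        flip: length)
qed

lemma transduces_expand_sets:
  assumes "set js \<subseteq> {..<k}"
  shows "transduces (length js * (n * g * (30 * Z + 2) + 10) + 1) (expand_sets prob js) constants
    (concat (map (\<lambda>j. enc_lists (nsss ! j)) js))
    (concat (map (\<lambda>j. enc_lists (map (list_image prob T j) (nsss ! j))) js)) constants"
  using assms
proof (induction js)
  case Nil
  have "transduces 1 (Const rTmp 0) constants [] [] constants"
    by (intro transduces_silent) (simp add: wp_straight_line)
  then show ?case
    by simp
next
  case (Cons j js)
  then have "j < k"
    by simp
  note set = transduces_Seq[OF transduces_set_parameters transduces_expand_lists, OF this this
    lists_nth[OF this]]
  have "transduces (n * g * (30 * Z + 2) + 10) (set_parameters j ;; expand_lists prob j) constants
      (enc_lists (nsss ! j)) (enc_lists (map (list_image prob T j) (nsss ! j))) constants"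
    by (rule transduces_mono[OF set]) (auto simp: parameters_def)
  from transduces_Seq[OF this Cons.IH] Cons.prems show ?case
    by (simp add: add_ac)
qed

lemma wp_load_constants:
  "wp w (load_constants prob k) (\<lambda>t (R, M). t \<le> 20 \<and> constants R \<and> R rIn = 3 + Z \<and> R rOut = base \<and>
    M = mem input base []) (\<lambda>_. 0, mem input base [])"
proof -
  have cells: "mem input base [] 0 = n" "mem input base [] (Suc 0) = g" "mem input base [] 2 = b"
    by (simp_all add: mem_def input_def)
  have base: "3 + Z + k * (n * g) * Suc (2 ^ b) = base"
    by (simp add: base_def algebra_simps)
  have "k * (n * g) \<le> base" "k * (n * g) * Suc (2 ^ b) \<le> base" "3 + Z \<le> base"
    unfolding base[symmetric] by simp_all
  then have fit: "k * (n * g) < 2 ^ w" "k * (n * g) * Suc (2 ^ b) < 2 ^ w" "3 + Z < 2 ^ w"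
    "2 < (2::nat) ^ w" "3 < (2::nat) ^ w"
    using base_fits(2) by linarith+
  have "(2::nat) ^ b \<le> Z" "1 \<le> Z"
    using two_le_k by simp_all
  then have "Suc (2 ^ b) < 2 ^ w" "Z - Suc 0 < 2 ^ w"
    using Z_fits by linarith+
  moreover have "prob \<noteq> FOV \<Longrightarrow> flag prob = Z" "prob = FOV \<Longrightarrow> flag prob = Z * Z" "Z * Z < 2 ^ w"
    using fits[of "Z * Z"] by (cases prob; simp)+
  ultimately show ?thesis
    using fit sizes_fit base_fits(2) base
    by (simp add: load_constants_def wp_straight_line cells constants_def small_fit mask_eq_exp_minus_1)
qed

lemma transduces_write_header: "transduces 12 (write_header prob k) constants [] [n, g, width prob] constants"
proof -
  have emit: "transduces 2 (emit rN) constants [] [n] constants"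
    "transduces 2 (emit rG) constants [] [g] constants"
    "transduces 2 (emit rTmp) (\<lambda>R. constants R \<and> R rTmp = width prob) [] [width prob] constants"
    by (rule transduces_emit; auto simp: constants_def)+
  have width: "transduces 4 (Const rTmp k ;; Op Mul rTmp rTmp rB ;; width_program prob) constants [] []
      (\<lambda>R. constants R \<and> R rTmp = width prob)"
  proof (rule transduces_silent)
    fix R :: "nat \<Rightarrow> nat" and out :: "nat list"
    assume state: "constants R"
    then have "R rB = b" "R rOne = 1"
      by (simp_all add: constants_def)
    moreover have "constants (R(rTmp := v))" for v
      using state by simp
    ultimately show "wp w (Const rTmp k ;; Op Mul rTmp rTmp rB ;; width_program prob) (\<lambda>t (R', M'). t \<le> 4 \<and>
        (constants R' \<and> R' rTmp = width prob) \<and> R' rIn = R rIn \<and> R' rOut = R rOut \<and> M' = mem input base out)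
        (R, mem input base out)"
      using sizes_fit by (cases prob) (simp_all add: wp_straight_line)
  qed
  from transduces_Seq[OF emit(1) transduces_Seq[OF emit(2) transduces_Seq[OF width emit(3)]]] show ?thesis
    unfolding write_header_def by (rule transduces_mono) auto
qed

lemma wp_clear_registers:
  fixes R :: "nat \<Rightarrow> nat"
  assumes "\<And>r. m < r \<Longrightarrow> R r = 0" "Q (Suc m) (\<lambda>_. 0, M)"
  shows "wp w (clear_registers m) Q (R, M)"
  using assms
proof (induction m arbitrary: Q R)
  case 0
  then have "R(0 := 0) = (\<lambda>_. 0)"
    by auto
  then show ?case
    using 0 by (simp add: wp_Const)
next
  case (Suc m)
  have "wp w (clear_registers m) (\<lambda>t. Q (Suc t)) (R(Suc m := 0), M)"
    using Suc.prems by (intro Suc.IH) auto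
  then show ?case
    by (simp add: wp_Seq wp_Const)
qed

lemma wp_copy_output:
  fixes R :: "nat \<Rightarrow> nat"
  assumes out: "base + length out < 2 ^ w" "\<forall>x\<in>set out. x < 2 ^ w"
    and state: "constants R" "R rOut = base + length out"
  shows "wp w copy_output (\<lambda>t (R', M'). t \<le> length out * 6 + 4 \<and> constants R' \<and> R' rOut = length out \<and>
    M' = (\<lambda>a. if a < length out then out ! a else mem input base out a)) (R, mem input base out)"
proof -
  let ?M = "\<lambda>i a. if a < i then out ! a else mem input base out a"
  let ?R = "R(rLists := length out, rIn := base, rOut := 0)"
  define I where "I i R M \<longleftrightarrow> constants R \<and> R rIn = base + i \<and> R rOut = i \<and> M = ?M i" for i and R M :: "nat \<Rightarrow> nat"
  have "wp w (for_loop rLists (read rTmp ;; emit rTmp))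
      (\<lambda>t (R', M'). t \<le> length out * (4 + 2) + 1 \<and> I (length out) R' M') (?R, mem input base out)"
  proof (rule wp_for_loop)
    fix i R M
    assume i_less: "i < length out" and invariant: "I i R M" and counter: "R rLists = length out - i"
    have "?M i (base + i) = out ! i" "(?M i)(i := out ! i) = ?M (Suc i)" "out ! i < 2 ^ w"
      using i_less out(2) length_input_le by (auto simp: mem_def fun_eq_iff less_Suc_eq)
    moreover have "R rOne = 1"
      using invariant by (simp add: I_def constants_def)
    ultimately show "wp w (read rTmp ;; emit rTmp)
        (\<lambda>t (R', M'). t \<le> 4 \<and> R' rLists = length out - i \<and> I (Suc i) R' M') (R, M)"
      using invariant counter i_less out(1) by (simp add: I_def wp_straight_line read_def emit_def)
  qed (use out(1) state in \<open>auto simp: I_def constants_def\<close>)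
  then have "wp w (for_loop rLists (read rTmp ;; emit rTmp)) (\<lambda>t (R', M'). t \<le> length out * 6 + 1 \<and>
      constants R' \<and>
      R' rOut = length out \<and> M' = ?M (length out)) (?R, mem input base out)"
    by (rule wp_mono) (auto simp: I_def)
  moreover have "R 0 = 0" "R rBase = base"
    using state(1) by (simp_all add: constants_def)
  ultimately show ?thesis
    using state out(1) by (simp add: copy_output_def wp_straight_line)
qed

lemma wp_erase_source:
  fixes R M :: "nat \<Rightarrow> nat"
  assumes "base + l < 2 ^ w" and state: "constants R" "R rOut = l"
  shows "wp w erase_source (\<lambda>t (R', M'). t \<le> base * 4 + 2 \<and> constants R' \<and>
    M' = (\<lambda>a. if l \<le> a \<and> a < l + base then 0 else M a)) (R, M)"
proof -
  let ?M = "\<lambda>i a. if l \<le> a \<and> a < l + i then 0 else M a"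
  define I where "I i R M' \<longleftrightarrow> constants R \<and> R rOut = l + i \<and> M' = ?M i" for i and R M' :: "nat \<Rightarrow> nat"
  have "wp w (for_loop rLists (emit 0)) (\<lambda>t (R', M'). t \<le> base * (2 + 2) + 1 \<and>
      I base R' M') (R(rLists := base), M)"
  proof (rule wp_for_loop)
    fix i R M'
    assume i_less: "i < base" and invariant: "I i R M'" and counter: "R rLists = base - i"
    have "(?M i)(l + i := 0) = ?M (Suc i)"
      by (auto simp: fun_eq_iff less_Suc_eq)
    moreover have "R rOne = 1" "R 0 = 0"
      using invariant by (simp_all add: I_def constants_def)
    ultimately show "wp w (emit 0) (\<lambda>t (R', M'). t \<le> 2 \<and> R' rLists = base - i \<and> I (Suc i) R' M') (R, M')"
      using invariant counter i_less assms(1) by (simp add: I_def wp_straight_line emit_def)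
  qed (use assms(1) state in \<open>auto simp: I_def constants_def\<close>)
  then have "wp w (for_loop rLists (emit 0)) (\<lambda>t (R', M'). t \<le> base * 4 + 1 \<and> constants R' \<and> M' = ?M base)
      (R(rLists := base), M)"
    by (rule wp_mono) (auto simp: I_def)
  moreover have "R 0 = 0" "R rBase = base"
    using state(1) by (simp_all add: constants_def)
  ultimately show ?thesis
    using base_fits(2) by (simp add: erase_source_def wp_straight_line)
qed

lemma wp_move_output:
  fixes R :: "nat \<Rightarrow> nat"
  assumes out: "base + length out < 2 ^ w" "\<forall>x\<in>set out. x < 2 ^ w"
    and state: "constants R" "R rOut = base + length out"
  shows "wp w (copy_output ;; erase_source ;; clear_registers rFlag)
    (\<lambda>t s. t \<le> length out * 6 + base * 4 + 31 \<and> s = initial out) (R, mem input base out)"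
proof -
  let ?M = "\<lambda>a. if a < length out then out ! a else mem input base out a"
  have "(\<lambda>a. if length out \<le> a \<and> a < length out + base then 0 else ?M a) = snd (initial out)"
    using length_input_le by (auto simp: initial_def mem_def)
  then have erase: "wp w (erase_source ;; clear_registers rFlag) (\<lambda>t s. t \<le> base * 4 + 27 \<and>
      s = initial out) (R', ?M)"
    if "constants R'" "R' rOut = length out" for R'
    unfolding wp_Seq
    by (intro wp_mono[OF wp_erase_source[OF out(1) that, where M = ?M]])
      (auto intro!: wp_clear_registers simp: initial_def constants_def)
  show ?thesis
    unfolding wp_Seq[of w copy_output]
  proof (rule wp_mono[OF wp_copy_output[OF out state]], clarify)
    fix t R'
    assume steps: "t \<le> length out * 6 + 4" and state': "constants R'" "R' rOut = length out"
    show "wp w (erase_source ;; clear_registers rFlag) (\<lambda>u s. t + u \<le> length out * 6 + base * 4 + 31 \<and>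
        s = initial out)
        (R', ?M)"
      by (rule wp_mono[OF erase[OF state']]) (use steps in auto)
  qed
qed

lemma transduces_body:
  "transduces (k * (n * g * (30 * Z + 2) + 10) + 13) (write_header prob k ;; expand_sets prob [0..<k]) constants
    (concat (map enc_lists nsss)) translation constants"
proof (rule transduces_mono[OF transduces_Seq[OF transduces_write_header transduces_expand_sets]])
  have "map (\<lambda>j. enc_lists (nsss ! j)) [0..<k] = map enc_lists nsss"
    using lists(1) map_nth_eq by metis
  then show "[] @ concat (map (\<lambda>j. enc_lists (nsss ! j)) [0..<k]) = concat (map enc_lists nsss)"
    by simp
qed (auto simp: translation_def)

lemma reduction_time:
  "20 + (k * (n * g * (30 * Z + 2) + 10) + 13 + (length translation * 6 + base * 4 + 31)) \<le>
    120 * ((k + 1) * ((n * g + 1) * Z))"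
proof -
  let ?m = "k * (n * g)"
  have "(2::nat) ^ b \<le> Z" "1 \<le> Z"
    using two_le_k by simp_all
  then have "?m * 2 ^ b \<le> ?m * Z" "?m * 1 \<le> ?m * Z" "k * 1 \<le> k * Z"
    by (intro mult_le_mono2; simp)+
  moreover have "base = 3 + Z + (?m * 2 ^ b + ?m)" "length translation \<le> 3 + (?m * Z + ?m)"
    using length_translation_le by (simp_all add: base_def algebra_simps)
  moreover have "k * (n * g * (30 * Z + 2) + 10) = 30 * (?m * Z) + 2 * ?m + 10 * k"
    "(k + 1) * ((n * g + 1) * Z) = ?m * Z + k * Z + n * g * Z + Z"
    by (simp_all add: algebra_simps)
  ultimately show ?thesis
    using \<open>1 \<le> Z\<close> by linarith
qed

lemma wp_translate_and_move:
  fixes R :: "nat \<Rightarrow> nat"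
  assumes state: "constants R" "R rIn = 3 + Z" "R rOut = base"
  shows "wp w ((write_header prob k ;; expand_sets prob [0..<k]) ;; copy_output ;; erase_source ;;
      clear_registers rFlag)
    (\<lambda>t s. 20 + t \<le> 120 * ((k + 1) * ((n * g + 1) * Z)) \<and> s = initial translation) (R, mem input base [])"
    (is "wp w (?body ;; ?move) ?post _")
proof -
  have "segment input (3 + Z) (concat (map enc_lists nsss))"
    unfolding segment_def input_def
    by (intro exI[of _ "[n, g, b] @ map (\<lambda>u. of_bool (T u)) [0..<Z]"] exI[of _ "[]"]) simp
  then have body: "wp w ?body (\<lambda>t (R', M'). t \<le> k * (n * g * (30 * Z + 2) + 10) + 13 \<and> constants R' \<and>
      R' rIn = R rIn + length (concat (map enc_lists nsss)) \<and> R' rOut = base + length ([] :: nat list) +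
        length translation \<and>
      M' = mem input base ([] @ translation)) (R, mem input base [])"
    using state base_fits(1) by (intro transducesD[OF transduces_body]) auto
  show ?thesis
    unfolding wp_Seq[of w ?body]
  proof (rule wp_mono[OF body], clarify)
    fix t R'
    assume steps: "t \<le> k * (n * g * (30 * Z + 2) + 10) + 13"
      and state': "constants R'" "R' rOut = base + length ([] :: nat list) + length translation"
    have "wp w ?move (\<lambda>u s. u \<le> length translation * 6 + base * 4 + 31 \<and> s = initial translation)
        (R', mem input base translation)"
      using state' base_fits(1) translation_fits_word by (intro wp_move_output) auto
    then have "wp w ?move (\<lambda>u. ?post (t + u)) (R', mem input base translation)"
      by (rule wp_mono) (use steps reduction_time in linarith)
    then show "wp w ?move (\<lambda>u. ?post (t + u)) (R', mem input base ([] @ translation))"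
      by simp
  qed
qed

lemma exec_reduction:
  "\<exists>t \<le> 120 * ((k + 1) * ((n * g + 1) * Z)). exec w (reduction prob k) (initial input) t (initial translation)"
proof -
  have init: "initial input = (\<lambda>_. 0, mem input base [])"
    by (auto simp: initial_def mem_def)
  have "wp w (reduction prob k) (\<lambda>t s. t \<le> 120 * ((k + 1) * ((n * g + 1) * Z)) \<and> s = initial translation)
      (initial input)"
    unfolding reduction_def wp_Seq[of w "load_constants prob k"] init
  proof (rule wp_mono[OF wp_load_constants], clarify)
    fix t :: nat and R
    assume steps: "t \<le> 20" and state: "constants R" "R rIn = 3 + Z" "R rOut = base"
    show "wp w ((write_header prob k ;; expand_sets prob [0..<k]) ;; copy_output ;; erase_source ;;
        clear_registers rFlag)
        (\<lambda>u s. t + u \<le> 120 * ((k + 1) * ((n * g + 1) * Z)) \<and> s = initial translation) (R, mem input base [])"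
      by (rule wp_mono[OF wp_translate_and_move[OF state]]) (use steps in linarith)
  qed
  then show ?thesis
    unfolding wp_def by blast
qed

end

section \<open>Correctness and running time of the reduction\<close>

context digit_code
begin

lemma truth_table_eq: "truth_table k b f = map (\<lambda>u. of_bool (f (tuple u))) [0..<Z]"
proof -
  have "bits_of b (digit j u) = map (\<lambda>a. bit u (j * b + a)) [0..<b]" for j u
    by (simp add: bits_of_def bit_digit)
  then show ?thesis
    by (simp add: truth_table_def tuple_def)
qed

lemma volume_less:
  assumes "ceillog2 (n + 1) + g + k + 2 * (k * b) + 5 \<le> w"
  shows "16 * volume n g < 2 ^ w"
proof -
  have "volume n g \<le> 2 ^ ceillog2 (n + 1) * 2 ^ g * (2 ^ k * (Z * Z))"
    unfolding volume_def using le_two_power_ceillog2[of "n + 1"] less_exp[of g] less_exp[of k]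
    by (intro mult_le_mono order_refl) (simp_all add: Suc_leI)
  also have "\<dots> = 2 ^ (ceillog2 (n + 1) + g + k + 2 * (k * b))"
    by (simp add: power_add mult_2)
  also have "\<dots> < 2 * 2 ^ (ceillog2 (n + 1) + g + k + 2 * (k * b))"
    by simp
  finally have "16 * volume n g < 2 ^ 5 * 2 ^ (ceillog2 (n + 1) + g + k + 2 * (k * b))"
    by simp
  also have "\<dots> = 2 ^ (ceillog2 (n + 1) + g + k + 2 * (k * b) + 5)"
    by (simp only: power_add mult.commute)
  also have "\<dots> \<le> 2 ^ w"
    using assms by (rule power_increasing) simp
  finally show ?thesis .
qed

theorem exec_reduction_instance:
  assumes inst: "fk_instance k n g b Vs" and enc: "enc_instance Vs xs"
    and word_length: "16 * volume n g < 2 ^ w"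
  obtains Vs' xs' t where "fk_instance k n g (width prob) Vs'" "enc_instance Vs' xs'"
    "factored_count (target prob (width prob)) g Vs' = factored_count f g Vs"
    "t \<le> 120 * ((k + 1) * ((n * g + 1) * Z))"
    "exec w (reduction prob k) (initial ([n, g, b] @ truth_table k b f @ xs)) t
        (initial ([n, g, width prob] @ xs'))"
proof -
  define T where "T u = f (tuple u)" for u
  obtain nsss where nsss: "length nsss = k" "set nsss \<subseteq> word_lists (n * g) b" "xs = concat (map enc_lists nsss)"
    "enc_instance (instance_image prob T Vs)
      (concat (map (\<lambda>j. enc_lists (map (list_image prob T j) (nsss ! j))) [0..<k]))"
    using enc_instance_image[OF inst enc] .
  interpret reduction_input k b w prob T n g nsss
    by unfold_locales (fact nsss(1) nsss(2) word_length)+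
  obtain t where "t \<le> 120 * ((k + 1) * ((n * g + 1) * Z))"
    "exec w (reduction prob k) (initial input) t (initial translation)"
    using exec_reduction by blast
  moreover have "input = [n, g, b] @ truth_table k b f @ xs"
    by (simp add: input_def truth_table_eq T_def nsss(3))
  moreover have "factored_count (target prob (width prob)) g (instance_image prob T Vs) = factored_count f g Vs"
    using inst by (rule factored_count_image) (simp add: T_def)
  ultimately show thesis
    using that fk_instance_image[OF inst] nsss(4) unfolding translation_def by metis
qed

end

definition solves :: "nat \<Rightarrow> (nat \<Rightarrow> nat \<Rightarrow> bits list \<Rightarrow> bool) \<Rightarrow> (nat \<Rightarrow> nat \<Rightarrow> nat list) \<Rightarrow> com \<Rightarrow>
    (nat \<Rightarrow> nat) \<Rightarrow> (nat \<Rightarrow> nat) \<Rightarrow> (nat \<Rightarrow> nat) \<Rightarrow> (nat \<Rightarrow> nat) \<Rightarrow> bool" where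
  "solves k f aux P g b t w \<longleftrightarrow>
     (\<forall>n Vs xs. fk_instance k n (g n) (b n) Vs \<longrightarrow> enc_instance Vs xs \<longrightarrow>
       computes_within (w n) P ([n, g n, b n] @ aux n (b n) @ xs) (t n) (factored_count (f n (b n)) (g n) Vs))"

abbreviation target_solver :: "nat \<Rightarrow> problem \<Rightarrow> com \<Rightarrow>
    (nat \<Rightarrow> nat) \<Rightarrow> (nat \<Rightarrow> nat) \<Rightarrow> (nat \<Rightarrow> nat) \<Rightarrow> (nat \<Rightarrow> nat) \<Rightarrow> bool" where
  "target_solver k prob P g b \<equiv> solves k (\<lambda>n. target prob) (\<lambda>n b. []) P g (\<lambda>n. digit_code.width k (b n) prob)"

definition reduction_steps :: "nat \<Rightarrow> (nat \<Rightarrow> nat) \<Rightarrow> (nat \<Rightarrow> nat) \<Rightarrow> nat \<Rightarrow> nat" where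
  "reduction_steps k g b n = 120 * ((k + 1) * ((n * g n + 1) * 2 ^ (k * b n)))"

definition reduction_word_length :: "nat \<Rightarrow> (nat \<Rightarrow> nat) \<Rightarrow> (nat \<Rightarrow> nat) \<Rightarrow> nat \<Rightarrow> nat" where
  "reduction_word_length k g b n = ceillog2 (n + 1) + g n + k + 2 * (k * b n) + 5"

lemma solves_reduction:
  assumes "2 \<le> k" and solver: "target_solver k prob P g b t w"
  shows "solves k f (\<lambda>n b. truth_table k b (f n b)) (Seq (reduction prob k) P) g b
    (\<lambda>n. reduction_steps k g b n + t n) (\<lambda>n. reduction_word_length k g b n + w n)"
  unfolding solves_def
proof (intro allI impI)
  fix n Vs xs
  let ?w = "reduction_word_length k g b n + w n"
  assume inst: "fk_instance k n (g n) (b n) Vs" and enc: "enc_instance Vs xs"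
  interpret digit_code k "b n"
    using assms(1) by unfold_locales
  have "16 * volume n (g n) < 2 ^ ?w"
    by (rule volume_less) (simp add: reduction_word_length_def)
  from exec_reduction_instance[OF inst enc this, of prob "f n (b n)"]
  obtain Vs' xs' t' where red: "fk_instance k n (g n) (width prob) Vs'" "enc_instance Vs' xs'"
    "factored_count (target prob (width prob)) (g n) Vs' = factored_count (f n (b n)) (g n) Vs"
    "t' \<le> reduction_steps k g b n"
    "exec ?w (reduction prob k) (initial ([n, g n, b n] @ truth_table k (b n) (f n (b n)) @ xs)) t'
      (initial ([n, g n, width prob] @ xs'))"
    unfolding reduction_steps_def by metis
  have "computes_within (w n) P ([n, g n, width prob] @ xs') (t n) (factored_count (f n (b n)) (g n) Vs)"
    using solver red(1-3) unfolding solves_def by fastforce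
  then obtain u R M where run: "u \<le> t n" "exec (w n) P (initial ([n, g n, width prob] @ xs')) u (R, M)"
    "result_in M (factored_count (f n (b n)) (g n) Vs)"
    by (auto simp: computes_within_def)
  have "exec ?w P (initial ([n, g n, width prob] @ xs')) u (R, M)"
    using run(2) by (rule exec_word_length_mono) simp
  from exec.Seq[OF red(5) this]
  show "computes_within ?w (Seq (reduction prob k) P) ([n, g n, b n] @ truth_table k (b n) (f n (b n)) @ xs)
      (reduction_steps k g b n + t n) (factored_count (f n (b n)) (g n) Vs)"
    unfolding computes_within_def using red(4) run(1,3) by (meson add_mono)
qed

section \<open>Asymptotics\<close>

lemma ceillog2_bigo_log: "(\<lambda>n. real (ceillog2 (n + 1))) \<in> O(\<lambda>n. log 2 (real n))"
proof (rule landau_o.big_trans)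
  have "real (ceillog2 (n + 1)) \<le> log 2 (real n + 1) + 1" for n
    using ceillog2_less_log[of "n + 1"] by (simp add: add.commute)
  then show "(\<lambda>n. real (ceillog2 (n + 1))) \<in> O(\<lambda>n. log 2 (real n + 1) + 1)"
    by (intro bigoI[of _ 1] always_eventually allI) (auto intro: order_trans[OF _ abs_ge_self])
  show "(\<lambda>n. log 2 (real n + 1) + 1) \<in> O(\<lambda>n. log 2 (real n))"
    by real_asymp
qed

lemma ceillog2_ceillog2_smallo_log: "(\<lambda>n. real (ceillog2 (ceillog2 n))) \<in> o(\<lambda>n. log 2 (real n))"
proof (rule landau_o.big_small_trans)
  have "real (ceillog2 (ceillog2 n)) \<le> log 2 (log 2 (real n) + 1) + 1" if "2 \<le> n" for n
  proof -
    have "0 < ceillog2 n"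
      using that ceillog2_ge_iff[of n 1] by simp
    then have "real (ceillog2 (ceillog2 n)) \<le> log 2 (real (ceillog2 n)) + 1"
      using ceillog2_less_log less_imp_le by blast
    also have "log 2 (real (ceillog2 n)) \<le> log 2 (log 2 (real n) + 1)"
      using \<open>0 < ceillog2 n\<close> ceillog2_less_log[of n] that by (intro log_mono) simp_all
    finally show ?thesis
      by simp
  qed
  then show "(\<lambda>n. real (ceillog2 (ceillog2 n))) \<in> O(\<lambda>n. log 2 (log 2 (real n) + 1) + 1)"
    by (intro bigoI[of _ 1] eventually_sequentiallyI[of 2]) (auto intro: order_trans[OF _ abs_ge_self])
  show "(\<lambda>n. log 2 (log 2 (real n) + 1) + 1) \<in> o(\<lambda>n. log 2 (real n))"
    by real_asymp
qed

lemma const_smallo_log: "(\<lambda>n. c :: real) \<in> o(\<lambda>n. log 2 (real n))"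
  by real_asymp

lemma admissible_smallo_log:
  assumes "admissible g b"
  shows "(\<lambda>n. real (g n)) \<in> o(\<lambda>n. log 2 (real n))" "(\<lambda>n. real (b n)) \<in> o(\<lambda>n. log 2 (real n))"
proof -
  have "(\<lambda>n. log 2 (real n) / log 2 (log 2 (real n))) \<in> O(\<lambda>n. log 2 (real n))"
    by real_asymp
  then show "(\<lambda>n. real (g n)) \<in> o(\<lambda>n. log 2 (real n))"
    using assms unfolding admissible_def by (blast intro: landau_o.small_big_trans)
  show "(\<lambda>n. real (b n)) \<in> o(\<lambda>n. log 2 (real n))"
    using assms by (simp add: admissible_def)
qed

lemma admissible_width:
  assumes "2 \<le> k" "admissible g b"
  shows "admissible g (\<lambda>n. digit_code.width k (b n) prob)"
proof -
  have "(\<lambda>n. real (2 * k) * real (b n) + 2) \<in> o(\<lambda>n. log 2 (real n))"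
    using admissible_smallo_log(2)[OF assms(2)] by (intro sum_in_smallo const_smallo_log) simp
  moreover have "(\<lambda>n. real (digit_code.width k (b n) prob)) \<in> O(\<lambda>n. real (2 * k) * real (b n) + 2)"
  proof (intro bigoI[of _ 1] always_eventually allI)
    fix n
    interpret digit_code k "b n"
      using assms(1) by unfold_locales
    have "width prob \<le> 2 * k * b n + 2"
      by (cases prob) simp_all
    then have "real (width prob) \<le> real (2 * k * b n + 2)"
      by (simp only: of_nat_le_iff)
    then show "norm (real (width prob)) \<le> 1 * norm (real (2 * k) * real (b n) + 2)"
      by simp
  qed
  ultimately show ?thesis
    using assms(2) unfolding admissible_def by (blast intro: landau_o.big_small_trans)
qed

text \<open>The lower bound is applied to instances with \<open>g = 1\<close> but longer words. These are still admissible,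
  and reading them takes longer than the reduction does.\<close>

definition padded :: "(nat \<Rightarrow> nat) \<Rightarrow> (nat \<Rightarrow> nat) \<Rightarrow> nat \<Rightarrow> nat" where
  "padded g b n = b n + g n + ceillog2 (ceillog2 n) + 2"

lemma admissible_padded:
  assumes "admissible g b"
  shows "admissible (\<lambda>_. 1) (padded g b)"
proof -
  have "(\<lambda>n. real (padded g b n)) \<in> o(\<lambda>n. log 2 (real n))"
    unfolding padded_def of_nat_add of_nat_numeral
    by (intro sum_in_smallo admissible_smallo_log[OF assms] ceillog2_ceillog2_smallo_log const_smallo_log)
  moreover have "(\<lambda>_. 1) \<in> o(\<lambda>n. log 2 (real n) / log 2 (log 2 (real n)))"
    by real_asymp
  ultimately show ?thesis
    by (simp add: admissible_def)
qed

lemma solver_time_padded: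
  assumes "2 \<le> k" "1 \<le> n" and solver: "target_solver k prob P (\<lambda>_. 1) (padded g b) t w"
  shows "(n * g n + 1) * 2 ^ (k * b n) \<le> t n"
proof -
  let ?h = "padded g b n"
  interpret digit_code k ?h
    using assms(1) by unfold_locales
  have "n \<le> 2 ^ ceillog2 n" "ceillog2 n \<le> 2 ^ ceillog2 (ceillog2 n)"
    by (rule le_two_power_ceillog2)+
  moreover have "(2::nat) ^ ceillog2 (ceillog2 n) \<le> 2 ^ ?h"
    by (intro power_increasing) (simp_all add: padded_def)
  ultimately have "n \<le> 2 ^ 2 ^ ?h"
    by (meson le_trans one_le_numeral power_increasing)
  then have reading: "n * (2 ^ (k * ?h - 1) - 2) \<le> t n"
    using solver by (intro reading_lower_bound) (auto simp: solves_def padded_def)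
  have "1 * g n \<le> k * g n"
    using assms(1) by (intro mult_le_mono1) simp
  then have "k * b n + g n + 2 \<le> k * ?h - 1"
    using assms(1) unfolding padded_def distrib_left by linarith
  then have "(2::nat) ^ (k * b n + g n + 2) \<le> 2 ^ (k * ?h - 1)"
    by (rule power_increasing) simp
  moreover have "(2::nat) ^ (k * b n + g n + 2) = 4 * 2 ^ (k * b n + g n)" "1 \<le> (2::nat) ^ (k * b n + g n)"
    by (simp_all add: power_add)
  ultimately have long: "2 ^ (k * b n + g n) \<le> (2::nat) ^ (k * ?h - 1) - 2"
    by linarith
  have "(n * g n + 1) * 2 ^ (k * b n) \<le> n * (g n + 1) * 2 ^ (k * b n)"
    using assms(2) by (intro mult_le_mono1) simp
  also have "\<dots> \<le> n * 2 ^ g n * 2 ^ (k * b n)"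
    using less_exp[of "g n"] by (intro mult_le_mono order_refl) (simp add: Suc_leI)
  also have "\<dots> = n * 2 ^ (k * b n + g n)"
    by (simp add: power_add)
  also have "\<dots> \<le> n * (2 ^ (k * ?h - 1) - 2)"
    using long by (rule mult_le_mono2)
  finally show ?thesis
    using reading by linarith
qed

lemma reduction_steps_bigo:
  assumes "2 \<le> k" "target_solver k prob P (\<lambda>_. 1) (padded g b) t w" "(\<lambda>n. real (t n)) \<in> O(T)"
  shows "(\<lambda>n. real (reduction_steps k g b n)) \<in> O(T)"
proof (rule landau_o.big_trans[OF _ assms(3)])
  have "reduction_steps k g b n \<le> 120 * (k + 1) * t n" if "1 \<le> n" for n
    unfolding reduction_steps_def mult.assoc using solver_time_padded[OF assms(1) that assms(2)]
      by (intro mult_le_mono2)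
  then have "real (reduction_steps k g b n) \<le> real (120 * (k + 1)) * real (t n)" if "1 \<le> n" for n
    using that by (metis of_nat_le_iff of_nat_mult)
  then show "(\<lambda>n. real (reduction_steps k g b n)) \<in> O(\<lambda>n. real (t n))"
    by (intro bigoI[of _ "real (120 * (k + 1))"] eventually_sequentiallyI[of 1]) simp
qed

lemma reduction_word_length_bigo:
  assumes "admissible g b"
  shows "(\<lambda>n. real (reduction_word_length k g b n)) \<in> O(\<lambda>n. log 2 (real n))"
proof -
  have "(\<lambda>n. 2 * (real k * real (b n))) \<in> o(\<lambda>n. log 2 (real n))"
    using admissible_smallo_log(2)[OF assms] by simp
  then have "(\<lambda>n. real (ceillog2 (n + 1)) + real (g n) + real k + 2 * (real k * real (b n)) + 5) \<in>
      O(\<lambda>n. log 2 (real n))"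
    by (intro sum_in_bigo ceillog2_bigo_log landau_o.small_imp_big[OF admissible_smallo_log(1)[OF assms]]
        landau_o.small_imp_big[OF const_smallo_log] landau_o.small_imp_big)
  then show ?thesis
    by (simp add: reduction_word_length_def)
qed

section \<open>The theorem\<close>

lemma fk_solvable_iff:
  "fk_solvable k f aux \<T> \<longleftrightarrow> (\<exists>P. \<forall>g b. admissible g b \<longrightarrow> (\<exists>t w. (\<lambda>n. real (t n)) \<in> \<T> \<and>
     (\<lambda>n. real (w n)) \<in> O(\<lambda>n. log 2 (real n)) \<and> solves k f aux P g b t w))"
  by (simp add: fk_solvable_def solves_def)

lemma Fkf_solvable_if_target_solvable:
  assumes two_le_k: "2 \<le> k" and "fk_solvable k (\<lambda>n. target prob) (\<lambda>n b. []) (O(T))"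
  shows "Fkf_solvable k f (O(T))"
proof -
  obtain P where program: "\<exists>t w. (\<lambda>n. real (t n)) \<in> O(T) \<and> (\<lambda>n. real (w n)) \<in> O(\<lambda>n. log 2 (real n)) \<and>
      target_solver k prob P g b t w" if "admissible g b" for g b
    using assms(2) admissible_width[OF two_le_k] unfolding fk_solvable_iff by metis
  have "\<exists>t w. (\<lambda>n. real (t n)) \<in> O(T) \<and> (\<lambda>n. real (w n)) \<in> O(\<lambda>n. log 2 (real n)) \<and>
      solves k f (\<lambda>n b. truth_table k b (f n b))
        (Seq (reduction prob k) P) g b t w" if adm: "admissible g b" for g b
  proof -
    obtain t w where solver: "(\<lambda>n. real (t n)) \<in> O(T)" "(\<lambda>n. real (w n)) \<in> O(\<lambda>n. log 2 (real n))"
      "target_solver k prob P g b t w"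
      using program[OF adm] by blast
    have "(\<lambda>n. real (reduction_steps k g b n)) \<in> O(T)"
      using program[OF admissible_padded[OF adm]] reduction_steps_bigo[OF two_le_k] by blast
    then have time: "(\<lambda>n. real (reduction_steps k g b n + t n)) \<in> O(T)"
      using solver(1) by (simp add: sum_in_bigo)
    have word_length: "(\<lambda>n. real (reduction_word_length k g b n + w n)) \<in> O(\<lambda>n. log 2 (real n))"
      using reduction_word_length_bigo[OF adm] solver(2) by (simp add: sum_in_bigo)
    show ?thesis
      by (intro exI conjI) (rule time, rule word_length, rule solves_reduction[OF two_le_k solver(3)])
  qed
  then show ?thesis
    unfolding Fkf_solvable_def fk_solvable_iff by blast
qed

lemma fk_solvable_mono: "fk_solvable k f aux \<T> \<Longrightarrow> \<T> \<subseteq> \<T>' \<Longrightarrow> fk_solvable k f aux \<T>'"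
  unfolding fk_solvable_iff by (meson subsetD)

lemma bigo_subset_soft_O: "O(T) \<subseteq> soft_O T"
  unfolding soft_O_def by (rule order_trans[OF _ UN_upper[of 0]]) simp_all

theorem theorem1p9:
  fixes k :: nat and T :: "nat \<Rightarrow> real"
  assumes "k \<ge> 2"
    and "FkOV_solvable k (O(T)) \<or> FkSUM_solvable k (O(T)) \<or> FkXOR_solvable k (O(T))"
  shows "\<forall>f :: nat \<Rightarrow> nat \<Rightarrow> bits list \<Rightarrow> bool. Fkf_solvable k f (soft_O T)"
proof
  fix f
  obtain prob where "fk_solvable k (\<lambda>n. target prob) (\<lambda>n b. []) (O(T))"
    using assms(2) unfolding FkOV_solvable_def FkSUM_solvable_def FkXOR_solvable_def by (metis target.simps)
  then have "Fkf_solvable k f (O(T))"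
    by (rule Fkf_solvable_if_target_solvable[OF assms(1)])
  then show "Fkf_solvable k f (soft_O T)"
    unfolding Fkf_solvable_def using bigo_subset_soft_O by (rule fk_solvable_mono)
qed

end
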